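(* For every integer $d\ge 1$ there exists a constant $C_d>0$ depending only on $d$ such that the following holds. Let $\Omega\subseteq\mathbb{R}^{2d}$ be a compact set with $0<\mathcal{H}^{2d-1}(\partial\Omega)<\infty$ and with regular boundary at scale $\eta>0$. Let $g\in L^2(\mathbb{R}^d)$ satisfy $\|g\|_2=1$ and the following condition with parameter $\beta\ge 1/2$: there are constants $C_g,A>0$ such that for every $n\in\mathbb{N}_0$, $$|V_gg(z)|\le C_g\,A^n\,(n!)^\beta\,(1+|z|)^{-n},\qquad z\in\mathbb{R}^{2d}.$$ For $\delta\in(0,1)$ set $\tau=\max\{\tfrac1\delta,\tfrac1{1-\delta}\}$. Then for all $R>0$, $$\Big|\#\{\lambda\in\sigma(L_{R\cdot\Omega}):\lambda>\delta\}-|R\cdot\Omega|\Big|\le C'_g\cdot\mathcal{H}^{2d-1}(\partial[R\cdot\Omega])\cdot(\log\tau)^{\beta}\left(1+\frac{(\log\tau)^{(2d-1)\beta}}{(R\cdot\eta)^{2d-1}}\right)\frac{\log[\log(\tau)+1]}{\kappa_{\partial\Omega,\eta}},$$ where $C'_g=C_g^{1/2}\cdot A^{3d+2}\cdot C_d^\beta$.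
   Context: Short-time Fourier transform: for $f,g\in L^2(\mathbb{R}^d)$, $V_gf(x,\xi)=\int_{\mathbb{R}^d}f(t)\overline{g(t-x)}e^{-2\pi i\xi t}\,dt$, $(x,\xi)\in\mathbb{R}^d\times\mathbb{R}^d$. If $\|g\|_2=1$, then $V_g:L^2(\mathbb{R}^d)\to L^2(\mathbb{R}^{2d})$ is an isometry. Time-frequency concentration operator: for compact $\Omega\subset\mathbb{R}^{2d}$, $L_\Omega:L^2(\mathbb{R}^d)\to L^2(\mathbb{R}^d)$ is $L_\Omega f=V_g^*[1_\Omega\cdot V_gf]$, i.e. $L_\Omega f(t)=\int_\Omega V_gf(x,\xi)\,g(t-x)e^{2\pi i\xi t}\,dx\,d\xi$. It is positive semi-definite and contractive. Eigenvalues are counted with multiplicity: $\#\{\lambda\in\sigma(L_\Omega):\lambda>\delta\}=\mathrm{trace}[1_{(\delta,\infty)}(L_\Omega)]$. $R\cdot\Omega=\{Rz:z\in\Omega\}$ is the dilation of $\Omega$. $|\Omega|$ is Lebesgue measure, $\mathcal{H}^{2d-1}$ is $(2d-1)$-dimensional Hausdorff measure, $\partial\Omega$ is the topological boundary, $|z|$ is the Euclidean norm, $B_r(z)$ is the Euclidean ball. Regular boundary: a compact $\Omega\subseteq\mathbb{R}^{2d}$ has regular boundary at scale $\eta>0$ if there is $\kappa>0$ with $\mathcal{H}^{2d-1}(\partial\Omega\cap B_r(z))\ge\kappa\,r^{2d-1}$ for all $0<r\le\eta$ and $z\in\partial\Omega$. The largest such constant is $\kappa_{\partial\Omega,\eta}=\inf_{0<r\le\eta}\inf_{z\in\partial\Omega}r^{-(2d-1)}\mathcal{H}^{2d-1}(\partial\Omega\cap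 B_r(z))$. *)

theory Defs
  imports "HOL-Analysis.Analysis"
begin

section \<open>Hausdorff measure\<close>

text \<open>
  The factor \<open>unit_ball_vol s / 2 ^ s\<close> is the usual normalization, for which the
  \<open>s\<close>-dimensional Hausdorff measure of \<open>s\<close>-dimensional Euclidean space is Lebesgue measure.
  \<open>diameter\<close> is only meaningful on bounded sets, and empty members of a cover must contribute
  nothing even for \<open>s = 0\<close> (where \<open>0 ^ 0 = 1\<close>).
\<close>

definition hausdorff_premeasure :: "nat \<Rightarrow> real \<Rightarrow> 'a::metric_space set \<Rightarrow> ennreal" where
  "hausdorff_premeasure s \<epsilon> A =
     (INF U \<in> {U :: nat \<Rightarrow> 'a set. A \<subseteq> (\<Union>i. U i) \<and> (\<forall>i. bounded (U i) \<and> diameter (U i) \<le> \<epsilon>)}.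
        \<Sum>i. if U i = {} then 0 else ennreal (unit_ball_vol (real s) * (diameter (U i) / 2) ^ s))"

definition hausdorff_measure :: "nat \<Rightarrow> 'a::metric_space set \<Rightarrow> ennreal" where
  "hausdorff_measure s A = (SUP \<epsilon> \<in> {0<..}. hausdorff_premeasure s \<epsilon> A)"

section \<open>Regular boundary\<close>

definition regular_boundary :: "real \<Rightarrow> 'b::euclidean_space set \<Rightarrow> bool" where
  "regular_boundary \<eta> \<Omega> \<longleftrightarrow>
     (\<exists>\<kappa>>0. \<forall>r z. 0 < r \<longrightarrow> r \<le> \<eta> \<longrightarrow> z \<in> frontier \<Omega> \<longrightarrow>
        hausdorff_measure (DIM('b) - 1) (frontier \<Omega> \<inter> ball z r) \<ge> ennreal (\<kappa> * r ^ (DIM('b) - 1)))"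

definition boundary_kappa :: "real \<Rightarrow> 'b::euclidean_space set \<Rightarrow> ennreal" where
  "boundary_kappa \<eta> \<Omega> =
     (INF r \<in> {0<..\<eta>}. INF z \<in> frontier \<Omega>.
        hausdorff_measure (DIM('b) - 1) (frontier \<Omega> \<inter> ball z r) / ennreal (r ^ (DIM('b) - 1)))"

section \<open>Square-integrable functions\<close>

text \<open>
  Elements of \<open>L\<^sup>2\<close> are handled through representatives; identities between them are
  understood almost everywhere.
\<close>

definition L2 :: "('a::euclidean_space \<Rightarrow> complex) set" where
  "L2 = {f. f \<in> borel_measurable lebesgue \<and> integrable lebesgue (\<lambda>t. (cmod (f t))\<^sup>2)}"

definition L2_norm :: "('a::euclidean_space \<Rightarrow> complex) \<Rightarrow> real" where
  "L2_norm f = sqrt (LINT t|lebesgue. (cmod (f t))\<^sup>2)"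

text \<open>
  The dimension of (the image in \<open>L\<^sup>2\<close> of) a subspace of representatives: the supremum of the
  lengths of families that are linearly independent modulo null functions.
\<close>

definition L2_dim :: "('a::euclidean_space \<Rightarrow> complex) set \<Rightarrow> enat" where
  "L2_dim E = Sup {enat n |n. \<exists>f :: nat \<Rightarrow> 'a \<Rightarrow> complex. (\<forall>i<n. f i \<in> E) \<and>
     (\<forall>c :: nat \<Rightarrow> complex. (AE t in lebesgue. (\<Sum>i<n. c i * f i t) = 0) \<longrightarrow> (\<forall>i<n. c i = 0))}"

section \<open>Spectrum and eigenvalue counting for operators on \<open>L\<^sup>2\<close>\<close>

text \<open>
  \<open>\<mu>\<close> is outside the spectrum iff \<open>T - \<mu>\<close> has a bounded inverse on \<open>L\<^sup>2\<close>, that is, iff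
  \<open>T - \<mu>\<close> is onto and bounded below.
\<close>

definition L2_spectrum ::
  "(('a::euclidean_space \<Rightarrow> complex) \<Rightarrow> ('a \<Rightarrow> complex)) \<Rightarrow> complex set" where
  "L2_spectrum T = {\<mu>. \<not> ((\<forall>h\<in>L2. \<exists>f\<in>L2. AE t in lebesgue. T f t - \<mu> * f t = h t) \<and>
                         (\<exists>K. \<forall>f\<in>L2. L2_norm f \<le> K * L2_norm (\<lambda>t. T f t - \<mu> * f t)))}"

definition L2_eigenspace ::
  "(('a::euclidean_space \<Rightarrow> complex) \<Rightarrow> ('a \<Rightarrow> complex)) \<Rightarrow> complex \<Rightarrow> ('a \<Rightarrow> complex) set" where
  "L2_eigenspace T \<mu> = {f \<in> L2. AE t in lebesgue. T f t = \<mu> * f t}"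

text \<open>
  The number of \<open>\<mu> > \<delta>\<close> in the spectrum, each counted with its multiplicity.  The value is
  extended so that infinitely many eigenvalues, or one of infinite multiplicity, give \<open>\<infinity>\<close>.
  For compact self-adjoint \<open>T\<close> and \<open>\<delta> > 0\<close> all these \<open>\<mu>\<close> are eigenvalues, and this is the trace of
  the spectral projection of \<open>T\<close> onto \<open>(\<delta>, \<infinity>)\<close>.
\<close>

definition eigenvalue_count ::
  "(('a::euclidean_space \<Rightarrow> complex) \<Rightarrow> ('a \<Rightarrow> complex)) \<Rightarrow> real \<Rightarrow> ennreal" where
  "eigenvalue_count T \<delta> =
     (\<Sum>\<^sub>\<infinity>\<mu> \<in> {\<mu>::real. complex_of_real \<mu> \<in> L2_spectrum T \<and> \<mu> > \<delta>}.
        ennreal_of_enat (L2_dim (L2_eigenspace T (complex_of_real \<mu>))))"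

section \<open>Time-frequency concentration operators\<close>

definition stft :: "('a::euclidean_space \<Rightarrow> complex) \<Rightarrow> ('a \<Rightarrow> complex) \<Rightarrow> 'a \<times> 'a \<Rightarrow> complex" where
  "stft g f = (\<lambda>(x, \<xi>). LINT t|lebesgue. f t * cnj (g (t - x)) * cis (- 2 * pi * (\<xi> \<bullet> t)))"

definition concentration_op ::
  "('a::euclidean_space \<Rightarrow> complex) \<Rightarrow> ('a \<times> 'a) set \<Rightarrow> ('a \<Rightarrow> complex) \<Rightarrow> 'a \<Rightarrow> complex" where
  "concentration_op g \<Omega> f t =
     (LINT z:\<Omega>|lebesgue. stft g f z * g (t - fst z) * cis (2 * pi * (snd z \<bullet> t)))"

end

theory Submission
  imports Defs "HOL-Probability.Characteristic_Functions" "HOL-Complex_Analysis.Great_Picard"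
begin

text \<open>
  Write \<open>k\<^sub>z\<close> for the time-frequency shift of \<open>g\<close> by \<open>z\<close>, so that \<open>V\<^sub>g f(z) = \<langle>f, k\<^sub>z\<rangle>\<close> and
  \<open>\<langle>L\<^sub>\<Omega> f, h\<rangle> = \<integral>\<^sub>\<Omega> V\<^sub>g f \<cdot> cnj (V\<^sub>g h)\<close>.  Let \<open>Q\<close> be the spectral projection of \<open>L\<^sub>\<Omega>\<close> onto the
  eigenvalues above \<open>\<delta>\<close> and \<open>\<rho>(z) = \<langle>Q k\<^sub>z, k\<^sub>z\<rangle> \<in> [0, 1]\<close>.  By Moyal's identity \<open>\<rho>\<close> integrates to the
  eigenvalue count \<open>N\<close>, hence \<open>N - |\<Omega>| \<le> \<integral> \<rho>\<close> over the complement of \<open>\<Omega>\<close> and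
  \<open>|\<Omega>| - N \<le> \<integral>\<^sub>\<Omega> (1 - \<rho>)\<close>.  Since \<open>\<delta> Q \<le> L\<^sub>\<Omega>\<close> and \<open>(1 - \<delta>)(1 - Q) \<le> 1 - L\<^sub>\<Omega>\<close>, both integrands are at
  most \<open>min 1 (\<tau> \<Phi>(dist(z, \<partial>\<Omega>)))\<close>, where \<open>\<Phi>(s)\<close> is the integral of \<open>|V\<^sub>g g|\<^sup>2\<close> over \<open>|w| \<ge> s\<close>.
  The decay of \<open>V\<^sub>g g\<close> makes \<open>\<tau> \<Phi>(s)\<close> small and rapidly decreasing beyond some
  \<open>s = r \<sim> (log \<tau>)\<^sup>\<beta>\<close>, and regularity of the boundary bounds the volume of its neighbourhoods, because
  well-separated boundary points carry disjoint pieces of boundary measure.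
\<close>

section \<open>Hausdorff measure and neighbourhoods of regular sets\<close>

text \<open>The projection \<open>Q\<close> is never constructed. Its place is taken by a finite
  orthonormal family of eigenvectors with eigenvalues above \<delta> (\<open>eigenfam\<close>). The
  upper bound for the length holds for every such family, so a longest one exists, and the
  eigenvalue count equals its length. On the orthogonal complement of a longest family the quadratic
  form is at most \<delta> times the squared norm: otherwise compactness of the operator would
  produce one more eigenvector. The shape of the constant is the second obstacle:
  \<open>A ^ (3 * d + 2)\<close> must survive for \<open>A < 1\<close>, and only
  \<open>sqrt Cg\<close> may appear. Both rest on the value 1 of \<open>stft g g\<close> at the
  origin, which turns the decay hypothesis into
  \<open>1 \<le> Cg * A ^ n * (fact n) powr \<beta>\<close> for all \<open>n\<close>. The exponent
  \<open>3 * d\<close> is \<open>3 / 2 * (2 * d)\<close>: the scale \<open>r\<close> contains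
  \<open>max A 1\<close> to the power \<open>3 / 2\<close> and is raised to at most the power
  \<open>2 * d\<close>. The factor \<open>ln (ln \<tau> + 1)\<close> enters through its lower bound
  \<open>1 / 3\<close>, valid since \<tau> is at least 2.\<close>

definition hausdorff_gauge :: "nat \<Rightarrow> 'a::metric_space set \<Rightarrow> ennreal" where
  "hausdorff_gauge s U =
     (if U = {} then 0 else ennreal (unit_ball_vol (real s) * (diameter U / 2) ^ s))"

lemma hausdorff_gauge_empty [simp]: "hausdorff_gauge s {} = 0"
  by (simp add: hausdorff_gauge_def)

lemma hausdorff_premeasure_le:
  assumes "A \<subseteq> (\<Union>i. U i)" "\<And>i. bounded (U i)" "\<And>i. diameter (U i) \<le> \<epsilon>"
  shows "hausdorff_premeasure s \<epsilon> A \<le> (\<Sum>i. hausdorff_gauge s (U i))"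
  unfolding hausdorff_premeasure_def hausdorff_gauge_def
  using assms by (intro INF_lower) auto

lemma hausdorff_premeasure_greatest:
  assumes "\<And>U. A \<subseteq> (\<Union>i. U i) \<Longrightarrow> (\<And>i. bounded (U i)) \<Longrightarrow> (\<And>i. diameter (U i) \<le> \<epsilon>) \<Longrightarrow>
             c \<le> (\<Sum>i::nat. hausdorff_gauge s (U i))"
  shows "c \<le> hausdorff_premeasure s \<epsilon> A"
  unfolding hausdorff_premeasure_def hausdorff_gauge_def[symmetric]
  using assms by (intro INF_greatest) auto

lemma hausdorff_premeasure_antimono:
  assumes "\<epsilon> \<le> \<epsilon>'"
  shows "hausdorff_premeasure s \<epsilon>' A \<le> hausdorff_premeasure s \<epsilon> A"
proof (rule hausdorff_premeasure_greatest)
  fix U :: "nat \<Rightarrow> 'a set"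
  assume U: "A \<subseteq> (\<Union>i. U i)" "\<And>i. bounded (U i)" "\<And>i. diameter (U i) \<le> \<epsilon>"
  show "hausdorff_premeasure s \<epsilon>' A \<le> (\<Sum>i. hausdorff_gauge s (U i))"
    by (rule hausdorff_premeasure_le[OF U(1,2) order_trans[OF U(3) assms]])
qed

lemma hausdorff_premeasure_le_measure:
  assumes "\<epsilon> > 0"
  shows "hausdorff_premeasure s \<epsilon> A \<le> hausdorff_measure s A"
  unfolding hausdorff_measure_def using assms by (intro SUP_upper) auto

text \<open>The premeasure decreases in its scale, so any sequence of scales tending to 0 gives the
  same supremum. A sequence is wanted because increasing suprema commute with finite sums; the free
  \<open>c\<close> lets it start below a prescribed gap.\<close>

lemma hausdorff_measure_eq_SUP:
  assumes "c > 0"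
  shows "hausdorff_measure s A = (SUP n. hausdorff_premeasure s (c / Suc n) A)"
proof (rule antisym)
  show "hausdorff_measure s A \<le> (SUP n. hausdorff_premeasure s (c / Suc n) A)"
    unfolding hausdorff_measure_def
  proof (rule SUP_least)
    fix \<epsilon> :: real assume "\<epsilon> \<in> {0<..}"
    then obtain n where "inverse (real (Suc n)) < \<epsilon> / c"
      using assms reals_Archimedean[of "\<epsilon> / c"] by auto
    hence "c / Suc n \<le> \<epsilon>" using assms by (simp add: field_simps)
    thus "hausdorff_premeasure s \<epsilon> A \<le> (SUP n. hausdorff_premeasure s (c / Suc n) A)"
      by (meson SUP_upper2 UNIV_I hausdorff_premeasure_antimono)
  qed
  show "(SUP n. hausdorff_premeasure s (c / Suc n) A) \<le> hausdorff_measure s A"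
    using assms by (intro SUP_least hausdorff_premeasure_le_measure) auto
qed

text \<open>A cover member of diameter at most \<epsilon> cannot meet two of the sets
  \<open>B z\<close>. Every cover of \<open>A\<close> therefore splits into disjoint subfamilies,
  one covering each \<open>B z\<close>; members that miss \<open>B z\<close> are replaced by the
  empty set, whose gauge is 0.\<close>

lemma hausdorff_premeasure_separated_sum:
  fixes B :: "'i \<Rightarrow> 'a::metric_space set"
  assumes "finite Z" and sub: "\<And>z. z \<in> Z \<Longrightarrow> B z \<subseteq> A"
    and sep: "\<And>z z' x y. z \<in> Z \<Longrightarrow> z' \<in> Z \<Longrightarrow> z \<noteq> z' \<Longrightarrow> x \<in> B z \<Longrightarrow> y \<in> B z' \<Longrightarrow> \<epsilon> < dist x y"
  shows "(\<Sum>z\<in>Z. hausdorff_premeasure s \<epsilon> (B z)) \<le> hausdorff_premeasure s \<epsilon> A"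
proof (rule hausdorff_premeasure_greatest)
  fix U :: "nat \<Rightarrow> 'a set"
  assume U: "A \<subseteq> (\<Union>i. U i)" "\<And>i. bounded (U i)" "\<And>i. diameter (U i) \<le> \<epsilon>"
  define W where "W z i = (if U i \<inter> B z = {} then {} else U i)" for z i
  have "hausdorff_premeasure s \<epsilon> (B z) \<le> (\<Sum>i. hausdorff_gauge s (W z i))" if "z \<in> Z" for z
  proof (rule hausdorff_premeasure_le)
    show "B z \<subseteq> (\<Union>i. W z i)" using U(1) sub[OF that] unfolding W_def by fastforce
    \<comment> \<open>Needed for the members replaced by the empty set, whose diameter is 0.\<close>
    have "0 \<le> \<epsilon>" using U(3)[of 0] diameter_ge_0[OF U(2)[of 0]] by linarith
    then show "bounded (W z i)" "diameter (W z i) \<le> \<epsilon>" for i using U by (auto simp: W_def)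
  qed
  hence "(\<Sum>z\<in>Z. hausdorff_premeasure s \<epsilon> (B z)) \<le> (\<Sum>z\<in>Z. \<Sum>i. hausdorff_gauge s (W z i))"
    by (rule sum_mono)
  also have "\<dots> = (\<Sum>i. \<Sum>z\<in>Z. hausdorff_gauge s (W z i))"
    by (rule suminf_sum[symmetric]) auto
  also have "\<dots> \<le> (\<Sum>i. hausdorff_gauge s (U i))"
  proof (rule suminf_le)
    fix i
    have one: "z = z'" if "z \<in> Z" "z' \<in> Z" "U i \<inter> B z \<noteq> {}" "U i \<inter> B z' \<noteq> {}" for z z'
    proof (rule ccontr)
      assume "z \<noteq> z'"
      from that obtain x y where xy: "x \<in> U i" "x \<in> B z" "y \<in> U i" "y \<in> B z'" by (metis disjoint_iff)
      have "dist x y \<le> diameter (U i)" using U(2) xy diameter_bounded_bound by blast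
      thus False using sep[OF that(1,2) \<open>z \<noteq> z'\<close> xy(2,4)] U(3)[of i] by linarith
    qed
    show "(\<Sum>z\<in>Z. hausdorff_gauge s (W z i)) \<le> hausdorff_gauge s (U i)"
    proof (cases "\<exists>z\<in>Z. U i \<inter> B z \<noteq> {}")
      case True
      then obtain z0 where z0: "z0 \<in> Z" "U i \<inter> B z0 \<noteq> {}" by auto
      have "W z i = {}" if "z \<in> Z - {z0}" for z
        using one[of z z0] z0 that by (auto simp: W_def)
      hence "(\<Sum>z\<in>Z. hausdorff_gauge s (W z i)) = (\<Sum>z\<in>{z0}. hausdorff_gauge s (W z i))"
        using z0(1) \<open>finite Z\<close> by (intro sum.mono_neutral_right) auto
      thus ?thesis by (simp add: W_def)
    qed (simp add: W_def)
  qed auto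
  finally show "(\<Sum>z\<in>Z. hausdorff_premeasure s \<epsilon> (B z)) \<le> (\<Sum>i. hausdorff_gauge s (U i))" .
qed

text \<open>Superadditivity over positively separated sets, with no measurability of the sets
  involved. All scales in the supremum are at most \<open>gap / 2\<close>, so the premeasure version
  applies to each of them.\<close>

lemma hausdorff_measure_separated_sum:
  fixes B :: "'i \<Rightarrow> 'a::metric_space set"
  assumes "finite Z" and sub: "\<And>z. z \<in> Z \<Longrightarrow> B z \<subseteq> A" and "gap > 0"
    and sep: "\<And>z z' x y. z \<in> Z \<Longrightarrow> z' \<in> Z \<Longrightarrow> z \<noteq> z' \<Longrightarrow> x \<in> B z \<Longrightarrow> y \<in> B z' \<Longrightarrow> gap \<le> dist x y"
  shows "(\<Sum>z\<in>Z. hausdorff_measure s (B z)) \<le> hausdorff_measure s A"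
proof -
  let ?p = "\<lambda>n S. hausdorff_premeasure s (gap / 2 / Suc n) S"
  have inc: "incseq (\<lambda>n. ?p n S)" for S :: "'a set"
    using \<open>gap > 0\<close> by (intro incseq_SucI hausdorff_premeasure_antimono) (auto simp: field_simps)
  have "(\<Sum>z\<in>Z. hausdorff_measure s (B z)) = (\<Sum>z\<in>Z. SUP n. ?p n (B z))"
    using \<open>gap > 0\<close> by (subst hausdorff_measure_eq_SUP[of "gap / 2"]) auto
  also have "\<dots> = (SUP n. \<Sum>z\<in>Z. ?p n (B z))"
    using inc by (subst ennreal_SUP_sum) (auto simp: mono_def)
  also have "\<dots> \<le> (SUP n. ?p n A)"
  proof (intro SUP_mono' hausdorff_premeasure_separated_sum assms)
    fix n z z' x y assume "z \<in> Z" "z' \<in> Z" "z \<noteq> z'" "x \<in> B z" "y \<in> B z'"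
    from sep[OF this] have "gap \<le> dist x y" .
    moreover have "gap / 2 / Suc n \<le> gap / 2" using \<open>gap > 0\<close> by (simp add: field_simps)
    ultimately show "gap / 2 / real (Suc n) < dist x y" using \<open>gap > 0\<close> by linarith
  qed
  also have "\<dots> = hausdorff_measure s A"
    using \<open>gap > 0\<close> by (subst hausdorff_measure_eq_SUP[of "gap / 2"]) auto
  finally show ?thesis .
qed

section \<open>Hausdorff measure under dilations\<close>

lemma diameter_scaleR_le:
  fixes U :: "'a::real_normed_vector set"
  assumes "bounded U" "c \<ge> 0"
  shows "diameter ((\<lambda>x. c *\<^sub>R x) ` U) \<le> c * diameter U"
proof (rule diameter_le)
  show "(\<lambda>x. c *\<^sub>R x) ` U \<noteq> {} \<or> 0 \<le> c * diameter U"
    using assms diameter_ge_0 by auto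
  fix x y assume "x \<in> (\<lambda>x. c *\<^sub>R x) ` U" "y \<in> (\<lambda>x. c *\<^sub>R x) ` U"
  then obtain a b where ab: "a \<in> U" "b \<in> U" "x = c *\<^sub>R a" "y = c *\<^sub>R b" by auto
  have "norm (a - b) \<le> diameter U"
    using diameter_bounded_bound[OF assms(1) ab(1,2)] by (simp add: dist_norm)
  thus "norm (x - y) \<le> c * diameter U"
    using assms(2) unfolding ab by (simp add: scaleR_diff_right[symmetric] mult_left_mono)
qed

text \<open>Covers of the image are pulled back by the factor \<open>1 / R\<close>; diameters shrink
  by \<open>R\<close> and gauges by \<open>R ^ s\<close>.\<close>

lemma hausdorff_premeasure_scaleR:
  fixes A :: "'a::real_normed_vector set"
  assumes "R > 0"
  shows "ennreal (R ^ s) * hausdorff_premeasure s (\<epsilon> / R) A \<le> hausdorff_premeasure s \<epsilon> ((\<lambda>x. R *\<^sub>R x) ` A)"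
proof (rule hausdorff_premeasure_greatest)
  fix V :: "nat \<Rightarrow> 'a set"
  assume V: "(\<lambda>x. R *\<^sub>R x) ` A \<subseteq> (\<Union>i. V i)" "\<And>i. bounded (V i)" "\<And>i. diameter (V i) \<le> \<epsilon>"
  define U where "U i = (\<lambda>x. (1 / R) *\<^sub>R x) ` V i" for i
  have d: "diameter (U i) \<le> diameter (V i) / R" for i
    using diameter_scaleR_le[OF V(2)[of i], of "1 / R"] assms by (simp add: U_def)
  have "hausdorff_premeasure s (\<epsilon> / R) A \<le> (\<Sum>i. hausdorff_gauge s (U i))"
  proof (rule hausdorff_premeasure_le)
    show "A \<subseteq> (\<Union>i. U i)"
    proof
      fix x assume "x \<in> A"
      then obtain i where "R *\<^sub>R x \<in> V i" using V(1) by auto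
      hence "x \<in> U i" unfolding U_def using assms by (auto intro!: image_eqI[of _ _ "R *\<^sub>R x"])
      thus "x \<in> (\<Union>i. U i)" by auto
    qed
    show "bounded (U i)" for i unfolding U_def using V(2) by (rule bounded_scaling)
    show "diameter (U i) \<le> \<epsilon> / R" for i
      using d[of i] V(3)[of i] assms by (meson divide_right_mono less_imp_le order_trans)
  qed
  hence "ennreal (R ^ s) * hausdorff_premeasure s (\<epsilon> / R) A \<le> ennreal (R ^ s) * (\<Sum>i. hausdorff_gauge s (U i))"
    by (rule mult_left_mono) simp
  also have "\<dots> = (\<Sum>i. ennreal (R ^ s) * hausdorff_gauge s (U i))" by simp
  also have "\<dots> \<le> (\<Sum>i. hausdorff_gauge s (V i))"
  proof (rule suminf_le)
    fix i
    show "ennreal (R ^ s) * hausdorff_gauge s (U i) \<le> hausdorff_gauge s (V i)"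
    proof (cases "V i = {}")
      case False
      have bU: "bounded (U i)" unfolding U_def using V(2) by (rule bounded_scaling)
      have "R * (diameter (U i) / 2) \<le> diameter (V i) / 2"
        using d[of i] assms by (simp add: field_simps)
      hence "(R * (diameter (U i) / 2)) ^ s \<le> (diameter (V i) / 2) ^ s"
        using assms diameter_ge_0[OF bU] by (intro power_mono) auto
      hence "R ^ s * (unit_ball_vol (real s) * (diameter (U i) / 2) ^ s)
          \<le> unit_ball_vol (real s) * (diameter (V i) / 2) ^ s"
        by (subst mult.left_commute, subst power_mult_distrib[symmetric]) (auto intro!: mult_left_mono)
      moreover have "U i \<noteq> {}" using False by (simp add: U_def)
      ultimately show ?thesis using assms False
        by (simp add: hausdorff_gauge_def ennreal_mult'[symmetric] ennreal_leI)
    qed (simp add: U_def)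
  qed auto
  finally show "ennreal (R ^ s) * hausdorff_premeasure s (\<epsilon> / R) A \<le> (\<Sum>i. hausdorff_gauge s (V i))" .
qed

lemma hausdorff_measure_scaleR_ge:
  fixes A :: "'a::real_normed_vector set"
  assumes "R > 0"
  shows "ennreal (R ^ s) * hausdorff_measure s A \<le> hausdorff_measure s ((\<lambda>x. R *\<^sub>R x) ` A)"
proof -
  have "ennreal (R ^ s) * hausdorff_measure s A
      = (SUP \<epsilon> \<in> {0<..}. ennreal (R ^ s) * hausdorff_premeasure s \<epsilon> A)"
    unfolding hausdorff_measure_def by (rule SUP_mult_left_ennreal)
  also have "\<dots> \<le> hausdorff_measure s ((\<lambda>x. R *\<^sub>R x) ` A)"
  proof (rule SUP_least)
    fix \<epsilon> :: real assume e: "\<epsilon> \<in> {0<..}"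
    have "ennreal (R ^ s) * hausdorff_premeasure s \<epsilon> A
       \<le> hausdorff_premeasure s (R * \<epsilon>) ((\<lambda>x. R *\<^sub>R x) ` A)"
      using hausdorff_premeasure_scaleR[OF assms, of s "R * \<epsilon>" A] assms by simp
    also have "\<dots> \<le> hausdorff_measure s ((\<lambda>x. R *\<^sub>R x) ` A)"
      using e assms by (intro hausdorff_premeasure_le_measure) auto
    finally show "ennreal (R ^ s) * hausdorff_premeasure s \<epsilon> A \<le> hausdorff_measure s ((\<lambda>x. R *\<^sub>R x) ` A)" .
  qed
  finally show ?thesis .
qed

text \<open>Scaling the image back by \<open>1 / R\<close> returns \<open>A\<close>, so the lower
  bound for dilations, used with \<open>1 / R\<close>, becomes an upper bound for the measure of the
  image.\<close>

lemma hausdorff_measure_scaleR_finite: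
  fixes A :: "'a::real_normed_vector set"
  assumes "R > 0" "hausdorff_measure s A < \<infinity>"
  shows "hausdorff_measure s ((\<lambda>x. R *\<^sub>R x) ` A) < \<infinity>"
proof -
  have "(\<lambda>x. (1 / R) *\<^sub>R x) ` (\<lambda>x. R *\<^sub>R x) ` A = A"
    using assms(1) by (auto simp: image_image)
  hence "ennreal ((1 / R) ^ s) * hausdorff_measure s ((\<lambda>x. R *\<^sub>R x) ` A) \<le> hausdorff_measure s A"
    using hausdorff_measure_scaleR_ge[of "1 / R" s "(\<lambda>x. R *\<^sub>R x) ` A"] assms(1) by simp
  hence "ennreal ((1 / R) ^ s) * hausdorff_measure s ((\<lambda>x. R *\<^sub>R x) ` A) < \<infinity>"
    using assms(2) by (rule le_less_trans)
  thus ?thesis using assms(1) by (auto simp: ennreal_mult_less_top)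
qed

section \<open>Volume of neighbourhoods of regular sets\<close>

lemma separated_set_card_le:
  fixes X :: "'b::euclidean_space set"
  assumes reg: "\<And>z. z \<in> X \<Longrightarrow> ennreal q \<le> hausdorff_measure k (X \<inter> ball z s)"
    and H: "hausdorff_measure k X \<le> ennreal h" and "s > 0" "q > 0" "h \<ge> 0"
    and Z: "finite Z" "Z \<subseteq> X" "\<And>z z'. z \<in> Z \<Longrightarrow> z' \<in> Z \<Longrightarrow> z \<noteq> z' \<Longrightarrow> 3 * s \<le> dist z z'"
  shows "real (card Z) \<le> h / q"
proof -
  have "ennreal (card Z * q) = (\<Sum>z\<in>Z. ennreal q)"
    using \<open>q > 0\<close> by (simp add: ennreal_mult ennreal_of_nat_eq_real_of_nat)
  also have "\<dots> \<le> (\<Sum>z\<in>Z. hausdorff_measure k (X \<inter> ball z s))"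
    using Z(2) by (intro sum_mono reg) auto
  \<comment> \<open>Centres at distance at least \<open>3 * s\<close> have balls of radius
    \<open>s\<close> that stay at distance at least \<open>s\<close> from each other, so
    superadditivity applies.\<close>
  also have "\<dots> \<le> hausdorff_measure k X"
  proof (rule hausdorff_measure_separated_sum[OF Z(1) _ \<open>s > 0\<close>])
    fix z z' x y assume zz: "z \<in> Z" "z' \<in> Z" "z \<noteq> z'" and "x \<in> X \<inter> ball z s" "y \<in> X \<inter> ball z' s"
    moreover have "3 * s \<le> dist z z'" using Z(3) zz .
    moreover have "dist z z' \<le> dist z x + dist x y + dist y z'"
      by (smt (verit) dist_triangle)
    ultimately show "s \<le> dist x y" by (auto simp: dist_commute)
  qed auto
  also note H
  finally have "card Z * q \<le> h" using \<open>h \<ge> 0\<close> by (simp add: ennreal_le_iff)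
  thus ?thesis using \<open>q > 0\<close> by (simp add: field_simps)
qed

text \<open>A \<open>3 * s\<close>-separated subset of \<open>X\<close> of greatest cardinality is
  also a \<open>3 * s\<close>-net. Each of its points carries measure at least \<open>q\<close>,
  which bounds their number by \<open>h / q\<close>, and balls of radius \<open>4 * r\<close> about
  them cover the neighbourhood.\<close>

lemma emeasure_neighbourhood_le:
  fixes X :: "'b::euclidean_space set"
  assumes "compact X" "X \<noteq> {}"
    and H: "hausdorff_measure (DIM('b) - 1) X \<le> ennreal h" and "h \<ge> 0" "\<kappa> > 0" "\<eta> > 0" "r > 0"
    and reg: "\<And>r z. 0 < r \<Longrightarrow> r \<le> \<eta> \<Longrightarrow> z \<in> X \<Longrightarrow>
        ennreal (\<kappa> * r ^ (DIM('b) - 1)) \<le> hausdorff_measure (DIM('b) - 1) (X \<inter> ball z r)"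
  shows "emeasure lborel {x. infdist x X \<le> r}
    \<le> ennreal (4 ^ DIM('b) * unit_ball_vol (DIM('b)) * (h / \<kappa>) * r * (1 + (r / \<eta>) ^ (DIM('b) - 1)))"
proof -
  let ?D = "DIM('b)"
  \<comment> \<open>Regularity reaches only up to the scale \<eta>, so the packing radius is cut off
    there. This is the origin of the factor \<open>1 + (r / \<eta>) ^ (D - 1)\<close>.\<close>
  define s where "s = min r \<eta>"
  define q where "q = \<kappa> * s ^ (?D - 1)"
  have s: "0 < s" "s \<le> \<eta>" "s \<le> r" using assms by (auto simp: s_def)
  have q: "q > 0" using s \<open>\<kappa> > 0\<close> by (auto simp: q_def)
  define sep where "sep Z \<longleftrightarrow> finite Z \<and> Z \<subseteq> X \<and> (\<forall>z\<in>Z. \<forall>z'\<in>Z. z \<noteq> z' \<longrightarrow> 3 * s \<le> dist z z')" for Z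
  have card: "real (card Z) \<le> h / q" if "sep Z" for Z
    by (rule separated_set_card_le[OF _ H s(1) q \<open>h \<ge> 0\<close>])
       (use reg[OF s(1,2)] that in \<open>auto simp: q_def sep_def\<close>)
  have "\<exists>Z. sep Z \<and> (\<forall>Z'. sep Z' \<longrightarrow> card Z' \<le> card Z)"
  proof (rule ex_has_greatest_nat[where b = "nat \<lceil>h / q\<rceil> + 1"])
    show "sep {}" by (simp add: sep_def)
    show "\<forall>Z. sep Z \<longrightarrow> card Z < nat \<lceil>h / q\<rceil> + 1"
    proof (intro allI impI)
      fix Z assume "sep Z"
      from card[OF this] have "real (card Z) \<le> real (nat \<lceil>h / q\<rceil>)"
        by (rule order_trans) (rule real_nat_ceiling_ge)
      thus "card Z < nat \<lceil>h / q\<rceil> + 1" by simp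
    qed
  qed
  then obtain Z where Z: "sep Z" and max: "\<And>Z'. sep Z' \<Longrightarrow> card Z' \<le> card Z" by auto
  have finZ: "finite Z" using Z by (simp add: sep_def)
  have cover: "\<exists>z\<in>Z. dist x z < 3 * s" if "x \<in> X" for x
  proof (rule ccontr)
    assume a: "\<not> ?thesis"
    hence "sep (insert x Z)" using Z that by (auto simp: sep_def dist_commute not_less)
    from max[OF this] have "x \<in> Z" using finZ by (auto simp: card_insert_if split: if_splits)
    thus False using a s by auto
  qed
  \<comment> \<open>From \<open>x\<close> to a nearest point of \<open>X\<close> is at most
    \<open>r\<close>, from there to the net less than \<open>3 * s \<le> 3 * r\<close>.\<close>
  have sub: "{x. infdist x X \<le> r} \<subseteq> (\<Union>z\<in>Z. cball z (4 * r))"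
  proof
    fix x assume "x \<in> {x. infdist x X \<le> r}"
    moreover obtain y where y: "y \<in> X" "infdist x X = dist x y"
      using infdist_attains_inf[of X x] assms(1,2) compact_imp_closed by auto
    moreover obtain z where "z \<in> Z" "dist y z < 3 * s" using cover[OF y(1)] by auto
    ultimately show "x \<in> (\<Union>z\<in>Z. cball z (4 * r))"
      using dist_triangle[of x z y] s by (force simp: dist_commute)
  qed
  have "emeasure lborel {x. infdist x X \<le> r} \<le> emeasure lborel (\<Union>z\<in>Z. cball z (4 * r))"
    by (rule emeasure_mono[OF sub]) (use finZ in auto)
  also have "\<dots> \<le> (\<Sum>z\<in>Z. emeasure lborel (cball z (4 * r)))"
    by (rule emeasure_subadditive_finite) (use finZ in auto)
  also have "\<dots> = ennreal (card Z * (unit_ball_vol ?D * (4 * r) ^ ?D))"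
    using \<open>r > 0\<close> by (simp add: emeasure_cball ennreal_mult ennreal_of_nat_eq_real_of_nat)
  also have "\<dots> \<le> ennreal (h / q * (unit_ball_vol ?D * (4 * r) ^ ?D))"
    using card[OF Z] \<open>r > 0\<close> by (intro ennreal_leI mult_right_mono) auto
  also have "\<dots> \<le> ennreal (4 ^ ?D * unit_ball_vol ?D * (h / \<kappa>) * r * (1 + (r / \<eta>) ^ (?D - 1)))"
  proof (rule ennreal_leI)
    have D: "r ^ ?D = r * r ^ (?D - 1)" using DIM_positive[where 'a='b] by (simp flip: power_Suc)
    have "(r / s) ^ (?D - 1) \<le> 1 + (r / \<eta>) ^ (?D - 1)"
    proof (cases "r \<le> \<eta>")
      case True thus ?thesis using assms by (simp add: s_def)
    next
      case False thus ?thesis using assms by (simp add: s_def)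
    qed
    hence "(4 ^ ?D * unit_ball_vol ?D * (h / \<kappa>) * r) * (r / s) ^ (?D - 1)
        \<le> (4 ^ ?D * unit_ball_vol ?D * (h / \<kappa>) * r) * (1 + (r / \<eta>) ^ (?D - 1))"
      using assms by (intro mult_left_mono) auto
    thus "h / q * (unit_ball_vol ?D * (4 * r) ^ ?D)
      \<le> 4 ^ ?D * unit_ball_vol ?D * (h / \<kappa>) * r * (1 + (r / \<eta>) ^ (?D - 1))"
      by (simp add: q_def D power_mult_distrib power_divide field_simps)
  qed
  finally show ?thesis .
qed

section \<open>Square-integrable functions\<close>

text \<open>Counterpart of \<open>L2\<close> over an arbitrary measure. The analysis runs over
  \<open>lborel\<close>, where Fubini applies and products are again \<open>lborel\<close>;
  \<open>L2_borel_representative\<close> and \<open>sqint_lebesgue_iff\<close> connect it to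
  \<open>L2\<close>.\<close>

definition sqint :: "'a measure \<Rightarrow> ('a \<Rightarrow> complex) \<Rightarrow> bool" where
  "sqint M f \<longleftrightarrow> f \<in> borel_measurable M \<and> integrable M (\<lambda>t. (cmod (f t))\<^sup>2)"

lemma sqint_measurable [measurable_dest, simp]: "sqint M f \<Longrightarrow> f \<in> borel_measurable M"
  by (simp add: sqint_def)

lemma sqint_measurable_borel [simp]: "sqint lborel f \<Longrightarrow> f \<in> borel_measurable borel"
  by (simp add: sqint_def)

lemma sqint_integrable [simp]: "sqint M f \<Longrightarrow> integrable M (\<lambda>t. (cmod (f t))\<^sup>2)"
  by (simp add: sqint_def)

lemma sqintI: "f \<in> borel_measurable M \<Longrightarrow> integrable M (\<lambda>t. (cmod (f t))\<^sup>2) \<Longrightarrow> sqint M f"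
  by (simp only: sqint_def)

lemma cmod_add_square_le: "(cmod (a + b))\<^sup>2 \<le> 2 * (cmod a)\<^sup>2 + 2 * (cmod b)\<^sup>2"
proof -
  have "(cmod (a + b))\<^sup>2 \<le> (cmod a + cmod b)\<^sup>2"
    by (intro power_mono norm_triangle_ineq) auto
  also have "\<dots> \<le> 2 * (cmod a)\<^sup>2 + 2 * (cmod b)\<^sup>2"
    using sum_squares_bound[of "cmod a" "cmod b"] by (simp add: power2_sum)
  finally show ?thesis .
qed

lemma sqint_bound:
  assumes "f \<in> borel_measurable M" "integrable M h" "AE t in M. (cmod (f t))\<^sup>2 \<le> h t"
  shows "sqint M f"
  unfolding sqint_def
proof
  show "integrable M (\<lambda>t. (cmod (f t))\<^sup>2)"
    by (rule Bochner_Integration.integrable_bound[OF assms(2)]) (use assms in auto)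
qed fact

lemma sqint_add [intro]:
  assumes "sqint M f" "sqint M g"
  shows "sqint M (\<lambda>t. f t + g t)"
  by (rule sqint_bound[where h = "\<lambda>t. 2 * (cmod (f t))\<^sup>2 + 2 * (cmod (g t))\<^sup>2"])
     (use assms in \<open>auto intro!: cmod_add_square_le\<close>)

lemma sqint_cmult [intro]:
  assumes "sqint M f"
  shows "sqint M (\<lambda>t. c * f t)"
  by (rule sqint_bound[where h = "\<lambda>t. (cmod c)\<^sup>2 * (cmod (f t))\<^sup>2"])
     (use assms in \<open>auto simp: norm_mult power_mult_distrib\<close>)

lemma sqint_diff [intro]:
  assumes "sqint M f" "sqint M g"
  shows "sqint M (\<lambda>t. f t - g t)"
  using sqint_add[OF assms(1) sqint_cmult[OF assms(2), of "-1"]] by simp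

lemma sqint_zero [simp, intro]: "sqint M (\<lambda>t. 0)"
  by (simp add: sqint_def)

lemma sqint_sum [intro]:
  assumes "\<And>i. i \<in> I \<Longrightarrow> sqint M (f i)"
  shows "sqint M (\<lambda>t. \<Sum>i\<in>I. f i t)"
  using assms by (induction I rule: infinite_finite_induct) auto

lemma sqint_mult_integrable:
  assumes "sqint M f" "sqint M g"
  shows "integrable M (\<lambda>t. f t * g t)"
proof (rule Bochner_Integration.integrable_bound)
  show "integrable M (\<lambda>t. (cmod (f t))\<^sup>2 + (cmod (g t))\<^sup>2)" using assms by auto
  show "AE t in M. norm (f t * g t) \<le> norm ((cmod (f t))\<^sup>2 + (cmod (g t))\<^sup>2)"
  proof (rule AE_I2)
    fix t
    have "2 * (cmod (f t) * cmod (g t)) \<le> (cmod (f t))\<^sup>2 + (cmod (g t))\<^sup>2"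
      using sum_squares_bound[of "cmod (f t)" "cmod (g t)"] by simp
    moreover have "0 \<le> cmod (f t) * cmod (g t)" by simp
    ultimately have "cmod (f t) * cmod (g t) \<le> (cmod (f t))\<^sup>2 + (cmod (g t))\<^sup>2" by linarith
    thus "norm (f t * g t) \<le> norm ((cmod (f t))\<^sup>2 + (cmod (g t))\<^sup>2)" by (simp add: norm_mult)
  qed
qed (use assms in auto)

lemma borel_measurable_cnj [measurable]: "cnj \<in> borel_measurable borel"
  by (intro borel_measurable_continuous_onI continuous_on_cnj continuous_on_id)

lemma sqint_cnj: "sqint M f \<Longrightarrow> sqint M (\<lambda>t. cnj (f t))"
  unfolding sqint_def by (auto intro: measurable_compose[OF _ borel_measurable_cnj])

definition ip :: "'a measure \<Rightarrow> ('a \<Rightarrow> complex) \<Rightarrow> ('a \<Rightarrow> complex) \<Rightarrow> complex" where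
  "ip M f g = (LINT t|M. f t * cnj (g t))"

definition nsq :: "'a measure \<Rightarrow> ('a \<Rightarrow> complex) \<Rightarrow> real" where
  "nsq M f = (LINT t|M. (cmod (f t))\<^sup>2)"

lemma ip_integrable: "sqint M f \<Longrightarrow> sqint M g \<Longrightarrow> integrable M (\<lambda>t. f t * cnj (g t))"
  by (intro sqint_mult_integrable sqint_cnj)

lemma nsq_nonneg [simp]: "0 \<le> nsq M f"
  by (simp add: nsq_def)

lemma ip_self: "ip M f f = complex_of_real (nsq M f)"
  by (simp add: ip_def nsq_def complex_norm_square[symmetric] flip: of_real_power integral_complex_of_real)

lemma ip_cnj: "cnj (ip M f g) = ip M g f"
  unfolding ip_def by (subst Bochner_Integration.integral_cnj[symmetric]) (simp only: complex_cnj_mult complex_cnj_cnj mult.commute)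

lemma ip_add_left:
  "sqint M f \<Longrightarrow> sqint M g \<Longrightarrow> sqint M h \<Longrightarrow> ip M (\<lambda>t. f t + g t) h = ip M f h + ip M g h"
  unfolding ip_def by (simp add: distrib_right ip_integrable)

lemma ip_diff_left:
  "sqint M f \<Longrightarrow> sqint M g \<Longrightarrow> sqint M h \<Longrightarrow> ip M (\<lambda>t. f t - g t) h = ip M f h - ip M g h"
  unfolding ip_def by (simp add: left_diff_distrib ip_integrable)

lemma ip_cmult_left: "ip M (\<lambda>t. c * f t) h = c * ip M f h"
  unfolding ip_def by (simp add: mult.assoc)

lemma ip_add_right:
  "sqint M f \<Longrightarrow> sqint M g \<Longrightarrow> sqint M h \<Longrightarrow> ip M h (\<lambda>t. f t + g t) = ip M h f + ip M h g"
  unfolding ip_def by (simp add: distrib_left ip_integrable)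

lemma ip_diff_right:
  "sqint M f \<Longrightarrow> sqint M g \<Longrightarrow> sqint M h \<Longrightarrow> ip M h (\<lambda>t. f t - g t) = ip M h f - ip M h g"
  unfolding ip_def by (simp add: right_diff_distrib ip_integrable)

lemma ip_cmult_right: "ip M h (\<lambda>t. c * f t) = cnj c * ip M h f"
  unfolding ip_def by (simp add: mult.assoc mult.left_commute)

lemma ip_zero_left [simp]: "ip M (\<lambda>t. 0) h = 0" by (simp add: ip_def)

lemma ip_zero_right [simp]: "ip M h (\<lambda>t. 0) = 0" by (simp add: ip_def)

lemma ip_sum_left:
  "(\<And>i. i \<in> I \<Longrightarrow> sqint M (f i)) \<Longrightarrow> sqint M h \<Longrightarrow> ip M (\<lambda>t. \<Sum>i\<in>I. f i t) h = (\<Sum>i\<in>I. ip M (f i) h)"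
  by (induction I rule: infinite_finite_induct) (auto simp: ip_add_left sqint_sum)

lemma ip_cong_AE:
  assumes "AE t in M. f t = f' t" "AE t in M. h t = h' t"
    "f \<in> borel_measurable M" "f' \<in> borel_measurable M" "h \<in> borel_measurable M" "h' \<in> borel_measurable M"
  shows "ip M f h = ip M f' h'"
  unfolding ip_def
proof (rule integral_cong_AE)
  show "AE t in M. f t * cnj (h t) = f' t * cnj (h' t)" using assms(1,2) by eventually_elim simp
qed (use assms in measurable)

lemma nsq_add:
  assumes "sqint M f" "sqint M g"
  shows "nsq M (\<lambda>t. f t + g t) = nsq M f + nsq M g + 2 * Re (ip M f g)"
proof -
  have "ip M (\<lambda>t. f t + g t) (\<lambda>t. f t + g t) = ip M f f + ip M g g + (ip M f g + cnj (ip M f g))"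
    using assms by (simp add: ip_add_left ip_add_right sqint_add ip_cnj)
  also have "ip M f g + cnj (ip M f g) = of_real (2 * Re (ip M f g))" by (simp add: complex_add_cnj)
  finally have "complex_of_real (nsq M (\<lambda>t. f t + g t)) = of_real (nsq M f + nsq M g + 2 * Re (ip M f g))"
    by (simp add: ip_self)
  thus ?thesis using of_real_eq_iff by blast
qed

lemma nsq_cmult: "nsq M (\<lambda>t. c * f t) = (cmod c)\<^sup>2 * nsq M f"
  by (simp add: nsq_def norm_mult power_mult_distrib)

lemma nsq_diff:
  assumes "sqint M f" "sqint M g"
  shows "nsq M (\<lambda>t. f t - g t) = nsq M f + nsq M g - 2 * Re (ip M f g)"
  using nsq_add[OF assms(1) sqint_cmult[OF assms(2), of "-1"]] ip_cmult_right[of M f "-1" g]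
    nsq_cmult[of M "-1" g] by simp

text \<open>Discriminant argument for a nonnegative Hermitian form in two variables:
  \<open>s = - c / b\<close> minimizes it if \<open>b > 0\<close>, and for \<open>b = 0\<close> a
  large negative multiple of \<open>c\<close> would make it negative.\<close>

lemma psd_form_Cauchy_Schwarz:
  fixes a b :: real and c :: complex
  assumes "\<And>s :: complex. 0 \<le> a + (cmod s)\<^sup>2 * b + 2 * Re (cnj s * c)" "0 \<le> a" "0 \<le> b"
  shows "(cmod c)\<^sup>2 \<le> a * b"
proof (cases "b = 0")
  case True
  show ?thesis
  proof (rule ccontr)
    assume "\<not> ?thesis"
    hence c: "(cmod c)\<^sup>2 > 0" using True by simp
    \<comment> \<open>With this \<open>x\<close> the form takes the value -1.\<close>
    define x where "x = (a + 1) / (2 * (cmod c)\<^sup>2)"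
    have "cnj (- of_real x * c) * c = - of_real (x * (cmod c)\<^sup>2)"
      using complex_norm_square[of c] by (simp add: mult.commute)
    hence "Re (cnj (- of_real x * c) * c) = - (x * (cmod c)\<^sup>2)" by (metis Re_complex_of_real uminus_complex.sel(1))
    hence "0 \<le> a - 2 * (x * (cmod c)\<^sup>2)" using assms(1)[of "- of_real x * c"] True by simp
    moreover have "2 * (x * (cmod c)\<^sup>2) = a + 1" using c by (simp add: x_def field_simps)
    ultimately show False by simp
  qed
next
  case False
  hence b: "b > 0" using assms by simp
  have "cnj (- of_real (1 / b) * c) * c = - of_real (1 / b * (cmod c)\<^sup>2)"
    using complex_norm_square[of c] by (simp add: mult.commute)
  hence "Re (cnj (- of_real (1 / b) * c) * c) = - (1 / b * (cmod c)\<^sup>2)" by (metis Re_complex_of_real uminus_complex.sel(1))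
  hence "0 \<le> a + (1 / b)\<^sup>2 * (cmod c)\<^sup>2 * b - 2 * (1 / b * (cmod c)\<^sup>2)"
    using assms(1)[of "- of_real (1 / b) * c"] b by (simp add: norm_mult norm_divide power_mult_distrib power_divide)
  hence "0 \<le> a - (cmod c)\<^sup>2 / b" using b by (simp add: power2_eq_square field_simps)
  thus ?thesis using b by (simp add: field_simps)
qed

lemma ip_Cauchy_Schwarz:
  assumes "sqint M f" "sqint M g"
  shows "(cmod (ip M f g))\<^sup>2 \<le> nsq M f * nsq M g"
proof (rule psd_form_Cauchy_Schwarz)
  fix s
  have "0 \<le> nsq M (\<lambda>t. f t + s * g t)" by simp
  also have "\<dots> = nsq M f + (cmod s)\<^sup>2 * nsq M g + 2 * Re (cnj s * ip M f g)"
    using assms by (simp add: nsq_add sqint_cmult nsq_cmult ip_cmult_right)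
  finally show "0 \<le> \<dots>" .
qed auto

lemma ip_Cauchy_Schwarz_sqrt:
  assumes "sqint M f" "sqint M g"
  shows "cmod (ip M f g) \<le> sqrt (nsq M f) * sqrt (nsq M g)"
  using real_le_rsqrt[OF ip_Cauchy_Schwarz[OF assms]] by (simp add: real_sqrt_mult)

lemma nsq_eq_0_iff: "sqint M f \<Longrightarrow> nsq M f = 0 \<longleftrightarrow> (AE t in M. f t = 0)"
  unfolding nsq_def by (subst integral_nonneg_eq_0_iff_AE) auto

lemma nsq_add_le:
  assumes "sqint M f" "sqint M g"
  shows "nsq M (\<lambda>t. f t + g t) \<le> 2 * nsq M f + 2 * nsq M g"
proof -
  have "nsq M (\<lambda>t. f t + g t) \<le> (LINT t|M. 2 * (cmod (f t))\<^sup>2 + 2 * (cmod (g t))\<^sup>2)"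
    unfolding nsq_def using assms sqint_integrable[OF sqint_add[OF assms]]
    by (intro integral_mono cmod_add_square_le) auto
  thus ?thesis using assms by (simp add: nsq_def)
qed

section \<open>Translations\<close>

lemma lborel_distr_minus: "distr lborel borel (\<lambda>t. t - c) = (lborel :: 'a::euclidean_space measure)"
  using lborel_distr_plus[of "- c"] by (simp add: fun_eq_iff cong: distr_cong)

lemma lborel_distr_reflect: "distr lborel borel (\<lambda>t. c - t) = (lborel :: 'a::euclidean_space measure)"
  using lborel_affine[of "-1" c] by (simp add: density_1)

lemma integral_translate:
  fixes f :: "'a::euclidean_space \<Rightarrow> 'b::{banach, second_countable_topology}"
  assumes [measurable]: "f \<in> borel_measurable borel"
  shows "(LINT t|lborel. f (t - c)) = (LINT t|lborel. f t)"
  by (subst (2) lborel_distr_minus[of c, symmetric], subst integral_distr) auto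

lemma integral_reflect:
  fixes f :: "'a::euclidean_space \<Rightarrow> 'b::{banach, second_countable_topology}"
  assumes [measurable]: "f \<in> borel_measurable borel"
  shows "(LINT t|lborel. f (c - t)) = (LINT t|lborel. f t)"
  by (subst (2) lborel_distr_reflect[of c, symmetric], subst integral_distr) auto

lemma integrable_translate:
  fixes f :: "'a::euclidean_space \<Rightarrow> 'b::{banach, second_countable_topology}"
  assumes "integrable lborel f"
  shows "integrable lborel (\<lambda>t. f (t - c))"
proof -
  have "integrable (distr lborel borel (\<lambda>t. t - c)) f" using assms by (simp add: lborel_distr_minus)
  thus ?thesis by (subst (asm) integrable_distr_eq) (use assms in auto)
qed

lemma nn_integral_reflect:
  fixes f :: "'a::euclidean_space \<Rightarrow> ennreal"
  assumes [measurable]: "f \<in> borel_measurable borel"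
  shows "(\<integral>\<^sup>+t. f (c - t) \<partial>lborel) = (\<integral>\<^sup>+t. f t \<partial>lborel)"
  by (subst (2) lborel_distr_reflect[of c, symmetric], subst nn_integral_distr) auto

lemma sqint_translate:
  assumes "sqint lborel f"
  shows "sqint lborel (\<lambda>t. f (t - c))"
proof -
  have [measurable]: "f \<in> borel_measurable borel" using assms by simp
  show ?thesis unfolding sqint_def
  proof
    show "(\<lambda>t. f (t - c)) \<in> borel_measurable lborel" by measurable
    show "integrable lborel (\<lambda>t. (cmod (f (t - c)))\<^sup>2)"
      by (rule integrable_translate[OF sqint_integrable[OF assms]])
  qed
qed

lemma nsq_translate:
  assumes "sqint lborel f"
  shows "nsq lborel (\<lambda>t. f (t - c)) = nsq lborel f"
proof -
  have [measurable]: "f \<in> borel_measurable borel" using assms by simp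
  show ?thesis unfolding nsq_def by (rule integral_translate) measurable
qed

section \<open>Continuity of translations in the square norm\<close>

definition translation_continuous :: "('a::euclidean_space \<Rightarrow> complex) \<Rightarrow> bool" where
  "translation_continuous f \<longleftrightarrow> sqint lborel f \<and> ((\<lambda>u. nsq lborel (\<lambda>t. f (t - u) - f t)) \<longlongrightarrow> 0) (at 0)"

lemma translation_continuous_add:
  assumes "translation_continuous f" "translation_continuous g"
  shows "translation_continuous (\<lambda>t. f t + g t)"
proof -
  have f: "sqint lborel f" "sqint lborel g" using assms by (auto simp: translation_continuous_def)
  have "((\<lambda>u. nsq lborel (\<lambda>t. (f (t - u) + g (t - u)) - (f t + g t))) \<longlongrightarrow> 0) (at 0)"
  proof (rule tendsto_sandwich[OF _ _ tendsto_const])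
    show "\<forall>\<^sub>F u in at 0. nsq lborel (\<lambda>t. (f (t - u) + g (t - u)) - (f t + g t))
        \<le> 2 * nsq lborel (\<lambda>t. f (t - u) - f t) + 2 * nsq lborel (\<lambda>t. g (t - u) - g t)"
    proof (rule always_eventually, rule allI)
      fix u
      show "nsq lborel (\<lambda>t. (f (t - u) + g (t - u)) - (f t + g t))
        \<le> 2 * nsq lborel (\<lambda>t. f (t - u) - f t) + 2 * nsq lborel (\<lambda>t. g (t - u) - g t)"
        using nsq_add_le[of lborel "\<lambda>t. f (t - u) - f t" "\<lambda>t. g (t - u) - g t"] f
        by (simp add: sqint_diff sqint_translate algebra_simps)
    qed
    show "((\<lambda>u. 2 * nsq lborel (\<lambda>t. f (t - u) - f t) + 2 * nsq lborel (\<lambda>t. g (t - u) - g t)) \<longlongrightarrow> 0) (at 0)"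
      using assms by (auto simp: translation_continuous_def intro!: tendsto_eq_intros)
  qed auto
  thus ?thesis using f by (auto simp: translation_continuous_def)
qed

lemma translation_continuous_cmult:
  assumes "translation_continuous f"
  shows "translation_continuous (\<lambda>t. c * f t)"
proof -
  have "((\<lambda>u. (cmod c)\<^sup>2 * nsq lborel (\<lambda>t. f (t - u) - f t)) \<longlongrightarrow> 0) (at 0)"
    using assms by (auto simp: translation_continuous_def intro!: tendsto_eq_intros)
  thus ?thesis using assms
    by (auto simp: translation_continuous_def nsq_cmult[symmetric] right_diff_distrib)
qed

lemma translation_continuous_zero: "translation_continuous (\<lambda>t. 0)"
  by (simp add: translation_continuous_def nsq_def)

lemma translation_continuous_sum:
  "(\<And>i. i \<in> I \<Longrightarrow> translation_continuous (f i)) \<Longrightarrow> translation_continuous (\<lambda>t. \<Sum>i\<in>I. f i t)"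
  by (induction I rule: infinite_finite_induct)
     (simp_all add: translation_continuous_add translation_continuous_zero)

text \<open>Translations are isometries, so an approximation of \<open>f\<close> by \<open>h\<close>
  is equally good after translating both. Together with closure under linear combinations this
  reduces the general case to indicators.\<close>

lemma translation_continuous_limit:
  assumes f: "sqint lborel f"
    and ap: "\<And>e. e > 0 \<Longrightarrow> \<exists>h. translation_continuous h \<and> nsq lborel (\<lambda>t. f t - h t) < e"
  shows "translation_continuous f"
  unfolding translation_continuous_def
proof (intro conjI f tendstoI)
  fix e :: real assume "e > 0"
  \<comment> \<open>Two uses of \<open>nsq_add_le\<close> put weights 4, 4 and 2 on three quantities
    below \<open>e / 16\<close>, in total below \<open>e\<close>.\<close>
  then obtain h where h: "translation_continuous h" "nsq lborel (\<lambda>t. f t - h t) < e / 16"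
    using ap[of "e / 16"] by auto
  have hs: "sqint lborel h" using h by (simp add: translation_continuous_def)
  have "\<forall>\<^sub>F u in at 0. nsq lborel (\<lambda>t. h (t - u) - h t) < e / 16"
    using h(1) \<open>e > 0\<close> order_tendstoD(2)[of _ 0 "at 0" "e / 16"] by (auto simp: translation_continuous_def)
  thus "\<forall>\<^sub>F u in at 0. dist (nsq lborel (\<lambda>t. f (t - u) - f t)) 0 < e"
  proof eventually_elim
    case (elim u)
    let ?d = "\<lambda>t. f t - h t"
    have d: "sqint lborel ?d" using f hs by auto
    have "nsq lborel (\<lambda>t. f (t - u) - f t) = nsq lborel (\<lambda>t. (?d (t - u) + (h (t - u) - h t)) + (- 1) * ?d t)"
      by (simp add: algebra_simps)
    also have "\<dots> \<le> 2 * (2 * nsq lborel (\<lambda>t. ?d (t - u)) + 2 * nsq lborel (\<lambda>t. h (t - u) - h t)) + 2 * nsq lborel (\<lambda>t. (- 1) * ?d t)"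
      by (intro order_trans[OF nsq_add_le] add_mono mult_left_mono nsq_add_le)
         (rule sqint_add sqint_diff sqint_cmult[OF d] sqint_translate[OF d] sqint_translate[OF hs] hs | simp)+
    also have "\<dots> < e" using elim h(2) \<open>e > 0\<close> by (simp only: nsq_translate[OF d] nsq_cmult) simp
    finally show ?case by (simp add: dist_real_def)
  qed
qed

text \<open>The squared distance of an indicator to its translate is twice the measure of
  \<open>U\<close> minus twice the measure of the overlap. For open \<open>U\<close> a point of
  \<open>U\<close> stays in \<open>U\<close> under small shifts, so the overlap tends to the measure
  of \<open>U\<close> by dominated convergence.\<close>

lemma translation_continuous_indicator_open:
  fixes U :: "'a::euclidean_space set"
  assumes "open U" "emeasure lborel U < \<infinity>"
  shows "translation_continuous (\<lambda>t. indicator U t)"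
proof -
  have U [measurable]: "U \<in> sets borel" using assms by auto
  have int: "integrable lborel (indicator U :: 'a \<Rightarrow> real)" using assms by (simp add: integrable_indicator_iff)
  have sq: "sqint lborel (\<lambda>t. indicator U t)"
    by (rule sqint_bound[OF _ int]) (auto split: split_indicator)
  have "((\<lambda>u. LINT t|lborel. (indicator U t * indicator U (t - u) :: real)) \<longlongrightarrow> (LINT t|lborel. (indicator U t :: real))) (at 0)"
  proof (unfold tendsto_at_iff_sequentially comp_def, intro allI impI,
      rule integral_dominated_convergence[where w = "indicator U"])
    fix X :: "nat \<Rightarrow> 'a" assume X: "\<forall>i. X i \<in> UNIV - {0}" "X \<longlonglongrightarrow> 0"
    show "AE t in lborel. norm (indicator U t * indicator U (t - X i) :: real) \<le> indicator U t" for i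
      by (auto split: split_indicator)
    have "((\<lambda>u. indicator U t * indicator U (t - u) :: real) \<longlongrightarrow> indicator U t) (at 0)" for t
    proof (cases "t \<in> U")
      case True
      have "((\<lambda>u. t - u) \<longlongrightarrow> t) (at 0)" by (auto intro!: tendsto_eq_intros)
      hence "\<forall>\<^sub>F u in at 0. t - u \<in> U" using assms(1) True topological_tendstoD by blast
      hence "\<forall>\<^sub>F u in at 0. (indicator U t * indicator U (t - u) :: real) = indicator U t"
        by eventually_elim (use True in auto)
      thus ?thesis by (rule tendsto_eventually)
    qed auto
    thus "AE t in lborel. (\<lambda>i. indicator U t * indicator U (t - X i) :: real) \<longlonglongrightarrow> indicator U t"
      using X unfolding tendsto_at_iff_sequentially comp_def by auto
  qed (use int in auto)
  moreover have "nsq lborel (\<lambda>t. indicator U (t - u) - indicator U t)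
     = 2 * (LINT t|lborel. (indicator U t :: real)) - 2 * (LINT t|lborel. (indicator U t * indicator U (t - u) :: real))" for u
  proof -
    have "nsq lborel (\<lambda>t. indicator U (t - u) - indicator U t)
       = (LINT t|lborel. indicator U (t - u) + indicator U t - 2 * (indicator U t * indicator U (t - u) :: real))"
      unfolding nsq_def by (intro Bochner_Integration.integral_cong) (auto split: split_indicator)
    also have "\<dots> = (LINT t|lborel. (indicator U (t - u) :: real)) + (LINT t|lborel. (indicator U t :: real))
        - 2 * (LINT t|lborel. (indicator U t * indicator U (t - u) :: real))"
    proof -
      have "integrable lborel (\<lambda>t. indicator U t * indicator U (t - u) :: real)"
        by (rule Bochner_Integration.integrable_bound[OF int]) (auto split: split_indicator)
      thus ?thesis using int integrable_translate[OF int, of u] by simp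
    qed
    finally show ?thesis by (simp add: integral_translate)
  qed
  ultimately have "((\<lambda>u. nsq lborel (\<lambda>t. indicator U (t - u) - indicator U t)) \<longlongrightarrow> 0) (at 0)"
    by (auto intro!: tendsto_eq_intros)
  thus ?thesis using sq by (simp add: translation_continuous_def)
qed

text \<open>By outer regularity some open superset exceeds \<open>S\<close> by measure less than
  \<open>e\<close>, and that excess is exactly the squared distance of the two indicators.\<close>

lemma translation_continuous_indicator:
  fixes S :: "'a::euclidean_space set"
  assumes [measurable]: "S \<in> sets borel" and fin: "emeasure lborel S < \<infinity>"
  shows "translation_continuous (\<lambda>t. indicator S t)"
proof (rule translation_continuous_limit)
  have "integrable lborel (indicator S :: 'a \<Rightarrow> real)" using fin by (simp add: integrable_indicator_iff)
  thus "sqint lborel (\<lambda>t. indicator S t)"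
    by (rule sqint_bound[rotated]) (auto split: split_indicator)
  fix e :: real assume "e > 0"
  have "S \<in> sets lebesgue" using assms(1) by simp
  from sets_lebesgue_outer_open[OF this \<open>e > 0\<close>] obtain U where U: "open U" "S \<subseteq> U" "U - S \<in> lmeasurable" "emeasure lebesgue (U - S) < ennreal e"
    by blast
  have [measurable]: "U \<in> sets borel" using U by auto
  have US: "emeasure lborel (U - S) < ennreal e" using U(4) by simp
  have "emeasure lborel U = emeasure lborel (U - S) + emeasure lborel S"
    using U(2) by (subst plus_emeasure) (auto simp: Un_absorb2)
  hence "emeasure lborel U < \<infinity>" using US fin by (auto simp: less_top[symmetric])
  hence "translation_continuous (\<lambda>t. indicator U t)" using U(1) by (rule translation_continuous_indicator_open[rotated])
  moreover have "nsq lborel (\<lambda>t. indicator S t - indicator U t) < e"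
  proof -
    have "nsq lborel (\<lambda>t. indicator S t - indicator U t) = (LINT t|lborel. indicator (U - S) t)"
      unfolding nsq_def using U(2) by (intro Bochner_Integration.integral_cong) (auto split: split_indicator)
    also have "\<dots> = measure lborel (U - S)" by simp
    also have "\<dots> < e"
    proof -
      have "emeasure lborel (U - S) = ennreal (measure lborel (U - S))"
        using US by (intro emeasure_eq_ennreal_measure) auto
      thus ?thesis using US by (simp add: ennreal_less_iff)
    qed
    finally show ?thesis .
  qed
  ultimately show "\<exists>h. translation_continuous h \<and> nsq lborel (\<lambda>t. indicator S t - h t) < e" by blast
qed

text \<open>Simple functions bounded by \<open>2 * cmod (f t)\<close> and converging pointwise to
  \<open>f\<close> also converge in the square norm, dominated by
  \<open>9 * (cmod (f t))\<^sup>2\<close>.\<close>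

lemma translation_continuous_sqint:
  fixes f :: "'a::euclidean_space \<Rightarrow> complex"
  assumes f: "sqint lborel f"
  shows "translation_continuous f"
proof (rule translation_continuous_limit[OF f])
  fix e :: real assume "e > 0"
  have fm [measurable]: "f \<in> borel_measurable lborel" using f by simp
  obtain F :: "nat \<Rightarrow> 'a \<Rightarrow> complex" where F: "\<And>i. simple_function lborel (F i)" "\<And>x. (\<lambda>i. F i x) \<longlonglongrightarrow> f x"
      "\<And>i x. cmod (F i x) \<le> 2 * cmod (f x)"
    using borel_measurable_implies_sequence_metric[OF fm, of 0] by (auto simp: dist_norm)
  have Fm [measurable]: "F i \<in> borel_measurable lborel" for i
    using F(1) by (rule borel_measurable_simple_function)
  have Fsq: "sqint lborel (F i)" for i
  proof (rule sqint_bound)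
    show "integrable lborel (\<lambda>t. 4 * (cmod (f t))\<^sup>2)" using f by auto
    show "AE t in lborel. (cmod (F i t))\<^sup>2 \<le> 4 * (cmod (f t))\<^sup>2"
      using power_mono[OF F(3)[of i], of _ 2] by (auto simp: power_mult_distrib)
  qed auto
  have "(\<lambda>i. nsq lborel (\<lambda>t. f t - F i t)) \<longlonglongrightarrow> (LINT t|(lborel :: 'a measure). 0)"
    unfolding nsq_def
  proof (rule integral_dominated_convergence[where w = "\<lambda>t. 9 * (cmod (f t))\<^sup>2"])
    show "AE t in lborel. (\<lambda>i. (cmod (f t - F i t))\<^sup>2) \<longlonglongrightarrow> 0"
      using F(2) by (auto intro!: AE_I2 tendsto_eq_intros)
    fix i
    have "cmod (f t - F i t) \<le> 3 * cmod (f t)" for t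
      using norm_triangle_ineq4[of "f t" "F i t"] F(3)[of i t] by linarith
    hence "(cmod (f t - F i t))\<^sup>2 \<le> (3 * cmod (f t))\<^sup>2" for t by (rule power_mono) auto
    thus "AE t in lborel. norm ((cmod (f t - F i t))\<^sup>2) \<le> 9 * (cmod (f t))\<^sup>2"
      by (auto simp: power_mult_distrib)
  qed (use f in auto)
  hence "(\<lambda>i. nsq lborel (\<lambda>t. f t - F i t)) \<longlonglongrightarrow> 0" by simp
  from order_tendstoD(2)[OF this \<open>e > 0\<close>] obtain i where i: "nsq lborel (\<lambda>t. f t - F i t) < e"
    by (auto simp: eventually_sequentially)
  \<comment> \<open>The value 0 is left out because its level set may have infinite measure; every
    other level set has finite measure by square integrability.\<close>
  have "translation_continuous (\<lambda>t. \<Sum>y\<in>range (F i) - {0}. y * indicator (F i -` {y}) t)"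
  proof (intro translation_continuous_sum translation_continuous_cmult translation_continuous_indicator)
    fix y assume y: "y \<in> range (F i) - {0}"
    have *: "{x \<in> space lborel. F i x \<in> {y}} \<in> sets lborel" by measurable
    thus m: "F i -` {y} \<in> sets borel" by (simp add: vimage_def)
    have "integrable lborel (\<lambda>t. indicator (F i -` {y}) t :: real)"
    proof (rule Bochner_Integration.integrable_bound)
      show "integrable lborel (\<lambda>t. (cmod (F i t))\<^sup>2 / (cmod y)\<^sup>2)" using Fsq[of i] by auto
      show "AE t in lborel. norm (indicator (F i -` {y}) t :: real) \<le> norm ((cmod (F i t))\<^sup>2 / (cmod y)\<^sup>2)"
        using y by (auto split: split_indicator)
    qed (use m in auto)
    thus "emeasure lborel (F i -` {y}) < \<infinity>" using m by (simp add: integrable_indicator_iff)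
  qed
  moreover have "(\<Sum>y\<in>range (F i) - {0}. y * indicator (F i -` {y}) t) = F i t" for t
  proof -
    have "finite (range (F i))" using F(1)[of i] by (simp add: simple_function_def)
    hence "(\<Sum>y\<in>range (F i) - {0}. y * indicator (F i -` {y}) t) = (\<Sum>y\<in>range (F i). y * indicator (F i -` {y}) t)"
      by (intro sum.mono_neutral_left) auto
    also have "\<dots> = (\<Sum>y\<in>{F i t}. y * indicator (F i -` {y}) t)"
      using \<open>finite (range (F i))\<close> by (intro sum.mono_neutral_right) (auto split: split_indicator)
    finally show ?thesis by simp
  qed
  ultimately show "\<exists>h. translation_continuous h \<and> nsq lborel (\<lambda>t. f t - h t) < e"
    using i by auto
qed

section \<open>Plancherel's theorem and Moyal's identity\<close>

lemma lborel_integral_prod: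
  fixes f :: "'a::euclidean_space \<Rightarrow> real \<Rightarrow> complex"
  assumes f: "\<And>b. b \<in> Basis \<Longrightarrow> integrable lborel (f b)"
  shows "integrable lborel (\<lambda>x. \<Prod>b\<in>Basis. f b (x \<bullet> b))"
    and "(LINT x|lborel. (\<Prod>b\<in>Basis. f b (x \<bullet> b))) = (\<Prod>b\<in>Basis. LINT y|lborel. f b y)"
proof -
  interpret product_sigma_finite "\<lambda>b::'a. lborel :: real measure" ..
  have [measurable]: "f b \<in> borel_measurable borel" if "b \<in> Basis" for b
    using borel_measurable_integrable[OF f[OF that]] by simp
  have [measurable]: "(\<lambda>f. \<Sum>b\<in>Basis. f b *\<^sub>R b) \<in> measurable (\<Pi>\<^sub>M b\<in>(Basis::'a set). lborel) borel"
    by measurable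
  have m: "(\<lambda>x::'a. \<Prod>b\<in>Basis. f b (x \<bullet> b)) \<in> borel_measurable borel"
  proof (rule borel_measurable_prod)
    fix b :: 'a assume "b \<in> Basis"
    hence "f b \<in> borel_measurable borel" by fact
    thus "(\<lambda>x. f b (x \<bullet> b)) \<in> borel_measurable borel"
      by (rule measurable_compose[rotated]) measurable
  qed
  have eq: "(\<Prod>b\<in>Basis. f b ((\<Sum>b'\<in>Basis. w b' *\<^sub>R b') \<bullet> b)) = (\<Prod>b\<in>Basis. f b (w b))" for w :: "'a \<Rightarrow> real"
    by (intro prod.cong) (auto simp: inner_sum_left_Basis)
  show "integrable lborel (\<lambda>x. \<Prod>b\<in>Basis. f b (x \<bullet> b))"
    by (subst lborel_eq, subst integrable_distr_eq)
       (use m f in \<open>auto simp: eq intro!: product_integrable_prod\<close>)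
  show "(LINT x|lborel. (\<Prod>b\<in>Basis. f b (x \<bullet> b))) = (\<Prod>b\<in>Basis. LINT y|lborel. f b y)"
    by (subst lborel_eq, subst integral_distr)
       (use m f in \<open>auto simp: eq intro!: product_integral_prod\<close>)
qed

lemma borel_measurable_cis [measurable]: "cis \<in> borel_measurable borel"
  by (intro borel_measurable_continuous_onI continuous_intros)

text \<open>This is the characteristic function of the standard normal distribution after the
  substitution \<open>x = c * y\<close> with \<open>c = sqrt (2 * pi)\<close>: it turns
  \<open>exp (- x\<^sup>2 / 2)\<close> into \<open>exp (- pi * y\<^sup>2)\<close>, and the
  normalizing factor cancels against the Jacobian.\<close>

lemma gauss_real:
  shows "integrable lborel (\<lambda>y::real. complex_of_real (exp (- pi * y\<^sup>2)) * cis (2 * pi * s * y))" (is ?A)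
    and "(LINT y|lborel. complex_of_real (exp (- pi * y\<^sup>2)) * cis (2 * pi * s * y)) = of_real (exp (- pi * s\<^sup>2))" (is ?B)
proof -
  define c where "c = sqrt (2 * pi)"
  have c: "c > 0" "c\<^sup>2 = 2 * pi" by (auto simp: c_def)
  let ?F = "\<lambda>x. std_normal_density x *\<^sub>R cis ((c * s) * x)"
  have F: "?F (0 + c * y) = (1 / c) *\<^sub>R (complex_of_real (exp (- pi * y\<^sup>2)) * cis (2 * pi * s * y))" for y
  proof -
    have e1: "- (c * y)\<^sup>2 / 2 = - pi * y\<^sup>2" using c(2) by (simp add: power_mult_distrib)
    have "(c * s) * (c * y) = c\<^sup>2 * s * y" by (simp add: power2_eq_square)
    hence e2: "(c * s) * (c * y) = 2 * pi * s * y" by (simp only: c(2))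
    show ?thesis
      by (simp only: add_0_left std_normal_density_def e1 e2) (simp add: c_def scaleR_conv_of_real)
  qed
  have iF: "integrable lborel ?F"
  proof (rule Bochner_Integration.integrable_bound)
    show "integrable lborel std_normal_density" by (intro integrable_normal_density) simp
    show "?F \<in> borel_measurable lborel" by measurable
  qed auto
  show ?A
    using integrable_scaleR_right[OF lborel_integrable_real_affine[OF iF, of c 0, unfolded F], of c] c by simp
  have "of_real (exp (- (c * s)\<^sup>2 / 2)) = char std_normal_distribution (c * s)"
    by (simp add: char_std_normal_distribution)
  also have "\<dots> = (LINT x|lborel. ?F x)"
    unfolding char_def cis_conv_exp by (subst integral_density) auto
  also have "\<dots> = \<bar>c\<bar> *\<^sub>R (LINT y|lborel. ?F (0 + c * y))"
    by (rule lborel_integral_real_affine) (use c in auto)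
  also have "\<dots> = (LINT y|lborel. complex_of_real (exp (- pi * y\<^sup>2)) * cis (2 * pi * s * y))"
    unfolding F using c(1) by simp
  finally show ?B using c by (simp add: power_mult_distrib)
qed

definition gauss :: "'a::euclidean_space \<Rightarrow> real" where
  "gauss x = exp (- pi * (norm x)\<^sup>2)"

lemma gauss_pos [simp]: "0 < gauss x" "0 \<le> gauss x"
  by (auto simp: gauss_def)

lemma gauss_measurable [measurable]: "gauss \<in> borel_measurable borel"
  unfolding gauss_def by measurable

definition fourier :: "('a::euclidean_space \<Rightarrow> complex) \<Rightarrow> 'a \<Rightarrow> complex" where
  "fourier h \<xi> = (LINT t|lborel. h t * cis (- 2 * pi * (\<xi> \<bullet> t)))"

lemma cis_sum: "finite I \<Longrightarrow> cis (\<Sum>i\<in>I. f i) = (\<Prod>i\<in>I. cis (f i))"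
  by (induction I rule: finite_induct) (auto simp: cis_mult[symmetric])

lemma gauss_cis_prod:
  fixes x u :: "'a::euclidean_space"
  shows "complex_of_real (gauss x) * cis (2 * pi * (u \<bullet> x))
    = (\<Prod>b\<in>Basis. complex_of_real (exp (- pi * (x \<bullet> b)\<^sup>2)) * cis (2 * pi * (u \<bullet> b) * (x \<bullet> b)))"
proof -
  have "(norm x)\<^sup>2 = (\<Sum>b\<in>Basis. (x \<bullet> b)\<^sup>2)"
    unfolding power2_norm_eq_inner by (subst euclidean_inner) (simp add: power2_eq_square)
  hence "gauss x = (\<Prod>b\<in>Basis. exp (- pi * (x \<bullet> b)\<^sup>2))"
    by (simp add: gauss_def exp_sum[symmetric] sum_distrib_left[symmetric] sum_negf)
  moreover have "cis (2 * pi * (u \<bullet> x)) = (\<Prod>b\<in>Basis. cis (2 * pi * (u \<bullet> b) * (x \<bullet> b)))"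
    by (simp add: cis_sum[symmetric] euclidean_inner[of u x] sum_distrib_left mult.assoc)
  ultimately show ?thesis by (simp add: prod.distrib)
qed

lemma gauss_integral:
  fixes u :: "'a::euclidean_space"
  shows "(LINT x|lborel. complex_of_real (gauss x) * cis (2 * pi * (u \<bullet> x))) = of_real (gauss u)"
proof -
  have "(LINT x|lborel. complex_of_real (gauss x) * cis (2 * pi * (u \<bullet> x)))
     = (\<Prod>b\<in>Basis. complex_of_real (exp (- pi * (u \<bullet> b)\<^sup>2)))"
    unfolding gauss_cis_prod by (subst lborel_integral_prod(2)) (simp_all only: gauss_real)
  also have "\<dots> = of_real (gauss u)" using gauss_cis_prod[of u 0] by simp
  finally show ?thesis .
qed

lemma gauss_integrable: "integrable lborel (gauss :: 'a::euclidean_space \<Rightarrow> real)"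
proof -
  have "integrable lborel (\<lambda>x::'a. complex_of_real (gauss x) * cis (2 * pi * (0 \<bullet> x)))"
    unfolding gauss_cis_prod by (intro lborel_integral_prod(1) gauss_real)
  hence "integrable lborel (\<lambda>x::'a. complex_of_real (gauss x))" by simp
  thus ?thesis by (rule complex_of_real_integrable_eq[THEN iffD1])
qed

lemma gauss_integral_1: "(LINT x|lborel. gauss (x :: 'a::euclidean_space)) = 1"
proof -
  have "complex_of_real (LINT x|lborel. gauss (x :: 'a)) = 1"
    using gauss_integral[of "0 :: 'a"] by (simp add: gauss_def)
  thus ?thesis using of_real_eq_1_iff by blast
qed

lemma fourier_measurable [measurable]:
  assumes [measurable]: "h \<in> borel_measurable borel"
  shows "fourier h \<in> borel_measurable borel"
  unfolding fourier_def[abs_def] by (intro lborel.borel_measurable_lebesgue_integral) measurable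

lemma integral_scale:
  fixes f :: "'a::euclidean_space \<Rightarrow> 'b::{banach, second_countable_topology}"
  assumes [measurable]: "f \<in> borel_measurable borel" and c: "c > 0"
  shows "(LINT x|lborel. f x) = c ^ DIM('a) *\<^sub>R (LINT x|lborel. f (c *\<^sub>R x))"
  using c by (subst lborel_affine[of c 0])
    (simp_all add: integral_density integral_distr)

lemma integrable_scale:
  fixes f :: "'a::euclidean_space \<Rightarrow> 'b::{banach, second_countable_topology}"
  assumes f: "integrable lborel f" and c: "c > 0"
  shows "integrable lborel (\<lambda>x. f (c *\<^sub>R x))"
proof -
  have [measurable]: "f \<in> borel_measurable borel" using f by auto
  have "integrable (density (distr lborel borel (\<lambda>x. 0 + c *\<^sub>R x)) (\<lambda>_. \<bar>c\<bar>^DIM('a))) f"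
    using f c by (subst lborel_affine[symmetric]) auto
  hence "integrable lborel (\<lambda>x. c ^ DIM('a) *\<^sub>R f (c *\<^sub>R x))"
    using c by (simp add: integrable_density integrable_distr_eq)
  hence "integrable lborel (\<lambda>x. inverse (c ^ DIM('a)) *\<^sub>R (c ^ DIM('a) *\<^sub>R f (c *\<^sub>R x)))"
    by (rule integrable_scaleR_right)
  thus ?thesis using c by simp
qed

lemma integrable_pair_product:
  fixes f :: "'a \<Rightarrow> complex" and g :: "'b \<Rightarrow> complex"
  assumes "sigma_finite_measure M" "sigma_finite_measure N" "integrable M f" "integrable N g"
  shows "integrable (M \<Otimes>\<^sub>M N) (\<lambda>(x, y). f x * g y)"
proof -
  interpret M: sigma_finite_measure M by fact
  interpret N: sigma_finite_measure N by fact
  interpret pair_sigma_finite M N ..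
  have [measurable]: "f \<in> borel_measurable M" "g \<in> borel_measurable N" using assms by auto
  show ?thesis
    by (rule Fubini_integrable) (use assms in \<open>auto simp: norm_mult\<close>)
qed

text \<open>
  The Fourier transform of the autocorrelation of \<open>h\<close> is \<open>|fourier h|\<^sup>2\<close>, so Plancherel's theorem is
  Fourier inversion for the autocorrelation at the single point \<open>0\<close>, where it is continuous.
\<close>

definition autocorr :: "('a::euclidean_space \<Rightarrow> complex) \<Rightarrow> 'a \<Rightarrow> complex" where
  "autocorr h u = (LINT t|lborel. h t * cnj (h (t - u)))"

text \<open>Reflecting the inner variable shows that the absolute double integral is the square of
  the integral of \<open>cmod (h t)\<close>.\<close>

lemma autocorr_pair_integrable:
  fixes h :: "'a::euclidean_space \<Rightarrow> complex"
  assumes h: "integrable lborel h"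
  shows "integrable (lborel \<Otimes>\<^sub>M lborel) (\<lambda>(t, u). h t * cnj (h (t - u)))"
proof (rule lborel_pair.Fubini_integrable)
  have [measurable]: "h \<in> borel_measurable borel" using h by auto
  show "(\<lambda>(t, u). h t * cnj (h (t - u))) \<in> borel_measurable (lborel \<Otimes>\<^sub>M lborel)" by measurable
  have i: "integrable lborel (\<lambda>u. cmod (h (t - u)))" for t
  proof -
    have "integrable (distr lborel borel (\<lambda>u. t - u)) (\<lambda>x. cmod (h x))"
      using h by (subst lborel_distr_reflect) auto
    thus ?thesis by (subst (asm) integrable_distr_eq) auto
  qed
  have "(LINT u|lborel. cmod (h (t - u))) = (LINT u|lborel. cmod (h u))" for t
    by (rule integral_reflect[of "\<lambda>x. cmod (h x)"]) auto
  thus "integrable lborel (\<lambda>t. LINT u|lborel. norm (case (t, u) of (t, u) \<Rightarrow> h t * cnj (h (t - u))))"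
    using h by (simp add: norm_mult)
  show "AE t in lborel. integrable lborel (\<lambda>u. case (t, u) of (t, u) \<Rightarrow> h t * cnj (h (t - u)))"
  proof (rule AE_I2)
    fix t
    have "integrable lborel (\<lambda>u. h (t - u))"
      using i[of t] by (subst integrable_norm_iff[symmetric]) auto
    thus "integrable lborel (\<lambda>u. case (t, u) of (t, u) \<Rightarrow> h t * cnj (h (t - u)))" by simp
  qed
qed

lemma autocorr_integrable:
  assumes h: "integrable lborel h"
  shows "integrable lborel (autocorr h)"
  using lborel_pair.integrable_snd[OF autocorr_pair_integrable[OF h]]
  by (simp add: autocorr_def[abs_def])

lemma fourier_autocorr:
  fixes h :: "'a::euclidean_space \<Rightarrow> complex"
  assumes h: "integrable lborel h"
  shows "fourier (autocorr h) \<xi> = of_real ((cmod (fourier h \<xi>))\<^sup>2)"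
proof -
  have [measurable]: "h \<in> borel_measurable borel" using h by auto
  let ?e = "\<lambda>t. cis (- 2 * pi * (\<xi> \<bullet> t))"
  \<comment> \<open>The phase at \<open>u\<close> splits into the phases at \<open>t\<close> and
    \<open>t - u\<close>, after which the double integral factors.\<close>
  have e: "?e u = ?e t * cnj (?e (t - u))" for t u
    by (simp add: cis_cnj cis_mult inner_diff_right algebra_simps)
  have int: "integrable (lborel \<Otimes>\<^sub>M lborel) (\<lambda>(t, u). h t * cnj (h (t - u)) * ?e u)"
    by (rule Bochner_Integration.integrable_bound[OF autocorr_pair_integrable[OF h]])
       (auto simp: norm_mult split: prod.splits)
  have "fourier (autocorr h) \<xi> = (LINT u|lborel. LINT t|lborel. h t * cnj (h (t - u)) * ?e u)"
    by (simp add: fourier_def autocorr_def)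
  also have "\<dots> = (LINT t|lborel. LINT u|lborel. h t * cnj (h (t - u)) * ?e u)"
    by (rule lborel_pair.Fubini_integral[OF int])
  also have "\<dots> = (LINT t|lborel. LINT u|lborel. h t * ?e t * cnj (h (t - u) * ?e (t - u)))"
  proof -
    have "h t * cnj (h (t - u)) * ?e u = h t * ?e t * cnj (h (t - u) * ?e (t - u))" for t u
      by (subst e[of u t]) (simp add: mult_ac)
    thus ?thesis by (simp only:)
  qed
  also have "\<dots> = (LINT t|lborel. h t * ?e t * cnj (LINT u|lborel. h (t - u) * ?e (t - u)))"
    by (simp only: integral_mult_right_zero Bochner_Integration.integral_cnj)
  also have "\<dots> = (LINT t|lborel. h t * ?e t * cnj (fourier h \<xi>))"
    by (subst integral_reflect[of "\<lambda>u. h u * ?e u"]) (auto simp: fourier_def)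
  also have "\<dots> = fourier h \<xi> * cnj (fourier h \<xi>)" by (simp add: fourier_def)
  also have "\<dots> = of_real ((cmod (fourier h \<xi>))\<^sup>2)" by (simp only: complex_norm_square)
  finally show ?thesis .
qed

lemma autocorr_ip: "autocorr h u = ip lborel h (\<lambda>t. h (t - u))"
  by (simp add: autocorr_def ip_def)

lemma autocorr_bound:
  assumes "sqint lborel h"
  shows "cmod (autocorr h u) \<le> nsq lborel h"
  using ip_Cauchy_Schwarz_sqrt[OF assms sqint_translate[OF assms, of u]]
  by (simp add: autocorr_ip nsq_translate[OF assms])

lemma autocorr_0: "autocorr h 0 = of_real (nsq lborel h)"
  using ip_self[of lborel h] by (simp add: autocorr_ip)

text \<open>The difference to the value at 0 is the inner product of \<open>h\<close> with a
  translation increment of \<open>h\<close>; Cauchy-Schwarz and continuity of translations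
  finish.\<close>

lemma autocorr_tendsto:
  fixes h :: "'a::euclidean_space \<Rightarrow> complex"
  assumes h: "sqint lborel h"
  shows "isCont (autocorr h) 0"
  unfolding isCont_def
proof (subst tendsto_dist_iff, rule tendsto_sandwich[OF _ _ tendsto_const])
  let ?w = "\<lambda>u. sqrt (nsq lborel h) * sqrt (nsq lborel (\<lambda>t. h (t - u) - h t))"
  show "\<forall>\<^sub>F u in at 0. dist (autocorr h u) (autocorr h 0) \<le> ?w u"
  proof (rule always_eventually, rule allI)
    fix u
    have "autocorr h u - autocorr h 0 = ip lborel h (\<lambda>t. h (t - u) - h t)"
      using h by (simp add: autocorr_ip ip_diff_right sqint_translate)
    thus "dist (autocorr h u) (autocorr h 0) \<le> ?w u"
      using ip_Cauchy_Schwarz_sqrt[OF h sqint_diff[OF sqint_translate[OF h, of u] h]]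
      by (simp add: dist_norm)
  qed
  have "((\<lambda>u. nsq lborel (\<lambda>t. h (t - u) - h t)) \<longlongrightarrow> 0) (at 0)"
    using translation_continuous_sqint[OF h] by (simp add: translation_continuous_def)
  thus "(?w \<longlongrightarrow> 0) (at 0)" by (auto intro!: tendsto_eq_intros)
qed auto

text \<open>Fubini moves the Fourier transform from the autocorrelation onto the Gaussian, which is
  its own transform; the substitution \<open>u = c v\<close> then puts the parameter into the
  argument of the autocorrelation. As \<open>c\<close> tends to 0 the right side concentrates at the
  value at 0.\<close>

lemma gauss_fourier_autocorr:
  fixes h :: "'a::euclidean_space \<Rightarrow> complex"
  assumes h: "integrable lborel h" and c: "c > 0"
  shows "(LINT \<xi>|lborel. of_real (gauss (c *\<^sub>R \<xi>)) * fourier (autocorr h) \<xi>)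
       = (LINT v|lborel. autocorr h (c *\<^sub>R v) * of_real (gauss v))"
    and "integrable lborel (\<lambda>\<xi>. complex_of_real (gauss (c *\<^sub>R \<xi>)) * fourier (autocorr h) \<xi>)"
proof -
  let ?k = "autocorr h"
  have k: "integrable lborel ?k" by (rule autocorr_integrable[OF h])
  have km [measurable]: "?k \<in> borel_measurable borel" using k by auto
  have g: "integrable lborel (\<lambda>\<xi>::'a. complex_of_real (gauss \<xi>))" using gauss_integrable by (rule integrable_of_real)
  let ?F = "\<lambda>\<xi> u. complex_of_real (gauss (c *\<^sub>R \<xi>)) * (?k u * cis (- 2 * pi * (\<xi> \<bullet> u)))"
  have "integrable (lborel \<Otimes>\<^sub>M lborel) (\<lambda>(\<xi>::'a, u). complex_of_real (gauss (c *\<^sub>R \<xi>)) * ?k u)"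
    using integrable_scale[OF g c] k by (intro integrable_pair_product) (auto intro: sigma_finite_lborel)
  hence int: "integrable (lborel \<Otimes>\<^sub>M lborel) (\<lambda>(\<xi>, u). ?F \<xi> u)"
    by (rule Bochner_Integration.integrable_bound) (auto simp: norm_mult split: prod.splits)
  show "integrable lborel (\<lambda>\<xi>. complex_of_real (gauss (c *\<^sub>R \<xi>)) * fourier (autocorr h) \<xi>)"
    using lborel_pair.integrable_fst[OF int] by (simp add: fourier_def)
  have "(LINT \<xi>|lborel. of_real (gauss (c *\<^sub>R \<xi>)) * fourier ?k \<xi>) = (LINT \<xi>|lborel. LINT u|lborel. ?F \<xi> u)"
    by (simp add: fourier_def)
  also have "\<dots> = (LINT u|lborel. LINT \<xi>|lborel. ?F \<xi> u)"
    by (rule lborel_pair.Fubini_integral[OF int, symmetric])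
  also have "\<dots> = c ^ DIM('a) *\<^sub>R (LINT v|lborel. LINT \<xi>|lborel. ?F \<xi> (c *\<^sub>R v))"
    by (rule integral_scale[OF _ c]) measurable
  also have "\<dots> = (LINT v|lborel. c ^ DIM('a) *\<^sub>R (LINT \<xi>|lborel. ?F \<xi> (c *\<^sub>R v)))"
    by simp
  also have "\<dots> = (LINT v|lborel. ?k (c *\<^sub>R v) * of_real (gauss v))"
  proof (intro Bochner_Integration.integral_cong refl)
    fix v :: 'a
    have "of_real (gauss v) = (LINT x|lborel. complex_of_real (gauss x) * cis (2 * pi * (- v \<bullet> x)))"
      using gauss_integral[of "- v"] by (simp add: gauss_def)
    also have "\<dots> = c ^ DIM('a) *\<^sub>R (LINT \<xi>|lborel. complex_of_real (gauss (c *\<^sub>R \<xi>)) * cis (2 * pi * (- v \<bullet> (c *\<^sub>R \<xi>))))"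
      by (rule integral_scale[OF _ c]) measurable
    finally have "?k (c *\<^sub>R v) * of_real (gauss v) = c ^ DIM('a) *\<^sub>R (?k (c *\<^sub>R v) *
       (LINT \<xi>|lborel. complex_of_real (gauss (c *\<^sub>R \<xi>)) * cis (2 * pi * (- v \<bullet> (c *\<^sub>R \<xi>)))))" by simp
    also have "?k (c *\<^sub>R v) * (LINT \<xi>|lborel. complex_of_real (gauss (c *\<^sub>R \<xi>)) * cis (2 * pi * (- v \<bullet> (c *\<^sub>R \<xi>))))
       = (LINT \<xi>|lborel. ?F \<xi> (c *\<^sub>R v))"
      by (subst integral_mult_right_zero[symmetric])
         (intro Bochner_Integration.integral_cong refl, simp add: inner_commute mult_ac)
    finally show "c ^ DIM('a) *\<^sub>R (LINT \<xi>|lborel. ?F \<xi> (c *\<^sub>R v)) = ?k (c *\<^sub>R v) * of_real (gauss v)" by simp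
  qed
  finally show "(LINT \<xi>|lborel. of_real (gauss (c *\<^sub>R \<xi>)) * fourier (autocorr h) \<xi>)
       = (LINT v|lborel. autocorr h (c *\<^sub>R v) * of_real (gauss v))" .
qed

text \<open>The Gaussian identity is used along \<open>c = 1 / (n + 1)\<close>. On the
  autocorrelation side dominated convergence gives \<open>nsq lborel h\<close>. On the Fourier side
  the integrands increase with \<open>n\<close>, and monotone convergence yields both the
  integrability of the limit and its integral.\<close>

theorem Plancherel:
  fixes h :: "'a::euclidean_space \<Rightarrow> complex"
  assumes h: "integrable lborel h" "sqint lborel h"
  shows "sqint lborel (fourier h)" "nsq lborel (fourier h) = nsq lborel h"
proof -
  have [measurable]: "h \<in> borel_measurable borel" using h by auto
  have km [measurable]: "autocorr h \<in> borel_measurable borel" using autocorr_integrable[OF h(1)] by auto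
  let ?c = "\<lambda>n. inverse (real (Suc n))"
  let ?f = "\<lambda>n \<xi>. gauss (?c n *\<^sub>R \<xi>) * (cmod (fourier h \<xi>))\<^sup>2"
  have feq: "complex_of_real (?f n \<xi>) = of_real (gauss (?c n *\<^sub>R \<xi>)) * fourier (autocorr h) \<xi>" for n \<xi>
    by (simp add: fourier_autocorr[OF h(1)])
  have fint: "integrable lborel (?f n)" for n
  proof -
    have "integrable lborel (\<lambda>\<xi>. complex_of_real (?f n \<xi>))"
      unfolding feq by (rule gauss_fourier_autocorr(2)[OF h(1)]) simp
    thus ?thesis using complex_of_real_integrable_eq by blast
  qed
  have "(\<lambda>n. LINT v|lborel. autocorr h (?c n *\<^sub>R v) * of_real (gauss v))
      \<longlonglongrightarrow> (LINT v|(lborel :: 'a measure). of_real (nsq lborel h) * of_real (gauss v))"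
  proof (rule integral_dominated_convergence[where w = "\<lambda>v. nsq lborel h * gauss v"])
    show "AE v in lborel. (\<lambda>n. autocorr h (?c n *\<^sub>R v) * of_real (gauss v))
        \<longlonglongrightarrow> of_real (nsq lborel h) * of_real (gauss v)"
    proof (rule AE_I2)
      fix v :: 'a
      have "(\<lambda>n. ?c n *\<^sub>R v) \<longlonglongrightarrow> 0 *\<^sub>R v"
        by (rule tendsto_scaleR[OF LIMSEQ_inverse_real_of_nat tendsto_const])
      hence "(\<lambda>n. autocorr h (?c n *\<^sub>R v)) \<longlonglongrightarrow> autocorr h 0"
        using isCont_tendsto_compose[OF autocorr_tendsto[OF h(2)]] by simp
      thus "(\<lambda>n. autocorr h (?c n *\<^sub>R v) * of_real (gauss v)) \<longlonglongrightarrow> of_real (nsq lborel h) * of_real (gauss v)"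
        unfolding autocorr_0 by (intro tendsto_intros)
    qed
    show "AE v in lborel. norm (autocorr h (?c n *\<^sub>R v) * complex_of_real (gauss v)) \<le> nsq lborel h * gauss v" for n
      by (auto simp: norm_mult intro!: AE_I2 mult_right_mono autocorr_bound h)
  qed (use gauss_integrable in auto)
  also have "(LINT v|(lborel :: 'a measure). complex_of_real (nsq lborel h) * of_real (gauss v)) = of_real (nsq lborel h)"
    by (simp add: gauss_integral_1 )
  finally have "(\<lambda>n. LINT v|lborel. autocorr h (?c n *\<^sub>R v) * of_real (gauss v)) \<longlonglongrightarrow> of_real (nsq lborel h)" .
  moreover have "(LINT v|lborel. autocorr h (?c n *\<^sub>R v) * of_real (gauss v)) = of_real (LINT \<xi>|lborel. ?f n \<xi>)" for n
    by (subst gauss_fourier_autocorr(1)[OF h(1), symmetric]) (simp_all only: feq[symmetric] integral_complex_of_real, simp)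
  ultimately have "(\<lambda>n. complex_of_real (LINT \<xi>|lborel. ?f n \<xi>)) \<longlonglongrightarrow> of_real (nsq lborel h)"
    by (simp only:)
  hence lim: "(\<lambda>n. LINT \<xi>|lborel. ?f n \<xi>) \<longlonglongrightarrow> nsq lborel h"
    by (simp only: tendsto_of_real_iff)
  have mono: "AE \<xi> in lborel. mono (\<lambda>n. ?f n \<xi>)"
  proof (rule AE_I2, rule monoI)
    fix \<xi> :: 'a and m n :: nat assume "m \<le> n"
    hence "norm (?c n *\<^sub>R \<xi>) \<le> norm (?c m *\<^sub>R \<xi>)" by (simp add: mult_right_mono le_imp_inverse_le)
    hence "gauss (?c m *\<^sub>R \<xi>) \<le> gauss (?c n *\<^sub>R \<xi>)" unfolding gauss_def by (simp add: power_mono)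
    thus "?f m \<xi> \<le> ?f n \<xi>" by (intro mult_right_mono) auto
  qed
  have ptw: "AE \<xi> in lborel. (\<lambda>n. ?f n \<xi>) \<longlonglongrightarrow> (cmod (fourier h \<xi>))\<^sup>2"
  proof (rule AE_I2)
    fix \<xi> :: 'a
    have "(\<lambda>n. ?c n *\<^sub>R \<xi>) \<longlonglongrightarrow> 0 *\<^sub>R \<xi>"
      by (rule tendsto_scaleR[OF LIMSEQ_inverse_real_of_nat tendsto_const])
    hence "(\<lambda>n. gauss (?c n *\<^sub>R \<xi>)) \<longlonglongrightarrow> gauss (0 *\<^sub>R \<xi>)" unfolding gauss_def
      by (intro tendsto_exp tendsto_mult tendsto_const tendsto_power tendsto_norm)
    hence "(\<lambda>n. ?f n \<xi>) \<longlonglongrightarrow> gauss (0 *\<^sub>R \<xi>) * (cmod (fourier h \<xi>))\<^sup>2" by (intro tendsto_intros)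
    thus "(\<lambda>n. ?f n \<xi>) \<longlonglongrightarrow> (cmod (fourier h \<xi>))\<^sup>2" by (simp add: gauss_def)
  qed
  have "integrable lborel (\<lambda>\<xi>. (cmod (fourier h \<xi>))\<^sup>2)"
    by (rule integrable_monotone_convergence[OF fint mono ptw lim]) measurable
  thus "sqint lborel (fourier h)" by (rule sqintI[rotated]) measurable
  show "nsq lborel (fourier h) = nsq lborel h"
    unfolding nsq_def[of _ "fourier h"]
    by (rule integral_monotone_convergence[OF fint mono ptw lim]) measurable
qed

section \<open>Moyal's identity\<close>

lemma stft_lborel:
  fixes f g :: "'a::euclidean_space \<Rightarrow> complex"
  assumes [measurable]: "f \<in> borel_measurable borel" "g \<in> borel_measurable borel"
  shows "stft g f (x, \<xi>) = fourier (\<lambda>t. f t * cnj (g (t - x))) \<xi>"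
  unfolding stft_def fourier_def prod.case by (rule integral_completion) measurable

lemma stft_measurable:
  fixes f g :: "'a::euclidean_space \<Rightarrow> complex"
  assumes [measurable]: "f \<in> borel_measurable borel" "g \<in> borel_measurable borel"
  shows "stft g f \<in> borel_measurable borel"
proof -
  have "stft g f = (\<lambda>z. LINT t|lborel. f t * cnj (g (t - fst z)) * cis (- 2 * pi * (snd z \<bullet> t)))"
    by (auto simp: stft_lborel fourier_def)
  also have "\<dots> \<in> borel_measurable (borel \<Otimes>\<^sub>M borel)"
    by (intro lborel.borel_measurable_lebesgue_integral) measurable
  finally show ?thesis by (simp only: borel_prod)
qed

text \<open>For fixed \<open>x\<close> the transform in \<xi> is the Fourier transform of
  \<open>f\<close> times a conjugated translate of \<open>g\<close>. This product is always
  integrable; it is square integrable for almost every \<open>x\<close>, because by Tonelli the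
  squares have the finite total \<open>nsq lborel f * nsq lborel g\<close>. Plancherel is applied
  for those \<open>x\<close>.\<close>

theorem Moyal:
  fixes f g :: "'a::euclidean_space \<Rightarrow> complex"
  assumes f: "sqint lborel f" and g: "sqint lborel g"
  shows "sqint lborel (stft g f)" "nsq lborel (stft g f) = nsq lborel f * nsq lborel g"
proof -
  have [measurable]: "f \<in> borel_measurable borel" "g \<in> borel_measurable borel" using f g by auto
  have [measurable]: "stft g f \<in> borel_measurable borel" by (rule stft_measurable) measurable
  define h where "h x t = f t * cnj (g (t - x))" for x t
  have hint: "integrable lborel (h x)" for x
    unfolding h_def by (rule ip_integrable[OF f sqint_translate[OF g]])
  have [measurable]: "case_prod h \<in> borel_measurable (borel \<Otimes>\<^sub>M borel)" unfolding h_def by measurable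
  have [measurable]: "h x \<in> borel_measurable borel" for x unfolding h_def by measurable
  have nn: "(\<integral>\<^sup>+x. ennreal ((cmod (f x))\<^sup>2) \<partial>lborel) = ennreal (nsq lborel f)" if "sqint lborel f" for f :: "'a \<Rightarrow> complex"
    unfolding nsq_def using that by (intro nn_integral_eq_integral) auto
  have tot: "(\<integral>\<^sup>+x. \<integral>\<^sup>+t. ennreal ((cmod (h x t))\<^sup>2) \<partial>lborel \<partial>lborel) = ennreal (nsq lborel f * nsq lborel g)"
  proof -
    have "(\<integral>\<^sup>+x. \<integral>\<^sup>+t. ennreal ((cmod (h x t))\<^sup>2) \<partial>lborel \<partial>lborel)
        = (\<integral>\<^sup>+t. \<integral>\<^sup>+x. ennreal ((cmod (h x t))\<^sup>2) \<partial>lborel \<partial>lborel)"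
      by (rule lborel_pair.Fubini') measurable
    also have "\<dots> = (\<integral>\<^sup>+t. ennreal ((cmod (f t))\<^sup>2) * (\<integral>\<^sup>+x. ennreal ((cmod (g (t - x)))\<^sup>2) \<partial>lborel) \<partial>lborel)"
      unfolding h_def by (simp add: norm_mult power_mult_distrib ennreal_mult nn_integral_cmult)
    also have "\<dots> = (\<integral>\<^sup>+t. ennreal ((cmod (f t))\<^sup>2) * ennreal (nsq lborel g) \<partial>lborel)"
      by (subst nn_integral_reflect[of "\<lambda>x. ennreal ((cmod (g x))\<^sup>2)"]) (auto simp: nn[OF g])
    also have "\<dots> = ennreal (nsq lborel f * nsq lborel g)"
      by (simp add: nn_integral_multc nn[OF f] ennreal_mult)
    finally show ?thesis .
  qed
  have "AE x in lborel. (\<integral>\<^sup>+t. ennreal ((cmod (h x t))\<^sup>2) \<partial>lborel) \<noteq> \<infinity>"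
  proof (rule nn_integral_PInf_AE)
    show "(\<lambda>x. \<integral>\<^sup>+t. ennreal ((cmod (h x t))\<^sup>2) \<partial>lborel) \<in> borel_measurable lborel" by measurable
  qed (simp only: tot, simp)
  hence ae: "AE x in lborel. (\<integral>\<^sup>+\<xi>. ennreal ((cmod (fourier (h x) \<xi>))\<^sup>2) \<partial>lborel) = (\<integral>\<^sup>+t. ennreal ((cmod (h x t))\<^sup>2) \<partial>lborel)"
  proof eventually_elim
    case (elim x)
    have "integrable lborel (\<lambda>t. (cmod (h x t))\<^sup>2)"
    proof (rule integrableI_bounded)
      show "(\<lambda>t. (cmod (h x t))\<^sup>2) \<in> borel_measurable lborel" by measurable
    qed (use elim in \<open>simp add: less_top\<close>)
    hence s: "sqint lborel (h x)" by (rule sqintI[rotated]) measurable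
    have "(\<integral>\<^sup>+\<xi>. ennreal ((cmod (fourier (h x) \<xi>))\<^sup>2) \<partial>lborel) = ennreal (nsq lborel (fourier (h x)))"
      by (rule nn[OF Plancherel(1)[OF hint s]])
    also have "\<dots> = ennreal (nsq lborel (h x))" by (simp only: Plancherel(2)[OF hint s])
    also have "\<dots> = (\<integral>\<^sup>+t. ennreal ((cmod (h x t))\<^sup>2) \<partial>lborel)" by (rule nn[OF s, symmetric])
    finally show ?case .
  qed
  have eq: "(\<integral>\<^sup>+z. ennreal ((cmod (stft g f z))\<^sup>2) \<partial>lborel) = ennreal (nsq lborel f * nsq lborel g)"
  proof -
    have m: "(\<lambda>z. ennreal ((cmod (stft g f z))\<^sup>2)) \<in> borel_measurable (lborel \<Otimes>\<^sub>M lborel)"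
      unfolding lborel_prod by measurable
    have "(\<integral>\<^sup>+z. ennreal ((cmod (stft g f z))\<^sup>2) \<partial>lborel)
       = (\<integral>\<^sup>+x. \<integral>\<^sup>+\<xi>. ennreal ((cmod (stft g f (x, \<xi>)))\<^sup>2) \<partial>lborel \<partial>lborel)"
      using lborel.nn_integral_fst[OF m] by (simp only: lborel_prod)
    also have "\<dots> = (\<integral>\<^sup>+x. \<integral>\<^sup>+t. ennreal ((cmod (h x t))\<^sup>2) \<partial>lborel \<partial>lborel)"
    proof (rule nn_integral_cong_AE)
      have "fourier (h x) \<xi> = stft g f (x, \<xi>)" for x \<xi>
        by (simp add: stft_lborel h_def[abs_def])
      thus "AE x in lborel. (\<integral>\<^sup>+\<xi>. ennreal ((cmod (stft g f (x, \<xi>)))\<^sup>2) \<partial>lborel) = (\<integral>\<^sup>+t. ennreal ((cmod (h x t))\<^sup>2) \<partial>lborel)"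
        using ae by simp
    qed
    finally show ?thesis using tot by simp
  qed
  show sq: "sqint lborel (stft g f)"
    by (intro sqintI integrableI_bounded) (measurable, simp add: eq)
  show "nsq lborel (stft g f) = nsq lborel f * nsq lborel g"
    using eq nn_integral_eq_integral[OF sqint_integrable[OF sq]] by (simp add: nsq_def[of _ "stft g f"])
qed

section \<open>The concentration operator as a quadratic form\<close>

lemma AE_lborel_translate:
  assumes "AE t in (lborel :: 'a::euclidean_space measure). P t"
  shows "AE t in lborel. P (t - c)"
proof -
  have "AE t in distr (lborel :: 'a measure) borel (\<lambda>t. t - c). P t" using assms by (simp only: lborel_distr_minus)
  thus ?thesis by (rule AE_distrD[rotated]) measurable
qed

lemma AE_lborel_reflect:
  assumes "AE t in (lborel :: 'a::euclidean_space measure). P t"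
  shows "AE t in lborel. P (c - t)"
proof -
  have "AE t in distr (lborel :: 'a measure) borel (\<lambda>t. c - t). P t" using assms by (simp only: lborel_distr_reflect)
  thus ?thesis by (rule AE_distrD[rotated]) measurable
qed

lemma AE_lborel_fst:
  assumes "AE x in (lborel :: 'a::euclidean_space measure). P x"
  shows "AE z in (lborel :: ('a \<times> 'b::euclidean_space) measure). P (fst z)"
proof -
  obtain N where N: "{x \<in> space lborel. \<not> P x} \<subseteq> N" "emeasure lborel N = 0" "N \<in> sets (lborel :: 'a measure)"
    using AE_E[OF assms] by blast
  have "emeasure (lborel \<Otimes>\<^sub>M (lborel :: 'b measure)) (N \<times> UNIV) = 0"
    using N(2,3) by (subst lborel.emeasure_pair_measure_Times) auto
  moreover have "N \<times> (UNIV :: 'b set) \<in> sets (lborel \<Otimes>\<^sub>M lborel)" using N(3) by auto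
  ultimately have "N \<times> UNIV \<in> null_sets (lborel :: ('a \<times> 'b) measure)"
    unfolding lborel_prod by (rule null_setsI)
  thus ?thesis by (rule AE_I') (use N(1) in auto)
qed

lemma lebesgue_measurable_AE:
  fixes f h :: "'a::euclidean_space \<Rightarrow> 'b::topological_space"
  assumes f: "f \<in> borel_measurable borel" and ae: "AE t in lborel. f t = h t"
  shows "h \<in> borel_measurable lebesgue"
proof (rule measurableI)
  obtain N where N: "{x \<in> space lborel. \<not> f x = h x} \<subseteq> N" "emeasure lborel N = 0" "N \<in> sets (lborel :: 'a measure)"
    using AE_E[OF ae] by blast
  hence null: "N \<in> null_sets lborel" by auto
  fix S :: "'b set" assume S: "S \<in> sets borel"
  have "f x = h x" if "x \<notin> N" for x using N(1) that by auto
  hence "h -` S \<inter> space lebesgue = (f -` S - N) \<union> (h -` S \<inter> N)" by auto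
  moreover have "f -` S \<in> sets borel" using measurable_sets[OF f S] by simp
  hence "f -` S - N \<in> sets lebesgue" using N(3) by auto
  moreover have "h -` S \<inter> N \<in> sets lebesgue"
    using null_sets_completion_subset[OF _ null_sets_completionI[OF null], of "h -` S \<inter> N"] by auto
  ultimately show "h -` S \<inter> space lebesgue \<in> sets lebesgue" by (simp only: sets.Un)
qed auto

lemma lebesgue_integral_AE_borel:
  fixes f h :: "'a::euclidean_space \<Rightarrow> 'b::{banach, second_countable_topology}"
  assumes f: "f \<in> borel_measurable borel" and ae: "AE t in lborel. f t = h t"
  shows "(LINT t|lebesgue. h t) = (LINT t|lborel. f t)"
proof -
  have "(LINT t|lebesgue. h t) = (LINT t|lebesgue. f t)"
    using ae by (intro integral_cong_AE lebesgue_measurable_AE[OF f ae] measurable_completion)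
                (auto simp: AE_completion_iff f eq_commute)
  also have "\<dots> = (LINT t|lborel. f t)" using f by (intro integral_completion) auto
  finally show ?thesis .
qed

lemma lebesgue_ex_borel_complex:
  fixes f :: "'a::euclidean_space \<Rightarrow> complex"
  assumes f: "f \<in> borel_measurable lebesgue"
  obtains f' where "f' \<in> borel_measurable borel" "AE t in lborel. f' t = f t"
proof -
  have "(\<lambda>t. Re (f t)) \<in> borel_measurable lebesgue" "(\<lambda>t. Im (f t)) \<in> borel_measurable lebesgue"
    using f by auto
  then obtain a b where ab: "a \<in> borel_measurable lborel" "b \<in> borel_measurable lborel"
    "AE t in lborel. Re (f t) = a t" "AE t in lborel. Im (f t) = b t"
    using completion_ex_borel_measurable_real[of "\<lambda>t. Re (f t)" lborel]
      completion_ex_borel_measurable_real[of "\<lambda>t. Im (f t)" lborel] by blast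
  show thesis
  proof (rule that)
    show "(\<lambda>t. Complex (a t) (b t)) \<in> borel_measurable borel"
      using ab(1,2) by (auto simp: borel_measurable_complex_iff)
    show "AE t in lborel. Complex (a t) (b t) = f t"
      using ab(3,4) by eventually_elim (simp add: complex_eq_iff)
  qed
qed

lemma sqint_lebesgue_iff:
  fixes f f' :: "'a::euclidean_space \<Rightarrow> complex"
  assumes f': "f' \<in> borel_measurable borel" and ae: "AE t in lborel. f' t = f t"
  shows "f \<in> L2 \<longleftrightarrow> sqint lborel f'" "L2_norm f = sqrt (nsq lborel f')"
proof -
  have m: "f \<in> borel_measurable lebesgue" by (rule lebesgue_measurable_AE[OF f' ae])
  have m': "f' \<in> borel_measurable lebesgue" using f' by (auto intro: measurable_completion)
  have ae2: "AE t in lborel. (cmod (f' t))\<^sup>2 = (cmod (f t))\<^sup>2" using ae by eventually_elim simp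
  have "integrable lebesgue (\<lambda>t. (cmod (f t))\<^sup>2) \<longleftrightarrow> integrable lebesgue (\<lambda>t. (cmod (f' t))\<^sup>2)"
    using ae2 m m' by (intro integrable_cong_AE) (auto simp: AE_completion_iff eq_commute)
  also have "\<dots> \<longleftrightarrow> integrable lborel (\<lambda>t. (cmod (f' t))\<^sup>2)"
    using f' by (intro integrable_completion) auto
  finally show "f \<in> L2 \<longleftrightarrow> sqint lborel f'"
    using m f' unfolding L2_def sqint_def by simp
  show "L2_norm f = sqrt (nsq lborel f')"
    unfolding L2_norm_def nsq_def using f'
    by (subst lebesgue_integral_AE_borel[OF _ ae2]) auto
qed

lemma L2_borel_representative:
  fixes f :: "'a::euclidean_space \<Rightarrow> complex"
  assumes "f \<in> L2"
  obtains f' where "sqint lborel f'" "AE t in lborel. f' t = f t"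
proof -
  have "f \<in> borel_measurable lebesgue" using assms by (simp add: L2_def)
  then obtain f' where f': "f' \<in> borel_measurable borel" "AE t in lborel. f' t = f t"
    by (rule lebesgue_ex_borel_complex)
  with sqint_lebesgue_iff(1)[OF f'] assms that show thesis by blast
qed

lemma sqint_imp_L2: "sqint lborel f \<Longrightarrow> f \<in> L2"
  by (subst sqint_lebesgue_iff(1)[of f f]) auto

lemma borel_measurable_fst [measurable]:
  "(fst :: 'a::euclidean_space \<times> 'b::euclidean_space \<Rightarrow> 'a) \<in> measurable borel borel"
  by (intro borel_measurable_continuous_onI continuous_intros)

lemma borel_measurable_snd [measurable]:
  "(snd :: 'a::euclidean_space \<times> 'b::euclidean_space \<Rightarrow> 'b) \<in> measurable borel borel"
  by (intro borel_measurable_continuous_onI continuous_intros)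

text \<open>\<open>synth g\<close> is the adjoint of \<open>stft g\<close>.\<close>

definition synth :: "('a::euclidean_space \<Rightarrow> complex) \<Rightarrow> ('a \<times> 'a \<Rightarrow> complex) \<Rightarrow> 'a \<Rightarrow> complex" where
  "synth g F t = (LINT z|lborel. F z * (g (t - fst z) * cis (2 * pi * (snd z \<bullet> t))))"

text \<open>The equality holds at every point, since for fixed x and \<xi> the two integrands agree
  for almost every \<open>t\<close>.\<close>

lemma stft_cong_AE:
  fixes f g :: "'a::euclidean_space \<Rightarrow> complex"
  assumes [measurable]: "f' \<in> borel_measurable borel" "g' \<in> borel_measurable borel"
    and ae: "AE t in lborel. f' t = f t" "AE t in lborel. g' t = g t"
  shows "stft g f = stft g' f'"
proof (rule ext, clarify)
  fix x \<xi> :: 'a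
  have "AE t in lborel. f' t * cnj (g' (t - x)) * cis (- 2 * pi * (\<xi> \<bullet> t)) = f t * cnj (g (t - x)) * cis (- 2 * pi * (\<xi> \<bullet> t))"
    using ae(1) AE_lborel_translate[OF ae(2), of x] by eventually_elim simp
  from lebesgue_integral_AE_borel[OF _ this] show "stft g f (x, \<xi>) = stft g' f' (x, \<xi>)"
    by (simp add: stft_lborel fourier_def stft_def[of g])
qed

text \<open>Again an equality at every \<open>t\<close>: the exceptional null set of
  \<open>g\<close> is reflected at \<open>t\<close> and extended to a null set of phase space
  through \<open>fst\<close>. This lets the later spectral argument treat the operator as a function
  of the Borel representative alone.\<close>

lemma concentration_op_cong_AE:
  fixes f g :: "'a::euclidean_space \<Rightarrow> complex"
  assumes [measurable]: "f' \<in> borel_measurable borel" "g' \<in> borel_measurable borel" "\<Omega> \<in> sets borel"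
    and ae: "AE t in lborel. f' t = f t" "AE t in lborel. g' t = g t"
  shows "concentration_op g \<Omega> f = synth g' (\<lambda>z. indicator \<Omega> z * stft g' f' z)"
proof
  fix t :: 'a
  have [measurable]: "stft g' f' \<in> borel_measurable borel" by (rule stft_measurable) measurable
  let ?F = "\<lambda>g f z. indicator \<Omega> z *\<^sub>R (stft g' f' z * g (t - fst z) * cis (2 * pi * (snd z \<bullet> t)))"
  have "AE z in lborel. ?F g' f' z = ?F g f z"
    using AE_lborel_fst[OF AE_lborel_reflect[OF ae(2), of t]] by eventually_elim simp
  hence "(LINT z|lebesgue. ?F g f z) = (LINT z|lborel. ?F g' f' z)"
    by (rule lebesgue_integral_AE_borel[rotated]) measurable
  thus "concentration_op g \<Omega> f t = synth g' (\<lambda>z. indicator \<Omega> z * stft g' f' z) t"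
    unfolding concentration_op_def synth_def set_lebesgue_integral_def stft_cong_AE[OF assms(1,2) ae]
    by (simp only:) (intro Bochner_Integration.integral_cong refl, auto simp: mult.assoc split: split_indicator)
qed

text \<open>The inner integral over \<open>t\<close> is the constant \<open>nsq lborel g\<close>, by
  translation invariance. This is the absolute convergence behind \<open>synth\<close>.\<close>

lemma pair_integrable_window:
  fixes g :: "'a::euclidean_space \<Rightarrow> complex"
  assumes g: "sqint lborel g" and Q: "integrable lborel (q :: 'a \<times> 'a \<Rightarrow> real)"
  shows "integrable (lborel \<Otimes>\<^sub>M lborel) (\<lambda>(z :: 'a \<times> 'a, t). q z * (cmod (g (t - fst z)))\<^sup>2)"
proof (rule lborel_pair.Fubini_integrable)
  have [measurable]: "g \<in> borel_measurable borel" "q \<in> borel_measurable borel" using g Q by auto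
  show "(\<lambda>(z :: 'a \<times> 'a, t). q z * (cmod (g (t - fst z)))\<^sup>2) \<in> borel_measurable (lborel \<Otimes>\<^sub>M lborel)"
    by measurable
  have "(LINT t|lborel. (cmod (g (t - x)))\<^sup>2) = nsq lborel g" for x
    using nsq_translate[OF g, of x] by (simp add: nsq_def)
  thus "integrable lborel (\<lambda>z. LINT t|lborel. norm (case (z, t) of (z, t) \<Rightarrow> q z * (cmod (g (t - fst z)))\<^sup>2))"
    using Q by (simp add: abs_mult)
  have "integrable lborel (\<lambda>t. (cmod (g (t - x)))\<^sup>2)" for x by (rule sqint_integrable[OF sqint_translate[OF g]])
  thus "AE z in lborel. integrable lborel (\<lambda>t. case (z, t) of (z, t) \<Rightarrow> q z * (cmod (g (t - fst z)))\<^sup>2)"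
    by auto
qed

text \<open>In the final theorem the locale is entered with the dilated set in the role of \<Omega>
  and a Borel representative in the role of \<open>g\<close>.\<close>

locale window =
  fixes g :: "'a::euclidean_space \<Rightarrow> complex" and \<Omega> :: "('a \<times> 'a) set"
  assumes g: "sqint lborel g" and g1: "nsq lborel g = 1" and \<Omega>: "compact \<Omega>"
begin

lemma g_borel [measurable]: "g \<in> borel_measurable borel"
  using g by simp

lemma \<Omega>_borel [measurable]: "\<Omega> \<in> sets borel"
  using \<Omega> by (rule borel_compact)

lemma \<Omega>_finite: "emeasure lborel \<Omega> < \<infinity>"
  using \<Omega> by (intro emeasure_bounded_finite compact_imp_bounded)

lemma \<Omega>_integrable: "integrable lborel (indicator \<Omega> :: _ \<Rightarrow> real)"
  using \<Omega>_finite by (simp add: integrable_indicator_iff)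

text \<open>Cauchy-Schwarz in \<open>z\<close> bounds \<open>synth g F t\<close> by the norm of
  \<open>F\<close> and the mass over \<Omega> of the squared window seen from \<open>t\<close>. This
  mass is finite for almost every \<open>t\<close> and integrable in \<open>t\<close>, because
  \<Omega> has finite measure and carries \<open>F\<close>.\<close>

lemma synth_sqint:
  assumes F: "sqint lborel F" and supp: "\<And>z. z \<notin> \<Omega> \<Longrightarrow> F z = 0"
  shows "sqint lborel (synth g F)"
proof -
  have [measurable]: "F \<in> borel_measurable borel" using F by simp
  let ?k = "\<lambda>t z. cnj (indicator \<Omega> z * (g (t - fst z) * cis (2 * pi * (snd z \<bullet> t))))"
  have Fk: "synth g F t = ip lborel F (?k t)" for t
    unfolding synth_def ip_def using supp
    by (intro Bochner_Integration.integral_cong) (auto split: split_indicator)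
  let ?G = "\<lambda>t. LINT z|lborel. indicator \<Omega> z * (cmod (g (t - fst z)))\<^sup>2"
  have pair: "integrable (lborel \<Otimes>\<^sub>M lborel) (\<lambda>(z, t). indicator \<Omega> z * (cmod (g (t - fst z)))\<^sup>2)"
    by (rule pair_integrable_window[OF g \<Omega>_integrable])
  have bound: "AE t in lborel. (cmod (synth g F t))\<^sup>2 \<le> nsq lborel F * ?G t"
    using lborel_pair.AE_integrable_snd[OF pair]
  proof eventually_elim
    case (elim t)
    have eq: "(cmod (?k t z))\<^sup>2 = indicator \<Omega> z * (cmod (g (t - fst z)))\<^sup>2" for z
      by (auto simp: norm_mult split: split_indicator)
    have k: "sqint lborel (?k t)"
      by (rule sqintI) (measurable, use elim in \<open>simp only: eq\<close>)
    show ?case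
      using ip_Cauchy_Schwarz[OF F k] by (simp only: Fk nsq_def[of _ "?k t"] eq)
  qed
  show ?thesis
  proof (rule sqint_bound[OF _ _ bound])
    have "(\<lambda>t. LINT z|lborel. F z * (g (t - fst z) * cis (2 * pi * (snd z \<bullet> t)))) \<in> borel_measurable borel"
      by (intro lborel.borel_measurable_lebesgue_integral) measurable
    thus "synth g F \<in> borel_measurable lborel" by (simp add: synth_def[abs_def])
    show "integrable lborel (\<lambda>t. nsq lborel F * ?G t)"
      using lborel_pair.integrable_snd[OF pair] by simp
  qed
qed

text \<open>Fubini. The triple product of \<open>F\<close>, window and \<open>h\<close> is dominated
  by the squared window over \<Omega> plus the product of the squares of \<open>F\<close> and
  \<open>h\<close>, both integrable in \<open>(z, t)\<close>.\<close>

lemma ip_synth: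
  assumes F: "sqint lborel F" and supp: "\<And>z. z \<notin> \<Omega> \<Longrightarrow> F z = 0" and h: "sqint lborel h"
  shows "ip lborel (synth g F) h = ip lborel F (stft g h)"
proof -
  have [measurable]: "F \<in> borel_measurable borel" "h \<in> borel_measurable borel" using F h by auto
  let ?K = "\<lambda>z t. F z * (g (t - fst z) * cis (2 * pi * (snd z \<bullet> t))) * cnj (h t)"
  have p1: "integrable (lborel \<Otimes>\<^sub>M lborel) (\<lambda>(z :: 'a \<times> 'a, t). indicator \<Omega> z * (cmod (g (t - fst z)))\<^sup>2)"
    by (rule pair_integrable_window[OF g \<Omega>_integrable])
  have "integrable (lborel \<Otimes>\<^sub>M lborel) (\<lambda>(z, t). complex_of_real ((cmod (F z))\<^sup>2) * complex_of_real ((cmod (h t))\<^sup>2))"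
    using F h by (intro integrable_pair_product sigma_finite_lborel integrable_of_real) auto
  hence p2: "integrable (lborel \<Otimes>\<^sub>M lborel) (\<lambda>(z, t). (cmod (F z))\<^sup>2 * (cmod (h t))\<^sup>2)"
    by (subst complex_of_real_integrable_eq[symmetric]) (simp add: case_prod_unfold)
  have int: "integrable (lborel \<Otimes>\<^sub>M lborel) (\<lambda>(z, t). ?K z t)"
  proof (rule Bochner_Integration.integrable_bound[OF Bochner_Integration.integrable_add[OF p1 p2]])
    show "(\<lambda>(z, t). ?K z t) \<in> borel_measurable (lborel \<Otimes>\<^sub>M lborel)" by measurable
    have "cmod (?K z t) \<le> indicator \<Omega> z * (cmod (g (t - fst z)))\<^sup>2 + (cmod (F z))\<^sup>2 * (cmod (h t))\<^sup>2" for z t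
    proof (cases "z \<in> \<Omega>")
      case True
      have "2 * (cmod (g (t - fst z)) * (cmod (F z) * cmod (h t)))
          \<le> (cmod (g (t - fst z)))\<^sup>2 + (cmod (F z) * cmod (h t))\<^sup>2"
        using sum_squares_bound[of "cmod (g (t - fst z))" "cmod (F z) * cmod (h t)"] by (simp add: mult.assoc)
      moreover have "0 \<le> cmod (g (t - fst z)) * (cmod (F z) * cmod (h t))" by simp
      ultimately have "cmod (g (t - fst z)) * (cmod (F z) * cmod (h t))
          \<le> (cmod (g (t - fst z)))\<^sup>2 + (cmod (F z) * cmod (h t))\<^sup>2" by linarith
      thus ?thesis using True by (simp add: norm_mult power_mult_distrib mult_ac)
    qed (simp add: supp)
    thus "AE p in lborel \<Otimes>\<^sub>M lborel. norm (case p of (z, t) \<Rightarrow> ?K z t)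
        \<le> norm ((case p of (z, t) \<Rightarrow> indicator \<Omega> z * (cmod (g (t - fst z)))\<^sup>2) + (case p of (z, t) \<Rightarrow> (cmod (F z))\<^sup>2 * (cmod (h t))\<^sup>2))"
      by (intro AE_I2) (auto simp: split_beta intro: order_trans[OF _ abs_ge_self])
  qed
  have "ip lborel (synth g F) h = (LINT t|lborel. LINT z|lborel. ?K z t)"
    by (simp add: ip_def synth_def)
  also have "\<dots> = (LINT z|lborel. LINT t|lborel. ?K z t)"
    by (rule lborel_pair.Fubini_integral[OF int])
  also have "\<dots> = (LINT z|lborel. F z * cnj (stft g h z))"
  proof (intro Bochner_Integration.integral_cong refl)
    fix z :: "'a \<times> 'a"
    have "(LINT t|lborel. ?K z t) = (LINT t|lborel. F z * cnj (h t * cnj (g (t - fst z)) * cis (- 2 * pi * (snd z \<bullet> t))))"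
      by (intro Bochner_Integration.integral_cong refl) (simp add: cis_cnj mult_ac)
    also have "\<dots> = F z * cnj (LINT t|lborel. h t * cnj (g (t - fst z)) * cis (- 2 * pi * (snd z \<bullet> t)))"
      by (simp only: integral_mult_right_zero Bochner_Integration.integral_cnj)
    also have "(LINT t|lborel. h t * cnj (g (t - fst z)) * cis (- 2 * pi * (snd z \<bullet> t))) = stft g h z"
      using stft_lborel[of h g "fst z" "snd z"] by (simp add: fourier_def)
    finally show "(LINT t|lborel. ?K z t) = F z * cnj (stft g h z)" .
  qed
  finally show ?thesis by (simp add: ip_def)
qed

lemma moyal:
  assumes "sqint lborel f"
  shows "sqint lborel (stft g f)" "nsq lborel (stft g f) = nsq lborel f"
  using Moyal[OF assms g] by (auto simp: g1)

text \<open>The adjoint of an isometry is a contraction: the squared norm of the difference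
  \<open>p\<close> equals the inner product of \<open>F - G\<close> with \<open>stft g p\<close>,
  whose norm is that of \<open>p\<close>. The difference is handled through inner products, since
  the integral defining \<open>synth g F t\<close> is only known to converge for almost every
  \<open>t\<close>.\<close>

lemma synth_diff_nsq:
  assumes F: "sqint lborel F" "\<And>z. z \<notin> \<Omega> \<Longrightarrow> F z = 0" and G: "sqint lborel G" "\<And>z. z \<notin> \<Omega> \<Longrightarrow> G z = 0"
  shows "nsq lborel (\<lambda>t. synth g F t - synth g G t) \<le> nsq lborel (\<lambda>z. F z - G z)"
proof -
  let ?p = "\<lambda>t. synth g F t - synth g G t" and ?d = "\<lambda>z. F z - G z"
  have s: "sqint lborel (synth g F)" "sqint lborel (synth g G)" using synth_sqint F G by auto
  hence p: "sqint lborel ?p" by (rule sqint_diff)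
  have d: "sqint lborel ?d" using F G by auto
  have iF: "ip lborel (synth g F) ?p = ip lborel F (stft g ?p)" by (rule ip_synth[OF F(1) _ p]) (rule F(2))
  have iG: "ip lborel (synth g G) ?p = ip lborel G (stft g ?p)" by (rule ip_synth[OF G(1) _ p]) (rule G(2))
  have "complex_of_real (nsq lborel ?p) = ip lborel ?d (stft g ?p)"
    unfolding ip_self[symmetric]
    by (subst ip_diff_left[OF s p], subst ip_diff_left[OF F(1) G(1) moyal(1)[OF p]])
       (simp only: iF iG)
  hence "(nsq lborel ?p)\<^sup>2 \<le> nsq lborel ?d * nsq lborel ?p"
    using ip_Cauchy_Schwarz[OF d moyal(1)[OF p]] moyal(2)[OF p]
    by (metis norm_of_real power2_abs)
  thus ?thesis using nsq_nonneg[of lborel ?p] nsq_nonneg[of lborel ?d]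
    by (cases "nsq lborel ?p = 0") (auto simp: power2_eq_square mult_le_cancel_right)
qed

text \<open>\<open>T\<close> is the composition of \<open>W\<close> with its adjoint, so
  \<open>nsq lborel (W f)\<close> is the quadratic form of the concentration operator.
  \<open>W\<close> is linear at every point, being given by inner products, and most arguments are
  therefore carried out on \<open>W\<close>.\<close>

definition W :: "('a \<Rightarrow> complex) \<Rightarrow> 'a \<times> 'a \<Rightarrow> complex" where
  "W f z = indicator \<Omega> z * stft g f z"

definition T :: "('a \<Rightarrow> complex) \<Rightarrow> 'a \<Rightarrow> complex" where
  "T f = synth g (W f)"

lemma W_outside: "z \<notin> \<Omega> \<Longrightarrow> W f z = 0"
  by (simp add: W_def)

lemma W_sqint: assumes "sqint lborel f" shows "sqint lborel (W f)"
proof (rule sqint_bound[OF _ sqint_integrable[OF moyal(1)[OF assms]]])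
  have [measurable]: "stft g f \<in> borel_measurable borel" using moyal(1)[OF assms] by simp
  show "W f \<in> borel_measurable lborel" unfolding W_def[abs_def] by measurable
qed (auto simp: W_def split: split_indicator)

lemma W_nsq_le: assumes "sqint lborel f" shows "nsq lborel (W f) \<le> nsq lborel f"
proof -
  have "nsq lborel (W f) \<le> nsq lborel (stft g f)"
    unfolding nsq_def
    by (rule integral_mono[OF sqint_integrable[OF W_sqint[OF assms]] sqint_integrable[OF moyal(1)[OF assms]]])
       (auto simp: W_def split: split_indicator)
  thus ?thesis using moyal(2)[OF assms] by simp
qed

lemma T_sqint: "sqint lborel f \<Longrightarrow> sqint lborel (T f)"
  unfolding T_def by (intro synth_sqint W_sqint W_outside)

lemma ip_T: assumes "sqint lborel f" "sqint lborel h" shows "ip lborel (T f) h = ip lborel (W f) (W h)"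
proof -
  have "ip lborel (T f) h = ip lborel (W f) (stft g h)"
    unfolding T_def by (rule ip_synth[OF W_sqint[OF assms(1)] W_outside assms(2)])
  also have "\<dots> = ip lborel (W f) (W h)"
    unfolding ip_def by (intro Bochner_Integration.integral_cong) (auto simp: W_def split: split_indicator)
  finally show ?thesis .
qed

lemma ip_T_sym: assumes "sqint lborel f" "sqint lborel h" shows "ip lborel (T f) h = ip lborel f (T h)"
  using ip_T[OF assms] ip_T[OF assms(2,1)] by (metis ip_cnj)

text \<open>These are the vectors \<open>k\<^sub>z\<close> of the overview.\<close>

definition tfshift :: "'a \<times> 'a \<Rightarrow> 'a \<Rightarrow> complex" where
  "tfshift z t = g (t - fst z) * cis (2 * pi * (snd z \<bullet> t))"

lemma tfshift_sqint: "sqint lborel (tfshift z)"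
proof (rule sqint_bound)
  show "tfshift z \<in> borel_measurable lborel" unfolding tfshift_def[abs_def] by measurable
  show "integrable lborel (\<lambda>t. (cmod (g (t - fst z)))\<^sup>2)" by (rule sqint_integrable[OF sqint_translate[OF g]])
qed (auto simp: tfshift_def norm_mult)

lemma tfshift_nsq: "nsq lborel (tfshift z) = 1"
proof -
  have "nsq lborel (tfshift z) = nsq lborel (\<lambda>t. g (t - fst z))" by (simp add: nsq_def tfshift_def norm_mult)
  thus ?thesis using nsq_translate[OF g, of "fst z"] g1 by simp
qed

lemma stft_ip:
  assumes "sqint lborel f"
  shows "stft g f z = ip lborel f (tfshift z)"
proof -
  have [measurable]: "f \<in> borel_measurable borel" using assms by simp
  have "stft g f z = (LINT t|lborel. f t * cnj (g (t - fst z)) * cis (- 2 * pi * (snd z \<bullet> t)))"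
    using stft_lborel[of f g "fst z" "snd z"] by (simp add: fourier_def)
  also have "\<dots> = ip lborel f (tfshift z)"
    unfolding ip_def tfshift_def by (intro Bochner_Integration.integral_cong refl) (simp add: cis_cnj mult_ac)
  finally show ?thesis .
qed

lemma W_add: "sqint lborel f \<Longrightarrow> sqint lborel h \<Longrightarrow> W (\<lambda>t. f t + h t) = (\<lambda>z. W f z + W h z)"
  by (auto simp: W_def stft_ip sqint_add ip_add_left tfshift_sqint distrib_left)

lemma W_diff: "sqint lborel f \<Longrightarrow> sqint lborel h \<Longrightarrow> W (\<lambda>t. f t - h t) = (\<lambda>z. W f z - W h z)"
  by (auto simp: W_def stft_ip sqint_diff ip_diff_left tfshift_sqint right_diff_distrib)

lemma W_cmult: "sqint lborel f \<Longrightarrow> W (\<lambda>t. c * f t) = (\<lambda>z. c * W f z)"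
  by (auto simp: W_def stft_ip sqint_cmult ip_cmult_left mult_ac)

lemma T_cmult: "sqint lborel f \<Longrightarrow> T (\<lambda>t. c * f t) = (\<lambda>t. c * T f t)"
  unfolding T_def synth_def[abs_def] by (simp add: W_cmult mult.assoc)

lemma T_diff_nsq:
  assumes "sqint lborel f" "sqint lborel h"
  shows "nsq lborel (\<lambda>t. T f t - T h t) \<le> nsq lborel (\<lambda>t. f t - h t)"
proof -
  have "nsq lborel (\<lambda>t. T f t - T h t) \<le> nsq lborel (\<lambda>z. W f z - W h z)"
    unfolding T_def by (intro synth_diff_nsq W_sqint W_outside assms)
  also have "\<dots> = nsq lborel (W (\<lambda>t. f t - h t))" using assms by (simp add: W_diff)
  also have "\<dots> \<le> nsq lborel (\<lambda>t. f t - h t)" by (intro W_nsq_le sqint_diff assms)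
  finally show ?thesis .
qed

end

section \<open>Existence of eigenvectors\<close>

context window begin

text \<open>The increment is split into a change of translation \<open>a\<close>, controlled by
  continuity of translations, and a change of modulation \<open>b\<close>, controlled by dominated
  convergence with bound four times the squared window.\<close>

lemma tfshift_continuous: "((\<lambda>w. nsq lborel (\<lambda>t. tfshift w t - tfshift z t)) \<longlongrightarrow> 0) (at z)"
  unfolding tendsto_at_iff_sequentially comp_def
proof (intro allI impI)
  fix X :: "nat \<Rightarrow> 'a \<times> 'a" assume X: "\<forall>i. X i \<in> UNIV - {z}" "X \<longlonglongrightarrow> z"
  let ?x = "fst z" and ?\<xi> = "snd z"
  have lim: "(\<lambda>i. fst (X i)) \<longlonglongrightarrow> ?x" "(\<lambda>i. snd (X i)) \<longlonglongrightarrow> ?\<xi>"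
    using X(2) by (auto intro: tendsto_intros)
  have cis_cont: "isCont cis y" for y :: real
    using continuous_on_cis[OF continuous_on_id, of UNIV] by (simp add: continuous_on_eq_continuous_at)
  define a where "a i t = (g (t - fst (X i)) - g (t - ?x)) * cis (2 * pi * (snd (X i) \<bullet> t))" for i t
  define b where "b i t = g (t - ?x) * (cis (2 * pi * (snd (X i) \<bullet> t)) - cis (2 * pi * (?\<xi> \<bullet> t)))" for i t
  let ?d = "\<lambda>u. nsq lborel (\<lambda>t. g (t - u) - g t)"
  have a_sq: "(cmod (a i t))\<^sup>2 = (cmod (g (t - fst (X i)) - g (t - ?x)))\<^sup>2" for i t
    by (simp add: a_def norm_mult)
  have a: "sqint lborel (a i)" for i
  proof (rule sqintI)
    show "a i \<in> borel_measurable lborel" unfolding a_def[abs_def] by measurable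
    show "integrable lborel (\<lambda>t. (cmod (a i t))\<^sup>2)"
      unfolding a_sq by (rule sqint_integrable[OF sqint_diff[OF sqint_translate[OF g] sqint_translate[OF g]]])
  qed
  have na: "nsq lborel (a i) = ?d (fst (X i) - ?x)" for i
  proof -
    have "?d (fst (X i) - ?x) = nsq lborel (\<lambda>t. g (t - ?x - (fst (X i) - ?x)) - g (t - ?x))"
      by (rule nsq_translate[symmetric, OF sqint_diff[OF sqint_translate[OF g] g]])
    thus ?thesis by (simp add: nsq_def a_sq)
  qed
  have "isCont ?d 0"
    using translation_continuous_sqint[OF g] by (simp add: isCont_def translation_continuous_def nsq_def)
  moreover have "(\<lambda>i. fst (X i) - ?x) \<longlonglongrightarrow> 0" using lim(1) by (simp add: LIM_zero)
  ultimately have "(\<lambda>i. ?d (fst (X i) - ?x)) \<longlonglongrightarrow> ?d 0" by (rule isCont_tendsto_compose)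
  hence la: "(\<lambda>i. nsq lborel (a i)) \<longlonglongrightarrow> 0" by (simp add: na) (simp add: nsq_def)
  have b_le: "(cmod (b i t))\<^sup>2 \<le> 4 * (cmod (g (t - ?x)))\<^sup>2" for i t
  proof -
    have "cmod (cis (2 * pi * (snd (X i) \<bullet> t)) - cis (2 * pi * (?\<xi> \<bullet> t))) \<le> 2"
      by (rule order_trans[OF norm_triangle_ineq4]) simp
    hence "cmod (b i t) \<le> cmod (g (t - ?x)) * 2" unfolding b_def norm_mult by (rule mult_left_mono) simp
    hence "(cmod (b i t))\<^sup>2 \<le> (cmod (g (t - ?x)) * 2)\<^sup>2" by (rule power_mono) simp
    thus ?thesis by (simp add: power_mult_distrib)
  qed
  have gx: "integrable lborel (\<lambda>t. 4 * (cmod (g (t - ?x)))\<^sup>2)"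
    using sqint_integrable[OF sqint_translate[OF g, of ?x]] by simp
  have bm [measurable]: "b i \<in> borel_measurable lborel" for i unfolding b_def[abs_def] by measurable
  have b: "sqint lborel (b i)" for i
    by (rule sqint_bound[OF bm gx]) (simp add: b_le)
  have "(\<lambda>i. nsq lborel (b i)) \<longlonglongrightarrow> (LINT t|(lborel :: 'a measure). 0)"
    unfolding nsq_def
  proof (rule integral_dominated_convergence[OF _ _ gx])
    show "AE t in lborel. (\<lambda>i. (cmod (b i t))\<^sup>2) \<longlonglongrightarrow> 0"
    proof (rule AE_I2)
      fix t
      have "(\<lambda>i. cis (2 * pi * (snd (X i) \<bullet> t))) \<longlonglongrightarrow> cis (2 * pi * (?\<xi> \<bullet> t))"
        by (intro tendsto_intros lim isCont_tendsto_compose[OF cis_cont])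
      hence "(\<lambda>i. (cmod (b i t))\<^sup>2) \<longlonglongrightarrow> (cmod (g (t - ?x) * (cis (2 * pi * (?\<xi> \<bullet> t)) - cis (2 * pi * (?\<xi> \<bullet> t)))))\<^sup>2"
        unfolding b_def by (intro tendsto_power tendsto_norm tendsto_mult tendsto_diff tendsto_const)
      thus "(\<lambda>i. (cmod (b i t))\<^sup>2) \<longlonglongrightarrow> 0" by simp
    qed
    show "AE t in lborel. norm ((cmod (b i t))\<^sup>2) \<le> 4 * (cmod (g (t - ?x)))\<^sup>2" for i
      using b_le by simp
  qed auto
  hence lb: "(\<lambda>i. nsq lborel (b i)) \<longlonglongrightarrow> 0" by simp
  show "(\<lambda>i. nsq lborel (\<lambda>t. tfshift (X i) t - tfshift z t)) \<longlonglongrightarrow> 0"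
  proof (rule tendsto_sandwich[OF _ _ tendsto_const])
    show "\<forall>\<^sub>F i in sequentially. nsq lborel (\<lambda>t. tfshift (X i) t - tfshift z t) \<le> 2 * nsq lborel (a i) + 2 * nsq lborel (b i)"
    proof (rule always_eventually, rule allI)
      fix i
      have "(\<lambda>t. tfshift (X i) t - tfshift z t) = (\<lambda>t. a i t + b i t)"
        by (auto simp: tfshift_def a_def b_def algebra_simps)
      thus "nsq lborel (\<lambda>t. tfshift (X i) t - tfshift z t) \<le> 2 * nsq lborel (a i) + 2 * nsq lborel (b i)"
        using nsq_add_le[OF a b] by simp
    qed
    show "(\<lambda>i. 2 * nsq lborel (a i) + 2 * nsq lborel (b i)) \<longlonglongrightarrow> 0"
      by (auto intro!: tendsto_eq_intros la lb)
  qed auto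
qed

text \<open>By Cauchy-Schwarz the increment is at most the norm of \<open>f\<close> times that of
  the increment of \<open>tfshift\<close>, so one modulus of continuity serves the whole unit
  ball.\<close>

lemma stft_equicontinuous:
  assumes "e > 0"
  shows "\<exists>d>0. \<forall>w f. norm (z - w) < d \<longrightarrow> sqint lborel f \<longrightarrow> nsq lborel f \<le> 1 \<longrightarrow> cmod (stft g f z - stft g f w) < e"
proof -
  have "\<forall>\<^sub>F w in at z. nsq lborel (\<lambda>t. tfshift w t - tfshift z t) < e\<^sup>2"
    using order_tendstoD(2)[OF tfshift_continuous, of "e\<^sup>2"] assms by simp
  then obtain d where d: "d > 0" "\<And>w. w \<noteq> z \<Longrightarrow> dist w z < d \<Longrightarrow> nsq lborel (\<lambda>t. tfshift w t - tfshift z t) < e\<^sup>2"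
    by (auto simp: eventually_at)
  have "cmod (stft g f z - stft g f w) < e" if "norm (z - w) < d" and f: "sqint lborel f" "nsq lborel f \<le> 1" for w f
  proof (cases "w = z")
    case False
    have D: "sqint lborel (\<lambda>t. tfshift w t - tfshift z t)" by (intro sqint_diff tfshift_sqint)
    have "stft g f w - stft g f z = ip lborel f (\<lambda>t. tfshift w t - tfshift z t)"
      by (simp add: stft_ip f ip_diff_right tfshift_sqint)
    hence "(cmod (stft g f z - stft g f w))\<^sup>2 \<le> nsq lborel f * nsq lborel (\<lambda>t. tfshift w t - tfshift z t)"
      using ip_Cauchy_Schwarz[OF f(1) D] by (simp add: norm_minus_commute)
    also have "\<dots> \<le> 1 * nsq lborel (\<lambda>t. tfshift w t - tfshift z t)" using f by (intro mult_right_mono) auto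
    also have "\<dots> < e\<^sup>2" using d(2)[OF False] that(1) by (simp add: dist_norm norm_minus_commute)
    finally show ?thesis using assms by (simp add: power2_less_imp_less)
  qed (use assms in simp)
  thus ?thesis using d(1) by blast
qed

lemma stft_bound:
  assumes "sqint lborel f"
  shows "(cmod (stft g f z))\<^sup>2 \<le> nsq lborel f"
  using ip_Cauchy_Schwarz[OF assms tfshift_sqint[of z]] by (simp add: stft_ip[OF assms] tfshift_nsq)

text \<open>Compactness of \<open>T\<close>. The transforms are bounded by 1 and equicontinuous, so
  Arzela-Ascoli on the compact \<Omega> gives a uniformly convergent subsequence. As \<Omega> has
  finite measure, the functions \<open>W (f (k n))\<close> converge in the square norm, and
  \<open>synth\<close> is a contraction.\<close>

lemma subsequence_T_converges:
  assumes f: "\<And>n. sqint lborel (f n)" "\<And>n. nsq lborel (f n) = 1"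
  obtains h k where "sqint lborel h" "strict_mono (k :: nat \<Rightarrow> nat)"
    "(\<lambda>n. nsq lborel (\<lambda>t. T (f (k n)) t - h t)) \<longlonglongrightarrow> 0"
proof -
  have 1: "norm (stft g (f n) z) \<le> 1" for n z
    using stft_bound[OF f(1), of n z] f(2)[of n] by (simp add: power_le_one_iff abs_square_le_1)
  have 2: "\<exists>d. 0 < d \<and> (\<forall>n w. w \<in> \<Omega> \<and> norm (z - w) < d \<longrightarrow> norm (stft g (f n) z - stft g (f n) w) < e)" if "0 < e" for z e
    using stft_equicontinuous[OF that, of z] f by (metis order_refl)
  obtain G k where G: "continuous_on \<Omega> G" and k: "strict_mono (k :: nat \<Rightarrow> nat)"
    and lim: "\<And>e. 0 < e \<Longrightarrow> \<exists>N. \<forall>n z. n \<ge> N \<and> z \<in> \<Omega> \<longrightarrow> norm (stft g (f (k n)) z - G z) < e"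
    using Arzela_Ascoli[OF \<Omega>, of "\<lambda>n. stft g (f n)" 1] 1 2 by blast
  define H where "H z = indicator \<Omega> z *\<^sub>R G z" for z
  have H0: "H z = 0" if "z \<notin> \<Omega>" for z using that by (simp add: H_def)
  have Hm: "H \<in> borel_measurable lborel"
    unfolding H_def[abs_def] using borel_measurable_continuous_on_indicator[OF _ G] \<Omega>_borel by simp
  have bnd: "norm (G z) \<le> 2" if "z \<in> \<Omega>" for z
  proof -
    obtain N where "\<forall>n z. n \<ge> N \<and> z \<in> \<Omega> \<longrightarrow> norm (stft g (f (k n)) z - G z) < 1" using lim[of 1] by auto
    hence "norm (stft g (f (k N)) z - G z) < 1" using that by blast
    thus ?thesis using 1[of "k N" z] norm_triangle_ineq4[of "stft g (f (k N)) z" "stft g (f (k N)) z - G z"] by simp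
  qed
  have Hs: "sqint lborel H"
  proof (rule sqint_bound[OF Hm])
    show "integrable lborel (\<lambda>z. 4 * indicator \<Omega> z :: real)" using \<Omega>_integrable by simp
    have "(cmod (H z))\<^sup>2 \<le> 4 * indicator \<Omega> z" for z
      using power_mono[OF bnd, of z 2] by (auto simp: H_def split: split_indicator)
    thus "AE z in lborel. (cmod (H z))\<^sup>2 \<le> 4 * indicator \<Omega> z" by simp
  qed
  have "(\<lambda>n. nsq lborel (\<lambda>z. W (f (k n)) z - H z)) \<longlonglongrightarrow> (LINT z|(lborel :: ('a \<times> 'a) measure). 0)"
    unfolding nsq_def
  proof (rule integral_dominated_convergence[where w = "\<lambda>z. 9 * indicator \<Omega> z"])
    show "integrable lborel (\<lambda>z. 9 * indicator \<Omega> z :: real)" using \<Omega>_integrable by simp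
    show "AE z in lborel. (\<lambda>n. (cmod (W (f (k n)) z - H z))\<^sup>2) \<longlonglongrightarrow> 0"
    proof (rule AE_I2)
      fix z
      show "(\<lambda>n. (cmod (W (f (k n)) z - H z))\<^sup>2) \<longlonglongrightarrow> 0"
      proof (cases "z \<in> \<Omega>")
        case True
        have "(\<lambda>n. stft g (f (k n)) z) \<longlonglongrightarrow> G z"
          unfolding LIMSEQ_iff using lim True by meson
        hence "(\<lambda>n. (cmod (stft g (f (k n)) z - G z))\<^sup>2) \<longlonglongrightarrow> 0" by (auto intro!: tendsto_eq_intros)
        thus ?thesis using True by (simp add: W_def H_def)
      qed (simp add: W_def H_def)
    qed
    fix n
    have "norm ((cmod (W (f (k n)) z - H z))\<^sup>2) \<le> 9 * indicator \<Omega> z" for z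
    proof (cases "z \<in> \<Omega>")
      case True
      have "cmod (W (f (k n)) z - H z) \<le> 3"
        using 1[of "k n" z] bnd[OF True] True norm_triangle_ineq4[of "W (f (k n)) z" "H z"] by (simp add: W_def H_def)
      from power_mono[OF this, of 2] show ?thesis using True by simp
    qed (simp add: W_def H_def)
    thus "AE z in lborel. norm ((cmod (W (f (k n)) z - H z))\<^sup>2) \<le> 9 * indicator \<Omega> z" by simp
    show "(\<lambda>z. (cmod (W (f (k n)) z - H z))\<^sup>2) \<in> borel_measurable lborel"
      using sqint_measurable[OF W_sqint[OF f(1)]] Hm by measurable
  qed auto
  hence W0: "(\<lambda>n. nsq lborel (\<lambda>z. W (f (k n)) z - H z)) \<longlonglongrightarrow> 0" by simp
  show thesis
  proof (rule that[OF _ k])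
    show "sqint lborel (synth g H)" using Hs H0 by (rule synth_sqint)
    show "(\<lambda>n. nsq lborel (\<lambda>t. T (f (k n)) t - synth g H t)) \<longlonglongrightarrow> 0"
    proof (rule tendsto_sandwich[OF _ _ tendsto_const W0])
      show "\<forall>\<^sub>F n in sequentially. nsq lborel (\<lambda>t. T (f (k n)) t - synth g H t) \<le> nsq lborel (\<lambda>z. W (f (k n)) z - H z)"
        unfolding T_def by (intro always_eventually allI synth_diff_nsq W_sqint f W_outside Hs H0)
    qed auto
  qed
qed

text \<open>
  Along a sequence \<open>F\<^sub>n\<close> maximizing the form on the orthogonal complement of the \<open>u\<^sub>i\<close>, with supremum \<open>m\<close>,
  \<open>T F\<^sub>n - m F\<^sub>n\<close> tends to \<open>0\<close>; as \<open>T F\<^sub>n\<close> has a convergent subsequence, so has \<open>F\<^sub>n\<close>.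
\<close>

lemma eigenvector_exists:
  fixes u :: "nat \<Rightarrow> 'a \<Rightarrow> complex"
  assumes u: "\<And>i. i < N \<Longrightarrow> sqint lborel (u i)"
    and eig: "\<And>i. i < N \<Longrightarrow> AE t in lborel. T (u i) t = of_real (l i) * u i t"
    and f0: "sqint lborel f0" "\<And>i. i < N \<Longrightarrow> ip lborel f0 (u i) = 0" "\<delta> * nsq lborel f0 < nsq lborel (W f0)"
    and "\<delta> \<ge> 0"
  shows "\<exists>h m. sqint lborel h \<and> (\<forall>i<N. ip lborel h (u i) = 0) \<and> nsq lborel h > 0 \<and> m > \<delta>
     \<and> (AE t in lborel. T h t = of_real m * h t)"
proof -
  define P where "P f \<longleftrightarrow> sqint lborel f \<and> (\<forall>i<N. ip lborel f (u i) = 0)" for f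
  have Pc: "P (\<lambda>t. c * f t)" if "P f" for f c
    using that sqint_cmult[of lborel f c] by (simp only: P_def ip_cmult_left) simp
  define A where "A = {nsq lborel (W f) |f. P f \<and> nsq lborel f = 1}"
  define m where "m = Sup A"
  have bdd: "bdd_above A" unfolding A_def P_def by (rule bdd_aboveI[of _ 1]) (use W_nsq_le in force)
  have upper: "nsq lborel (W f) \<le> m * nsq lborel f" if "P f" for f
  proof (cases "nsq lborel f = 0")
    case True
    thus ?thesis using W_nsq_le[of f] that by (simp add: P_def)
  next
    case False
    hence pos: "nsq lborel f > 0" using nsq_nonneg[of lborel f] by linarith
    let ?c = "complex_of_real (1 / sqrt (nsq lborel f))"
    have c2: "(cmod ?c)\<^sup>2 = 1 / nsq lborel f" using pos by (simp add: norm_divide power_divide)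
    have "P (\<lambda>t. ?c * f t)" using that by (rule Pc)
    moreover have "nsq lborel (\<lambda>t. ?c * f t) = 1" using pos by (simp only: nsq_cmult c2) simp
    ultimately have "nsq lborel (W (\<lambda>t. ?c * f t)) \<in> A" unfolding A_def by blast
    hence "nsq lborel (W (\<lambda>t. ?c * f t)) \<le> m" unfolding m_def by (rule cSup_upper[OF _ bdd])
    hence "nsq lborel (W f) / nsq lborel f \<le> m"
      using that by (simp only: P_def W_cmult nsq_cmult c2) simp
    thus ?thesis using pos by (simp add: field_simps)
  qed
  have Pf0: "P f0" using f0 by (simp add: P_def)
  have pos0: "nsq lborel f0 > 0"
  proof (rule ccontr)
    assume "\<not> ?thesis"
    hence "nsq lborel f0 = 0" using nsq_nonneg[of lborel f0] by linarith
    thus False using f0(3) W_nsq_le[OF f0(1)] by simp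
  qed
  have md: "m > \<delta>"
    using upper[OF Pf0] f0(3) pos0 by (metis less_le_trans mult_less_cancel_right_pos)
  hence m0: "m > 0" using \<open>\<delta> \<ge> 0\<close> by simp
  have Ane: "A \<noteq> {}"
  proof -
    let ?c = "complex_of_real (1 / sqrt (nsq lborel f0))"
    have c2: "(cmod ?c)\<^sup>2 = 1 / nsq lborel f0" using pos0 by (simp add: norm_divide power_divide)
    have "P (\<lambda>t. ?c * f0 t)" using Pf0 by (rule Pc)
    moreover have "nsq lborel (\<lambda>t. ?c * f0 t) = 1" using pos0 by (simp only: nsq_cmult c2) simp
    ultimately show ?thesis unfolding A_def by blast
  qed
  have "\<exists>f. P f \<and> nsq lborel f = 1 \<and> m - inverse (real (Suc n)) < nsq lborel (W f)" for n
  proof -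
    have "m - inverse (real (Suc n)) < Sup A" unfolding m_def by simp
    then obtain a where "a \<in> A" "m - inverse (real (Suc n)) < a" using less_cSup_iff[OF Ane bdd] by blast
    thus ?thesis unfolding A_def by blast
  qed
  then obtain F where F: "\<And>n. P (F n)" "\<And>n. nsq lborel (F n) = 1" "\<And>n. m - inverse (real (Suc n)) < nsq lborel (W (F n))"
    by metis
  have Fs: "sqint lborel (F n)" for n using F(1) by (simp add: P_def)
  obtain h k where h: "sqint lborel h" and k: "strict_mono (k :: nat \<Rightarrow> nat)"
    and hlim: "(\<lambda>n. nsq lborel (\<lambda>t. T (F (k n)) t - h t)) \<longlonglongrightarrow> 0"
    using subsequence_T_converges[of F] Fs F(2) by blast
  \<comment> \<open>By symmetry of \<open>T\<close>, applied to eigenvectors, the orthogonal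
    complement of the \<open>u i\<close> is invariant.\<close>
  have TP: "P (T f)" if "P f" for f
    unfolding P_def
  proof (intro conjI allI impI)
    have f: "sqint lborel f" using that by (simp add: P_def)
    show "sqint lborel (T f)" by (rule T_sqint[OF f])
    fix i assume i: "i < N"
    have um: "u i \<in> borel_measurable lborel" "T (u i) \<in> borel_measurable lborel"
      using u[OF i] T_sqint[OF u[OF i]] by auto
    have "ip lborel (T f) (u i) = ip lborel f (T (u i))" by (rule ip_T_sym[OF f u[OF i]])
    also have "\<dots> = ip lborel f (\<lambda>t. of_real (l i) * u i t)"
      using um f by (intro ip_cong_AE eig i) auto
    also have "\<dots> = 0" using that i by (simp add: ip_cmult_right P_def)
    finally show "ip lborel (T f) (u i) = 0" .
  qed
  \<comment> \<open>The squared norm of \<open>T f\<close> is the form evaluated at \<open>f\<close>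
    and \<open>T f\<close>, and \<open>T f\<close> is again in the complement. Cauchy-Schwarz and
    \<open>upper\<close> therefore give \<open>nsq lborel (T f) \<le> m * nsq lborel (W f)\<close>;
    expanding the square leaves a quantity that tends to 0 along a maximizing sequence.\<close>
  have beta: "nsq lborel (\<lambda>t. T f t - of_real m * f t) \<le> m\<^sup>2 - m * nsq lborel (W f)" if "P f" "nsq lborel f = 1" for f
  proof -
    have f: "sqint lborel f" using that by (simp add: P_def)
    have Tf: "sqint lborel (T f)" by (rule T_sqint[OF f])
    have "(nsq lborel (T f))\<^sup>2 \<le> m * nsq lborel (W f) * nsq lborel (T f)"
    proof -
      have "complex_of_real (nsq lborel (T f)) = ip lborel (W f) (W (T f))"
        using ip_T[OF f Tf] by (simp add: ip_self)
      hence "(nsq lborel (T f))\<^sup>2 \<le> nsq lborel (W f) * nsq lborel (W (T f))"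
        using ip_Cauchy_Schwarz[OF W_sqint[OF f] W_sqint[OF Tf]] by (metis norm_of_real power2_abs)
      also have "\<dots> \<le> nsq lborel (W f) * (m * nsq lborel (T f))"
        by (intro mult_left_mono upper TP that) simp
      finally show ?thesis by (simp add: mult_ac)
    qed
    hence Tle: "nsq lborel (T f) \<le> m * nsq lborel (W f)"
      using nsq_nonneg[of lborel "T f"] m0 nsq_nonneg[of lborel "W f"]
      by (cases "nsq lborel (T f) = 0") (auto simp: power2_eq_square mult_le_cancel_right)
    have "ip lborel (T f) f = of_real (nsq lborel (W f))" using ip_T[OF f f] by (simp add: ip_self)
    hence "nsq lborel (\<lambda>t. T f t - of_real m * f t) = nsq lborel (T f) + m\<^sup>2 - 2 * (m * nsq lborel (W f))"
      using nsq_diff[OF Tf sqint_cmult[OF f, of "of_real m"]] that(2) by (simp add: nsq_cmult ip_cmult_right)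
    thus ?thesis using Tle by simp
  qed
  define q where "q n = nsq lborel (\<lambda>t. h t - of_real m * F (k n) t)" for n
  define p where "p n = nsq lborel (\<lambda>t. T (F (k n)) t - h t)" for n
  have p0: "p \<longlonglongrightarrow> 0" using hlim by (simp add: p_def[abs_def])
  have mF: "sqint lborel (\<lambda>t. of_real m * F n t)" for n using Fs by (rule sqint_cmult)
  have D: "sqint lborel (\<lambda>t. h t - of_real m * F n t)" for n using h mF by (rule sqint_diff)
  \<comment> \<open>\<open>h - m F\<close> is the sum of \<open>h - T F\<close>, small by choice of
    the subsequence, and \<open>T F - m F\<close>, small by \<open>beta\<close>. Thus
    \<open>m F\<close> converges to \<open>h\<close>.\<close>
  have q0: "q \<longlonglongrightarrow> 0"
  proof (rule tendsto_sandwich[OF _ _ tendsto_const])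
    have "q n \<le> 2 * p n + 2 * (m * inverse (real (Suc n)))" for n
    proof -
      have s1: "sqint lborel (\<lambda>t. h t - T (F (k n)) t)" and s2: "sqint lborel (\<lambda>t. T (F (k n)) t - of_real m * F (k n) t)"
        using h T_sqint[OF Fs] mF by auto
      have "q n = nsq lborel (\<lambda>t. (h t - T (F (k n)) t) + (T (F (k n)) t - of_real m * F (k n) t))"
        by (simp add: q_def)
      also have "\<dots> \<le> 2 * nsq lborel (\<lambda>t. h t - T (F (k n)) t) + 2 * nsq lborel (\<lambda>t. T (F (k n)) t - of_real m * F (k n) t)"
        by (rule nsq_add_le[OF s1 s2])
      also have "nsq lborel (\<lambda>t. h t - T (F (k n)) t) = p n" by (simp add: p_def nsq_def norm_minus_commute)
      also have "nsq lborel (\<lambda>t. T (F (k n)) t - of_real m * F (k n) t) \<le> m * inverse (real (Suc n))"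
      proof -
        have "n \<le> k n" using k by (rule seq_suble)
        hence "inverse (real (Suc (k n))) \<le> inverse (real (Suc n))" by (intro le_imp_inverse_le) auto
        hence "m - nsq lborel (W (F (k n))) \<le> inverse (real (Suc n))" using F(3)[of "k n"] by linarith
        hence "m * (m - nsq lborel (W (F (k n)))) \<le> m * inverse (real (Suc n))" using m0 by (intro mult_left_mono) auto
        thus ?thesis using beta[OF F(1,2), of "k n"] by (simp add: power2_eq_square right_diff_distrib)
      qed
      finally show ?thesis by simp
    qed
    thus "\<forall>\<^sub>F n in sequentially. q n \<le> 2 * p n + 2 * (m * inverse (real (Suc n)))" by simp
    show "(\<lambda>n. 2 * p n + 2 * (m * inverse (real (Suc n)))) \<longlonglongrightarrow> 0"
      by (rule tendsto_eq_rhs[OF tendsto_add[OF tendsto_mult_left[OF p0] tendsto_mult_left[OF tendsto_mult_left[OF LIMSEQ_inverse_real_of_nat]]]]) simp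
  qed (auto simp: q_def)
  have orth: "ip lborel h (u i) = 0" if i: "i < N" for i
  proof -
    have "(cmod (ip lborel h (u i)))\<^sup>2 \<le> q n * nsq lborel (u i)" for n
    proof -
      have "ip lborel (\<lambda>t. h t - of_real m * F (k n) t) (u i) = ip lborel h (u i)"
        using F(1)[of "k n"] i by (simp add: ip_diff_left h mF u ip_cmult_left P_def)
      thus ?thesis using ip_Cauchy_Schwarz[OF D u[OF i], of "k n"] by (simp add: q_def)
    qed
    moreover have "(\<lambda>n. q n * nsq lborel (u i)) \<longlonglongrightarrow> 0 * nsq lborel (u i)" by (intro tendsto_intros q0)
    ultimately have "(cmod (ip lborel h (u i)))\<^sup>2 \<le> 0 * nsq lborel (u i)" by (intro LIMSEQ_le_const) auto
    thus ?thesis by simp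
  qed
  \<comment> \<open>\<open>h\<close> is the limit of \<open>m F\<close> with unit vectors
    \<open>F\<close>, so it cannot vanish as \<open>m > 0\<close>.\<close>
  have pos: "nsq lborel h > 0"
  proof -
    have "m\<^sup>2 \<le> 2 * nsq lborel h + 2 * q n" for n
    proof -
      have "m\<^sup>2 = nsq lborel (\<lambda>t. h t + (- 1) * (h t - of_real m * F (k n) t))"
        using nsq_cmult[of lborel "of_real m" "F (k n)"] F(2)[of "k n"] by simp
      also have "\<dots> \<le> 2 * nsq lborel h + 2 * nsq lborel (\<lambda>t. (- 1) * (h t - of_real m * F (k n) t))"
        by (rule nsq_add_le[OF h sqint_cmult[OF D]])
      also have "nsq lborel (\<lambda>t. (- 1) * (h t - of_real m * F (k n) t)) = q n"
        by (simp only: nsq_cmult q_def) simp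
      finally show ?thesis .
    qed
    moreover have "(\<lambda>n. 2 * nsq lborel h + 2 * q n) \<longlonglongrightarrow> 2 * nsq lborel h + 2 * 0" by (intro tendsto_intros q0)
    ultimately have "m\<^sup>2 \<le> 2 * nsq lborel h + 2 * 0" by (intro LIMSEQ_le_const) auto
    thus ?thesis using zero_less_power[OF m0, of 2] by linarith
  qed
  have Th: "sqint lborel (T h)" by (rule T_sqint[OF h])
  have E: "sqint lborel (\<lambda>t. T h t - of_real m * h t)" using Th sqint_cmult[OF h] by (rule sqint_diff)
  have "nsq lborel (\<lambda>t. T h t - of_real m * h t) \<le> 2 * q n + 2 * (m\<^sup>2 * p n)" for n
  proof -
    let ?f = "F (k n)"
    have s1: "sqint lborel (\<lambda>t. T h t - T (\<lambda>t. of_real m * ?f t) t)" using Th T_sqint[OF mF] by (rule sqint_diff)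
    have s2: "sqint lborel (\<lambda>t. T ?f t - h t)" using T_sqint[OF Fs] h by (rule sqint_diff)
    \<comment> \<open>The eigenvalue equation holds up to \<open>T\<close> applied to
      \<open>h - m F\<close> and \<open>m\<close> times \<open>T F - h\<close>, both tending to
      0.\<close>
    have "(\<lambda>t. T h t - of_real m * h t) = (\<lambda>t. (T h t - T (\<lambda>t. of_real m * ?f t) t) + of_real m * (T ?f t - h t))"
      by (simp add: T_cmult[OF Fs] algebra_simps)
    hence "nsq lborel (\<lambda>t. T h t - of_real m * h t) \<le> 2 * nsq lborel (\<lambda>t. T h t - T (\<lambda>t. of_real m * ?f t) t) + 2 * nsq lborel (\<lambda>t. of_real m * (T ?f t - h t))"
      using nsq_add_le[OF s1 sqint_cmult[OF s2, of "of_real m"]] by simp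
    also have "\<dots> \<le> 2 * q n + 2 * (m\<^sup>2 * p n)"
      using T_diff_nsq[OF h mF, of "k n"] by (simp only: nsq_cmult q_def p_def) simp
    finally show ?thesis .
  qed
  moreover have "(\<lambda>n. 2 * q n + 2 * (m\<^sup>2 * p n)) \<longlonglongrightarrow> 2 * 0 + 2 * (m\<^sup>2 * 0)" by (intro tendsto_intros q0 p0)
  ultimately have "nsq lborel (\<lambda>t. T h t - of_real m * h t) \<le> 2 * 0 + 2 * (m\<^sup>2 * 0)" by (intro LIMSEQ_le_const) auto
  hence "nsq lborel (\<lambda>t. T h t - of_real m * h t) = 0" using nsq_nonneg[of lborel "\<lambda>t. T h t - of_real m * h t"] by simp
  hence "AE t in lborel. T h t - of_real m * h t = 0" using nsq_eq_0_iff[OF E] by simp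
  hence "AE t in lborel. T h t = of_real m * h t" by eventually_elim simp
  thus ?thesis using h orth pos md by blast
qed

end

section \<open>Orthonormal families of eigenvectors\<close>

lemma sqint_combination:
  assumes "\<And>i. i \<in> I \<Longrightarrow> sqint M (f i)"
  shows "sqint M (\<lambda>t. \<Sum>i\<in>I. c i * f i t)"
  using assms by (intro sqint_sum sqint_cmult)

lemma ip_combination_left:
  assumes "\<And>i. i \<in> I \<Longrightarrow> sqint M (f i)" "sqint M h"
  shows "ip M (\<lambda>t. \<Sum>i\<in>I. c i * f i t) h = (\<Sum>i\<in>I. c i * ip M (f i) h)"
  by (subst ip_sum_left) (use assms in \<open>auto intro: sqint_cmult simp: ip_cmult_left\<close>)

text \<open>The coefficients \<open>d\<close> are part of the conclusion so that membership in a
  linear space, later an eigenspace, passes from the \<open>f i\<close> to the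
  \<open>u i\<close>.\<close>

lemma gram_schmidt:
  fixes f :: "nat \<Rightarrow> 'a \<Rightarrow> complex"
  assumes "\<And>i. i < n \<Longrightarrow> sqint M (f i)"
    and "\<And>c :: nat \<Rightarrow> complex. (AE t in M. (\<Sum>i<n. c i * f i t) = 0) \<Longrightarrow> \<forall>i<n. c i = 0"
  shows "\<exists>u d. (\<forall>i<n. u i = (\<lambda>t. \<Sum>j<n. d i j * f j t)) \<and>
           (\<forall>i<n. \<forall>j<n. ip M (u i) (u j) = (if i = j then 1 else 0))"
  using assms
proof (induction n)
  case 0
  show ?case by simp
next
  case (Suc n)
  have f: "sqint M (f i)" if "i < Suc n" for i using Suc.prems(1) that by simp
  have "\<exists>u d. (\<forall>i<n. u i = (\<lambda>t. \<Sum>j<n. d i j * f j t)) \<and>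
           (\<forall>i<n. \<forall>j<n. ip M (u i) (u j) = (if i = j then 1 else 0))"
  proof (rule Suc.IH)
    fix c :: "nat \<Rightarrow> complex" assume "AE t in M. (\<Sum>i<n. c i * f i t) = 0"
    hence "AE t in M. (\<Sum>i<Suc n. (if i < n then c i else 0) * f i t) = 0" by eventually_elim simp
    from Suc.prems(2)[OF this] show "\<forall>i<n. c i = 0" by (metis less_SucI)
  qed (use f in auto)
  then obtain u d where u: "\<And>i. i < n \<Longrightarrow> u i = (\<lambda>t. \<Sum>j<n. d i j * f j t)"
    and orth: "\<And>i j. i < n \<Longrightarrow> j < n \<Longrightarrow> ip M (u i) (u j) = (if i = j then 1 else 0)" by blast
  have us: "sqint M (u i)" if "i < n" for i using u[OF that] f by (auto intro!: sqint_sum sqint_cmult)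
  define c where "c i = ip M (f n) (u i)" for i
  define v where "v t = f n t - (\<Sum>i<n. c i * u i t)" for t
  have sums: "sqint M (\<lambda>t. \<Sum>i<n. c i * u i t)" using us by (auto intro!: sqint_sum sqint_cmult)
  have vs: "sqint M v" unfolding v_def[abs_def] using f[of n] sums by (intro sqint_diff) auto
  define e where "e j = (if j = n then 1 else - (\<Sum>i<n. c i * d i j))" for j
  have ve: "v t = (\<Sum>j<Suc n. e j * f j t)" for t
  proof -
    have "(\<Sum>i<n. c i * u i t) = (\<Sum>i<n. \<Sum>j<n. c i * d i j * f j t)"
      by (intro sum.cong refl) (simp add: u sum_distrib_left mult.assoc)
    also have "\<dots> = (\<Sum>j<n. (\<Sum>i<n. c i * d i j) * f j t)"
      by (subst sum.swap) (simp add: sum_distrib_right)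
    also have "\<dots> = - (\<Sum>j<n. e j * f j t)" by (simp add: e_def sum_negf)
    finally show ?thesis by (simp add: v_def e_def)
  qed
  have "nsq M v \<noteq> 0"
  proof
    assume "nsq M v = 0"
    hence "AE t in M. (\<Sum>j<Suc n. e j * f j t) = 0" using nsq_eq_0_iff[OF vs] by (simp add: ve)
    from Suc.prems(2)[OF this] have "e n = 0" by simp
    thus False by (simp add: e_def)
  qed
  hence pos: "nsq M v > 0" using nsq_nonneg[of M v] by linarith
  have vu: "ip M v (u j) = 0" if "j < n" for j
  proof -
    have "ip M (\<lambda>t. \<Sum>i<n. c i * u i t) (u j) = (\<Sum>i<n. c i * ip M (u i) (u j))"
      using us that by (intro ip_combination_left) auto
    hence "ip M v (u j) = c j - (\<Sum>i<n. c i * ip M (u i) (u j))"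
      unfolding v_def[abs_def] using ip_diff_left[OF f[of n] sums us[OF that]] by (simp add: c_def)
    also have "(\<Sum>i<n. c i * ip M (u i) (u j)) = (\<Sum>i<n. if i = j then c i else 0)"
      using that by (intro sum.cong) (auto simp: orth)
    also have "\<dots> = c j" using that by simp
    finally show ?thesis by simp
  qed
  define s where "s = complex_of_real (1 / sqrt (nsq M v))"
  define u' where "u' i = (if i = n then (\<lambda>t. s * v t) else u i)" for i
  define d' where "d' i j = (if i = n then s * e j else if j < n then d i j else 0)" for i j
  have "\<forall>i<Suc n. u' i = (\<lambda>t. \<Sum>j<Suc n. d' i j * f j t)"
  proof (intro allI impI)
    fix i assume i: "i < Suc n"
    show "u' i = (\<lambda>t. \<Sum>j<Suc n. d' i j * f j t)"
    proof (cases "i = n")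
      case True
      have "s * v t = (\<Sum>j<Suc n. s * e j * f j t)" for t unfolding ve by (simp only: sum_distrib_left mult.assoc)
      thus ?thesis using True by (simp add: u'_def d'_def del: sum.lessThan_Suc)
    next
      case False
      thus ?thesis using i by (auto simp: u'_def d'_def u)
    qed
  qed
  moreover have "\<forall>i<Suc n. \<forall>j<Suc n. ip M (u' i) (u' j) = (if i = j then 1 else 0)"
  proof (intro allI impI)
    fix i j assume ij: "i < Suc n" "j < Suc n"
    have uv: "ip M (u j) v = 0" if "j < n" for j using vu[OF that] ip_cnj[of M v "u j"] by simp
    have "s * cnj s * of_real (nsq M v) = 1" using pos by (simp add: s_def flip: of_real_mult)
    hence vv: "ip M (\<lambda>t. s * v t) (\<lambda>t. s * v t) = 1"
      by (simp add: ip_cmult_left ip_cmult_right ip_self mult_ac)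
    show "ip M (u' i) (u' j) = (if i = j then 1 else 0)"
      using ij vu uv vv orth by (auto simp: u'_def ip_cmult_left ip_cmult_right less_Suc_eq)
  qed
  ultimately show ?case by blast
qed

context window begin

definition eig :: "('a \<Rightarrow> complex) \<Rightarrow> real \<Rightarrow> bool" where
  "eig f \<mu> \<longleftrightarrow> sqint lborel f \<and> (AE t in lborel. T f t = of_real \<mu> * f t)"

lemma eig_sqint: "eig f \<mu> \<Longrightarrow> sqint lborel f"
  by (simp add: eig_def)

lemma eig_weak:
  assumes "eig f \<mu>" "sqint lborel h"
  shows "ip lborel (W f) (W h) = of_real \<mu> * ip lborel f h"
proof -
  have f: "sqint lborel f" using assms by (simp add: eig_def)
  have "ip lborel (W f) (W h) = ip lborel (T f) h" using ip_T[OF f assms(2)] by simp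
  also have "\<dots> = ip lborel (\<lambda>t. of_real \<mu> * f t) h"
    by (rule ip_cong_AE)
       (use assms sqint_measurable[OF T_sqint[OF f]] sqint_measurable[OF sqint_cmult[OF f]] in \<open>auto simp: eig_def\<close>)
  finally show ?thesis by (simp add: ip_cmult_left)
qed

text \<open>Testing the weak equation with \<open>T f - \<mu> f\<close> itself shows that this
  function has norm 0.\<close>

lemma eigI_weak:
  assumes f: "sqint lborel f"
    and weak: "\<And>h. sqint lborel h \<Longrightarrow> ip lborel (W f) (W h) = of_real \<mu> * ip lborel f h"
  shows "eig f \<mu>"
proof -
  let ?p = "\<lambda>t. T f t - of_real \<mu> * f t"
  have Tf: "sqint lborel (T f)" and mf: "sqint lborel (\<lambda>t. of_real \<mu> * f t)"
    using f by (auto intro: T_sqint sqint_cmult)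
  hence p: "sqint lborel ?p" by (rule sqint_diff)
  have "of_real (nsq lborel ?p) = ip lborel (T f) ?p - of_real \<mu> * ip lborel f ?p"
    unfolding ip_self[symmetric] using ip_diff_left[OF Tf mf p] by (simp only: ip_cmult_left)
  also have "\<dots> = 0" using weak[OF p] ip_T[OF f p] by simp
  finally have "nsq lborel ?p = 0" by simp
  hence "AE t in lborel. ?p t = 0" using nsq_eq_0_iff[OF p] by simp
  hence "AE t in lborel. T f t = of_real \<mu> * f t" by eventually_elim simp
  thus ?thesis using f by (simp add: eig_def)
qed

lemma W_zero: "W (\<lambda>t. 0) = (\<lambda>z. 0)"
  by (auto simp: W_def stft_ip)

lemma W_sum:
  "(\<And>i. i \<in> I \<Longrightarrow> sqint lborel (f i)) \<Longrightarrow> W (\<lambda>t. \<Sum>i\<in>I. f i t) = (\<lambda>z. \<Sum>i\<in>I. W (f i) z)"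
  by (induction I rule: infinite_finite_induct) (simp_all add: W_zero W_add sqint_sum)

lemma W_combination:
  assumes "\<And>i. i \<in> I \<Longrightarrow> sqint lborel (f i)"
  shows "W (\<lambda>t. \<Sum>i\<in>I. c i * f i t) = (\<lambda>z. \<Sum>i\<in>I. c i * W (f i) z)"
proof -
  have "W (\<lambda>t. \<Sum>i\<in>I. c i * f i t) = (\<lambda>z. \<Sum>i\<in>I. W (\<lambda>t. c i * f i t) z)"
    using assms by (intro W_sum sqint_cmult)
  also have "\<dots> = (\<lambda>z. \<Sum>i\<in>I. c i * W (f i) z)"
    using assms by (intro ext sum.cong refl) (simp add: W_cmult)
  finally show ?thesis .
qed

text \<open>Proved through the weak equation, where the linearity of \<open>W\<close> and of the
  inner product is available.\<close>

lemma eig_combination: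
  assumes "\<And>i. i \<in> I \<Longrightarrow> eig (f i) \<mu>"
  shows "eig (\<lambda>t. \<Sum>i\<in>I. c i * f i t) \<mu>"
proof (rule eigI_weak)
  have f: "sqint lborel (f i)" if "i \<in> I" for i using assms[OF that] by (rule eig_sqint)
  show "sqint lborel (\<lambda>t. \<Sum>i\<in>I. c i * f i t)" using f by (intro sqint_sum sqint_cmult)
  fix h :: "'a \<Rightarrow> complex" assume h: "sqint lborel h"
  have "ip lborel (W (\<lambda>t. \<Sum>i\<in>I. c i * f i t)) (W h) = (\<Sum>i\<in>I. c i * ip lborel (W (f i)) (W h))"
  proof -
    have "W (\<lambda>t. \<Sum>i\<in>I. c i * f i t) = (\<lambda>z. \<Sum>i\<in>I. c i * W (f i) z)"
      by (rule W_combination) (rule f)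
    thus ?thesis using f W_sqint h by (simp only:) (intro ip_combination_left, auto)
  qed
  also have "\<dots> = of_real \<mu> * (\<Sum>i\<in>I. c i * ip lborel (f i) h)"
    unfolding sum_distrib_left
    by (intro sum.cong refl) (simp add: eig_weak[OF assms h] mult.left_commute)
  also have "(\<Sum>i\<in>I. c i * ip lborel (f i) h) = ip lborel (\<lambda>t. \<Sum>i\<in>I. c i * f i t) h"
    using f h by (intro ip_combination_left[symmetric])
  finally show "ip lborel (W (\<lambda>t. \<Sum>i\<in>I. c i * f i t)) (W h) = of_real \<mu> * ip lborel (\<lambda>t. \<Sum>i\<in>I. c i * f i t) h" .
qed

lemma eig_orthogonal:
  assumes "eig f \<mu>" "eig h \<nu>" "\<mu> \<noteq> \<nu>"
  shows "ip lborel f h = 0"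
proof -
  have s: "sqint lborel f" "sqint lborel h" using assms by (auto intro: eig_sqint)
  have "of_real \<mu> * ip lborel f h = cnj (of_real \<nu> * ip lborel h f)"
    using eig_weak[OF assms(1) s(2)] eig_weak[OF assms(2) s(1)] by (metis ip_cnj)
  also have "\<dots> = of_real \<nu> * ip lborel f h" by (simp add: ip_cnj)
  finally show ?thesis using assms(3) by simp
qed

text \<open>Finite substitute for the projection \<open>Q\<close> of the overview: a longest family
  spans its range.\<close>

definition eigenfam :: "real \<Rightarrow> nat \<Rightarrow> (nat \<Rightarrow> 'a \<Rightarrow> complex) \<Rightarrow> (nat \<Rightarrow> real) \<Rightarrow> bool" where
  "eigenfam \<delta> N u l \<longleftrightarrow> (\<forall>i<N. eig (u i) (l i) \<and> l i > \<delta>) \<and>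
     (\<forall>i<N. \<forall>j<N. ip lborel (u i) (u j) = (if i = j then 1 else 0))"

text \<open>\<open>r\<close> is \<open>f\<close> minus its orthogonal projection onto the family.
  Since the \<open>u i\<close> are eigenvectors, \<open>W r\<close> is orthogonal to every
  \<open>W (u i)\<close> too, so norm and form both split without cross terms.\<close>

lemma eigenfam_expansion:
  assumes ef: "eigenfam \<delta> N u l" and f: "sqint lborel f"
  shows "\<exists>r. sqint lborel r \<and> (\<forall>i<N. ip lborel r (u i) = 0) \<and>
    nsq lborel f = (\<Sum>i<N. (cmod (ip lborel f (u i)))\<^sup>2) + nsq lborel r \<and>
    nsq lborel (W f) = (\<Sum>i<N. l i * (cmod (ip lborel f (u i)))\<^sup>2) + nsq lborel (W r)"
proof -
  have eig: "eig (u i) (l i)" if "i < N" for i using ef that by (simp add: eigenfam_def)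
  have us: "sqint lborel (u i)" if "i < N" for i using eig[OF that] by (rule eig_sqint)
  have orth: "ip lborel (u i) (u j) = (if i = j then 1 else 0)" if "i < N" "j < N" for i j
    using ef that by (simp add: eigenfam_def)
  define c where "c i = ip lborel f (u i)" for i
  define P where "P t = (\<Sum>i<N. c i * u i t)" for t
  define r where "r t = f t - P t" for t
  have Ps: "sqint lborel P" unfolding P_def[abs_def] using us by (intro sqint_combination) auto
  have rs: "sqint lborel r" unfolding r_def[abs_def] using f Ps by (rule sqint_diff)
  have Pu: "ip lborel P (u j) = c j" if "j < N" for j
  proof -
    have "ip lborel P (u j) = (\<Sum>i<N. c i * ip lborel (u i) (u j))"
      unfolding P_def[abs_def] using us that by (intro ip_combination_left) auto
    also have "\<dots> = (\<Sum>i<N. if i = j then c i else 0)" using that by (intro sum.cong) (auto simp: orth)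
    finally show ?thesis using that by simp
  qed
  have ru: "ip lborel r (u j) = 0" if "j < N" for j
    unfolding r_def[abs_def] using ip_diff_left[OF f Ps us[OF that]] Pu[OF that] by (simp add: c_def)
  have ur: "ip lborel (u j) r = 0" if "j < N" for j using ru[OF that] ip_cnj[of lborel r "u j"] by simp
  have uP: "ip lborel (u j) P = cnj (c j)" if "j < N" for j using Pu[OF that] ip_cnj[of lborel P "u j"] by simp
  have left: "ip lborel P h = (\<Sum>i<N. c i * ip lborel (u i) h)" if "sqint lborel h" for h
    unfolding P_def[abs_def] using us that by (intro ip_combination_left) auto
  have Wleft: "ip lborel (W P) (W h) = (\<Sum>i<N. c i * (of_real (l i) * ip lborel (u i) h))" if "sqint lborel h" for h
  proof -
    have "ip lborel (W P) (W h) = (\<Sum>i<N. c i * ip lborel (W (u i)) (W h))"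
    proof -
      have "W P = (\<lambda>z. \<Sum>i<N. c i * W (u i) z)"
        unfolding P_def[abs_def] using us by (intro W_combination) auto
      thus ?thesis using us W_sqint that by (simp only:) (intro ip_combination_left, auto)
    qed
    thus ?thesis using eig_weak[OF eig that] by simp
  qed
  have fPr: "f = (\<lambda>t. P t + r t)" by (auto simp: r_def)
  have nP: "nsq lborel P = (\<Sum>i<N. (cmod (c i))\<^sup>2)"
  proof -
    have "complex_of_real (nsq lborel P) = of_real (\<Sum>i<N. (cmod (c i))\<^sup>2)"
      unfolding ip_self[symmetric] left[OF Ps] using uP by (simp add: complex_norm_square[symmetric] flip: of_real_power)
    thus ?thesis by (simp only: of_real_eq_iff)
  qed
  have nWP: "nsq lborel (W P) = (\<Sum>i<N. l i * (cmod (c i))\<^sup>2)"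
  proof -
    have "c i * (of_real (l i) * cnj (c i)) = of_real (l i * (cmod (c i))\<^sup>2)" for i
      using complex_norm_square[of "c i"] by (simp add: mult_ac)
    moreover have "complex_of_real (nsq lborel (W P)) = (\<Sum>i<N. c i * (of_real (l i) * cnj (c i)))"
      unfolding ip_self[symmetric] Wleft[OF Ps] using uP by simp
    ultimately have "complex_of_real (nsq lborel (W P)) = of_real (\<Sum>i<N. l i * (cmod (c i))\<^sup>2)"
      by (simp only: of_real_sum)
    thus ?thesis by (simp only: of_real_eq_iff)
  qed
  show ?thesis
  proof (intro exI conjI allI impI)
    show "sqint lborel r" by (rule rs)
    show "ip lborel r (u i) = 0" if "i < N" for i using that by (rule ru)
    have "nsq lborel f = nsq lborel P + nsq lborel r + 2 * Re (ip lborel P r)"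
      using nsq_add[OF Ps rs] fPr by simp
    thus "nsq lborel f = (\<Sum>i<N. (cmod (ip lborel f (u i)))\<^sup>2) + nsq lborel r"
      using ur by (simp add: left[OF rs] nP c_def)
    have "nsq lborel (W f) = nsq lborel (W P) + nsq lborel (W r) + 2 * Re (ip lborel (W P) (W r))"
      using nsq_add[OF W_sqint[OF Ps] W_sqint[OF rs]] W_add[OF Ps rs] fPr by simp
    thus "nsq lborel (W f) = (\<Sum>i<N. l i * (cmod (ip lborel f (u i)))\<^sup>2) + nsq lborel (W r)"
      using ur by (simp add: Wleft[OF rs] nWP c_def)
  qed
qed

text \<open>Bessel's inequality for the unit vector \<open>tfshift z\<close> gives the bound 1, the
  eigenvalues exceeding \<delta> give the bound by the form, and Moyal's identity makes each summand
  integrate to 1.\<close>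

lemma eigenfam_density:
  assumes ef: "eigenfam \<delta> N u l" and "\<delta> > 0"
  defines "\<rho> \<equiv> \<lambda>z. \<Sum>i<N. (cmod (stft g (u i) z))\<^sup>2"
  shows "\<rho> \<in> borel_measurable borel" "0 \<le> \<rho> z" "\<rho> z \<le> 1" "\<delta> * \<rho> z \<le> nsq lborel (W (tfshift z))"
    "(\<integral>\<^sup>+z. ennreal (\<rho> z) \<partial>lborel) = of_nat N"
proof -
  have us: "sqint lborel (u i)" if "i < N" for i using ef that by (simp add: eigenfam_def eig_def)
  have n1: "nsq lborel (u i) = 1" if "i < N" for i
    using ef that ip_self[of lborel "u i"] by (simp add: eigenfam_def)
  have cst: "cmod (ip lborel (tfshift z) (u i)) = cmod (stft g (u i) z)" if "i < N" for i
    using stft_ip[OF us[OF that], of z] ip_cnj[of lborel "u i" "tfshift z"] by (metis complex_mod_cnj)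
  have sm: "stft g (u i) \<in> borel_measurable borel" if "i < N" for i
    using moyal(1)[OF us[OF that]] by simp
  show "\<rho> \<in> borel_measurable borel"
    unfolding \<rho>_def
  proof (rule borel_measurable_sum)
    fix i assume "i \<in> {..<N}"
    hence [measurable]: "stft g (u i) \<in> borel_measurable borel" using sm by simp
    show "(\<lambda>z. (cmod (stft g (u i) z))\<^sup>2) \<in> borel_measurable borel" by measurable
  qed
  show "0 \<le> \<rho> z" unfolding \<rho>_def by (intro sum_nonneg) auto
  obtain r where r: "nsq lborel (tfshift z) = (\<Sum>i<N. (cmod (ip lborel (tfshift z) (u i)))\<^sup>2) + nsq lborel r"
    "nsq lborel (W (tfshift z)) = (\<Sum>i<N. l i * (cmod (ip lborel (tfshift z) (u i)))\<^sup>2) + nsq lborel (W r)"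
    using eigenfam_expansion[OF ef tfshift_sqint[of z]] by blast
  have rho: "(\<Sum>i<N. (cmod (ip lborel (tfshift z) (u i)))\<^sup>2) = \<rho> z" unfolding \<rho>_def using cst by simp
  have "1 = \<rho> z + nsq lborel r" using r(1) by (simp add: tfshift_nsq rho)
  thus "\<rho> z \<le> 1" using nsq_nonneg[of lborel r] by linarith
  have "\<delta> * \<rho> z = (\<Sum>i<N. \<delta> * (cmod (ip lborel (tfshift z) (u i)))\<^sup>2)" by (simp add: rho[symmetric] sum_distrib_left)
  also have "\<dots> \<le> (\<Sum>i<N. l i * (cmod (ip lborel (tfshift z) (u i)))\<^sup>2)"
    using ef by (intro sum_mono mult_right_mono) (auto simp: eigenfam_def less_imp_le)
  also have "\<dots> \<le> nsq lborel (W (tfshift z))" using r(2) by simp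
  finally show "\<delta> * \<rho> z \<le> nsq lborel (W (tfshift z))" .
  have "(\<integral>\<^sup>+z. ennreal (\<rho> z) \<partial>lborel) = (\<integral>\<^sup>+z. (\<Sum>i<N. ennreal ((cmod (stft g (u i) z))\<^sup>2)) \<partial>lborel)"
    unfolding \<rho>_def by (simp add: sum_ennreal)
  also have "\<dots> = (\<Sum>i<N. \<integral>\<^sup>+z. ennreal ((cmod (stft g (u i) z))\<^sup>2) \<partial>lborel)"
  proof (rule nn_integral_sum)
    fix i assume "i \<in> {..<N}"
    hence [measurable]: "stft g (u i) \<in> borel_measurable borel" using sm by simp
    show "(\<lambda>z. ennreal ((cmod (stft g (u i) z))\<^sup>2)) \<in> borel_measurable lborel" by measurable
  qed
  also have "\<dots> = (\<Sum>i<N. 1)"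
  proof (rule sum.cong)
    fix i assume "i \<in> {..<N}"
    hence i: "i < N" by simp
    have "(\<integral>\<^sup>+z. ennreal ((cmod (stft g (u i) z))\<^sup>2) \<partial>lborel) = ennreal (nsq lborel (stft g (u i)))"
      unfolding nsq_def using moyal(1)[OF us[OF i]] by (intro nn_integral_eq_integral) auto
    thus "(\<integral>\<^sup>+z. ennreal ((cmod (stft g (u i) z))\<^sup>2) \<partial>lborel) = 1"
      using moyal(2)[OF us[OF i]] n1[OF i] by simp
  qed simp
  finally show "(\<integral>\<^sup>+z. ennreal (\<rho> z) \<partial>lborel) = of_nat N" by simp
qed

text \<open>Valid for any family, maximal or not. The bound on the length obtained here is what
  makes a longest family exist.\<close>

lemma eigenfam_upper:
  assumes ef: "eigenfam \<delta> N u l" and "\<delta> > 0" and "1 / \<delta> \<le> \<tau>"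
    and \<Psi>: "\<And>z. z \<notin> \<Omega> \<Longrightarrow> nsq lborel (W (tfshift z)) \<le> \<Psi> z" and \<Psi>0: "\<And>z. 0 \<le> \<Psi> z"
  shows "of_nat N \<le> emeasure lborel \<Omega> + (\<integral>\<^sup>+z. ennreal (min 1 (\<tau> * \<Psi> z)) \<partial>lborel)"
proof -
  define \<rho> where "\<rho> z = (\<Sum>i<N. (cmod (stft g (u i) z))\<^sup>2)" for z
  have \<rho>: "\<rho> z \<le> 1" "0 \<le> \<rho> z" "\<delta> * \<rho> z \<le> nsq lborel (W (tfshift z))" for z
    unfolding \<rho>_def by (rule eigenfam_density[OF ef \<open>\<delta> > 0\<close>])+
  have [measurable]: "\<rho> \<in> borel_measurable borel"
    unfolding \<rho>_def[abs_def] by (rule eigenfam_density[OF ef \<open>\<delta> > 0\<close>])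
  have "of_nat N = (\<integral>\<^sup>+z. ennreal (\<rho> z) \<partial>lborel)"
    unfolding \<rho>_def by (rule eigenfam_density(5)[OF ef \<open>\<delta> > 0\<close>, symmetric])
  also have "\<dots> \<le> (\<integral>\<^sup>+z. indicator \<Omega> z + ennreal (\<rho> z * indicator (- \<Omega>) z) \<partial>lborel)"
    using \<rho>(1,2) by (intro nn_integral_mono) (auto split: split_indicator)
  also have "\<dots> = emeasure lborel \<Omega> + (\<integral>\<^sup>+z. ennreal (\<rho> z * indicator (- \<Omega>) z) \<partial>lborel)"
    by (subst nn_integral_add) auto
  also have "\<dots> \<le> emeasure lborel \<Omega> + (\<integral>\<^sup>+z. ennreal (min 1 (\<tau> * \<Psi> z)) \<partial>lborel)"
  proof (intro add_left_mono nn_integral_mono ennreal_leI)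
    fix z
    have "0 < 1 / \<delta>" using \<open>\<delta> > 0\<close> by simp
    hence "0 \<le> \<tau>" using \<open>1 / \<delta> \<le> \<tau>\<close> by linarith
    show "\<rho> z * indicator (- \<Omega>) z \<le> min 1 (\<tau> * \<Psi> z)"
    proof (cases "z \<in> \<Omega>")
      case True
      thus ?thesis using \<open>0 \<le> \<tau>\<close> \<Psi>0 by simp
    next
      case False
      have "\<delta> * \<rho> z \<le> \<Psi> z" using \<rho>(3)[of z] \<Psi>[OF False] by linarith
      hence "\<rho> z \<le> 1 / \<delta> * \<Psi> z" using \<open>\<delta> > 0\<close> by (simp add: field_simps)
      also have "\<dots> \<le> \<tau> * \<Psi> z" using \<open>1 / \<delta> \<le> \<tau>\<close> \<Psi>0 by (rule mult_right_mono)
      finally show ?thesis using \<rho>(1)[of z] False by simp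
    qed
  qed
  finally show ?thesis .
qed

definition maximal_eigenfam :: "real \<Rightarrow> nat \<Rightarrow> bool" where
  "maximal_eigenfam \<delta> N \<longleftrightarrow> (\<exists>u l. eigenfam \<delta> N u l) \<and> (\<forall>N' u l. eigenfam \<delta> N' u l \<longrightarrow> N' \<le> N)"

text \<open>If the form exceeded the bound at \<open>r\<close>, \<open>eigenvector_exists\<close>
  would give an eigenvector orthogonal to the family with eigenvalue above \<delta>; normalized and
  appended, it would make a longer family.\<close>

lemma maximal_eigenfam_complement:
  assumes ef: "eigenfam \<delta> N u l" and max: "maximal_eigenfam \<delta> N" and "\<delta> \<ge> 0"
    and r: "sqint lborel r" "\<And>i. i < N \<Longrightarrow> ip lborel r (u i) = 0"
  shows "nsq lborel (W r) \<le> \<delta> * nsq lborel r"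
proof (rule ccontr)
  assume "\<not> ?thesis"
  hence gt: "\<delta> * nsq lborel r < nsq lborel (W r)" by simp
  have e: "eig (u i) (l i)" if "i < N" for i using ef that by (simp add: eigenfam_def)
  obtain h m where h: "sqint lborel h" "\<And>i. i < N \<Longrightarrow> ip lborel h (u i) = 0" "nsq lborel h > 0" "m > \<delta>"
    "AE t in lborel. T h t = of_real m * h t"
    using eigenvector_exists[of N u l r \<delta>] e r gt \<open>\<delta> \<ge> 0\<close> unfolding eig_def by blast
  define s where "s = complex_of_real (1 / sqrt (nsq lborel h))"
  define v where "v t = s * h t" for t
  have "eig h m" using h by (simp add: eig_def)
  hence ev: "eig v m" using eig_combination[of "{0::nat}" "\<lambda>_. h" m "\<lambda>_. s"] by (simp add: v_def[abs_def])
  have vu: "ip lborel v (u i) = 0" if "i < N" for i using h(2)[OF that] by (simp add: v_def[abs_def] ip_cmult_left)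
  have uv: "ip lborel (u i) v = 0" if "i < N" for i using vu[OF that] ip_cnj[of lborel v "u i"] by simp
  have "s * cnj s * of_real (nsq lborel h) = 1" using h(3) by (simp add: s_def flip: of_real_mult)
  hence vv: "ip lborel v v = 1"
    by (simp add: v_def[abs_def] ip_cmult_left ip_cmult_right ip_self mult_ac)
  have "eigenfam \<delta> (Suc N) (\<lambda>i. if i = N then v else u i) (\<lambda>i. if i = N then m else l i)"
    using ef ev h(4) vu uv vv by (auto simp: eigenfam_def less_Suc_eq)
  thus False using max unfolding maximal_eigenfam_def by (metis Suc_n_not_le_n)
qed

text \<open>Here maximality is essential: it controls the part of \<open>tfshift z\<close>
  orthogonal to the family.\<close>

lemma eigenfam_lower:
  assumes max: "maximal_eigenfam \<delta> N" and "0 < \<delta>" "\<delta> < 1" and "1 / (1 - \<delta>) \<le> \<tau>"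
    and \<Psi>: "\<And>z. z \<in> \<Omega> \<Longrightarrow> 1 - nsq lborel (W (tfshift z)) \<le> \<Psi> z" and \<Psi>0: "\<And>z. 0 \<le> \<Psi> z"
  shows "emeasure lborel \<Omega> \<le> of_nat N + (\<integral>\<^sup>+z. ennreal (min 1 (\<tau> * \<Psi> z)) \<partial>lborel)"
proof -
  obtain u l where ef: "eigenfam \<delta> N u l" using max by (auto simp: maximal_eigenfam_def)
  define \<rho> where "\<rho> z = (\<Sum>i<N. (cmod (stft g (u i) z))\<^sup>2)" for z
  have us: "sqint lborel (u i)" if "i < N" for i using ef that by (simp add: eigenfam_def eig_def)
  have n1: "nsq lborel (u i) = 1" if "i < N" for i
    using ef that ip_self[of lborel "u i"] by (simp add: eigenfam_def)
  have l1: "l i \<le> 1" if i: "i < N" for i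
  proof -
    have "ip lborel (W (u i)) (W (u i)) = of_real (l i) * ip lborel (u i) (u i)"
      using ef i us[OF i] by (intro eig_weak) (auto simp: eigenfam_def)
    hence "nsq lborel (W (u i)) = l i" unfolding ip_self n1[OF i] by simp
    thus ?thesis using W_nsq_le[OF us[OF i]] n1[OF i] by simp
  qed
  have \<rho>: "\<rho> z \<le> 1" "0 \<le> \<rho> z" for z
    unfolding \<rho>_def by (rule eigenfam_density[OF ef \<open>\<delta> > 0\<close>])+
  have \<rho>m [measurable]: "\<rho> \<in> borel_measurable borel"
    unfolding \<rho>_def[abs_def] by (rule eigenfam_density[OF ef \<open>\<delta> > 0\<close>])
  \<comment> \<open>The component in the family contributes at most \<rho> to the form because
    eigenvalues are at most 1, the orthogonal component at most \<delta> times
    \<open>1 - \<rho>\<close>.\<close>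
  have key: "(1 - \<delta>) * (1 - \<rho> z) \<le> 1 - nsq lborel (W (tfshift z))" for z
  proof -
    have cst: "cmod (ip lborel (tfshift z) (u i)) = cmod (stft g (u i) z)" if "i < N" for i
      using stft_ip[OF us[OF that], of z] ip_cnj[of lborel "u i" "tfshift z"] by (metis complex_mod_cnj)
    hence rho: "(\<Sum>i<N. (cmod (ip lborel (tfshift z) (u i)))\<^sup>2) = \<rho> z" unfolding \<rho>_def by simp
    obtain r where r: "sqint lborel r" "\<And>i. i < N \<Longrightarrow> ip lborel r (u i) = 0"
      "nsq lborel (tfshift z) = (\<Sum>i<N. (cmod (ip lborel (tfshift z) (u i)))\<^sup>2) + nsq lborel r"
      "nsq lborel (W (tfshift z)) = (\<Sum>i<N. l i * (cmod (ip lborel (tfshift z) (u i)))\<^sup>2) + nsq lborel (W r)"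
      using eigenfam_expansion[OF ef tfshift_sqint[of z]] by blast
    have nr: "nsq lborel r = 1 - \<rho> z" using r(3) by (simp add: tfshift_nsq rho)
    have "(\<Sum>i<N. l i * (cmod (ip lborel (tfshift z) (u i)))\<^sup>2) \<le> (\<Sum>i<N. 1 * (cmod (ip lborel (tfshift z) (u i)))\<^sup>2)"
      using l1 by (intro sum_mono mult_right_mono) auto
    hence "nsq lborel (W (tfshift z)) \<le> \<rho> z + nsq lborel (W r)" using r(4) by (simp add: rho)
    also have "\<dots> \<le> \<rho> z + \<delta> * (1 - \<rho> z)"
      using maximal_eigenfam_complement[OF ef max _ r(1,2)] \<open>0 < \<delta>\<close> by (simp add: nr)
    finally show ?thesis by (simp add: algebra_simps)
  qed
  have "0 < 1 / (1 - \<delta>)" using \<open>\<delta> < 1\<close> by simp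
  hence "0 \<le> \<tau>" using \<open>1 / (1 - \<delta>) \<le> \<tau>\<close> by linarith
  have "emeasure lborel \<Omega> = (\<integral>\<^sup>+z. indicator \<Omega> z \<partial>lborel)" by simp
  also have "\<dots> \<le> (\<integral>\<^sup>+z. ennreal (\<rho> z) + ennreal ((1 - \<rho> z) * indicator \<Omega> z) \<partial>lborel)"
    using \<rho> by (intro nn_integral_mono) (auto split: split_indicator simp flip: ennreal_plus)
  also have "\<dots> = of_nat N + (\<integral>\<^sup>+z. ennreal ((1 - \<rho> z) * indicator \<Omega> z) \<partial>lborel)"
    using eigenfam_density(5)[OF ef \<open>\<delta> > 0\<close>, folded \<rho>_def] by (subst nn_integral_add) auto
  also have "\<dots> \<le> of_nat N + (\<integral>\<^sup>+z. ennreal (min 1 (\<tau> * \<Psi> z)) \<partial>lborel)"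
  proof (intro add_left_mono nn_integral_mono ennreal_leI)
    fix z
    show "(1 - \<rho> z) * indicator \<Omega> z \<le> min 1 (\<tau> * \<Psi> z)"
    proof (cases "z \<in> \<Omega>")
      case False
      thus ?thesis using \<open>0 \<le> \<tau>\<close> \<Psi>0 by simp
    next
      case True
      have "(1 - \<delta>) * (1 - \<rho> z) \<le> \<Psi> z" using key[of z] \<Psi>[OF True] by linarith
      hence "1 - \<rho> z \<le> 1 / (1 - \<delta>) * \<Psi> z" using \<open>\<delta> < 1\<close> by (simp add: field_simps)
      also have "\<dots> \<le> \<tau> * \<Psi> z" using \<open>1 / (1 - \<delta>) \<le> \<tau>\<close> \<Psi>0 by (rule mult_right_mono)
      finally show ?thesis using \<rho>(2)[of z] True by simp
    qed
  qed
  finally show ?thesis .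
qed

end

section \<open>Eigenvalue counting\<close>

definition L2_independent :: "('a::euclidean_space \<Rightarrow> complex) set \<Rightarrow> nat \<Rightarrow> (nat \<Rightarrow> 'a \<Rightarrow> complex) \<Rightarrow> bool" where
  "L2_independent E n f \<longleftrightarrow> (\<forall>i<n. f i \<in> E) \<and>
     (\<forall>c :: nat \<Rightarrow> complex. (AE t in lebesgue. (\<Sum>i<n. c i * f i t) = 0) \<longrightarrow> (\<forall>i<n. c i = 0))"

lemma L2_dim_eq: "L2_dim E = Sup (enat ` {n. \<exists>f. L2_independent E n f})"
  unfolding L2_dim_def L2_independent_def by (intro arg_cong[where f = Sup]) auto

lemma L2_dim_ge: "L2_independent E n f \<Longrightarrow> enat n \<le> L2_dim E"
  unfolding L2_dim_eq by (intro Sup_upper) auto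

lemma L2_dim_attained:
  assumes "\<And>n f. L2_independent E n f \<Longrightarrow> n \<le> K"
  obtains n f where "L2_dim E = enat n" "L2_independent E n f"
proof -
  let ?D = "{n. \<exists>f. L2_independent E n f}"
  have "?D \<subseteq> {..K}" using assms by auto
  hence fin: "finite ?D" by (rule finite_subset) simp
  have "L2_independent E 0 (\<lambda>_ _. 0)" by (simp add: L2_independent_def)
  hence ne: "?D \<noteq> {}" by blast
  have "Max ?D \<in> ?D" using fin ne by (rule Max_in)
  then obtain f where f: "L2_independent E (Max ?D) f" by blast
  have "L2_dim E \<le> enat (Max ?D)"
    unfolding L2_dim_eq
  proof (rule Sup_least)
    fix x assume "x \<in> enat ` ?D"
    then obtain n where "x = enat n" "n \<in> ?D" by blast
    thus "x \<le> enat (Max ?D)" using Max_ge[OF fin] by simp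
  qed
  hence "L2_dim E = enat (Max ?D)" using L2_dim_ge[OF f] by (rule antisym)
  thus thesis using f that by blast
qed

lemma AE_lebesgue_iff: "(AE t in lebesgue. P t) \<longleftrightarrow> (AE t in lborel. P t)"
  by (rule AE_completion_iff)

lemma orthonormal_independent:
  fixes n :: nat
  assumes "\<And>i. i < n \<Longrightarrow> sqint M (u i)"
    and "\<And>i j. i < n \<Longrightarrow> j < n \<Longrightarrow> ip M (u i) (u j) = (if i = j then 1 else 0)"
    and "AE t in M. (\<Sum>i<n. c i * u i t) = 0" "j < n"
  shows "c j = 0"
proof -
  have "sqint M (\<lambda>t. \<Sum>i<n. c i * u i t)" using assms(1) by (intro sqint_combination) auto
  hence "ip M (\<lambda>t. \<Sum>i<n. c i * u i t) (u j) = ip M (\<lambda>t. 0) (u j)"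
    by (intro ip_cong_AE) (use assms in auto)
  hence "0 = (\<Sum>i<n. c i * ip M (u i) (u j))"
    using ip_combination_left[of "{..<n}" M u "u j" c] assms by simp
  also have "\<dots> = (\<Sum>i<n. if i = j then c i else 0)" using assms by (intro sum.cong) auto
  also have "\<dots> = c j" using assms(4) by simp
  finally show ?thesis by simp
qed

context window begin

text \<open>\<open>S\<close> acts on all representatives of an \<open>L\<^sup>2\<close> class, \<open>T\<close> only on Borel measurable ones.\<close>

context
  fixes S :: "('a \<Rightarrow> complex) \<Rightarrow> 'a \<Rightarrow> complex"
  assumes S: "\<And>f f'. sqint lborel f' \<Longrightarrow> AE t in lborel. f' t = f t \<Longrightarrow> S f = T f'"
begin

lemma eig_in_eigenspace:
  assumes "eig f \<mu>"
  shows "f \<in> L2_eigenspace S (of_real \<mu>)"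
  using assms S[of f f] by (auto simp: L2_eigenspace_def AE_lebesgue_iff eig_def sqint_imp_L2)

lemma eigenspace_representative:
  assumes "f \<in> L2_eigenspace S (of_real \<mu>)"
  obtains f' where "eig f' \<mu>" "AE t in lborel. f' t = f t"
proof -
  have "f \<in> L2" using assms by (simp add: L2_eigenspace_def)
  then obtain f' where f': "sqint lborel f'" "AE t in lborel. f' t = f t" by (rule L2_borel_representative)
  have "AE t in lborel. S f t = of_real \<mu> * f t" using assms by (simp add: L2_eigenspace_def AE_lebesgue_iff)
  hence "AE t in lborel. T f' t = of_real \<mu> * f' t"
    using f'(2) unfolding S[OF f'] by eventually_elim simp
  thus thesis using f' that by (simp add: eig_def)
qed

text \<open>Gram-Schmidt is run on Borel representatives; its output consists of linear
  combinations, hence stays in the eigenspace.\<close>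

lemma independent_orthonormal:
  assumes "L2_independent (L2_eigenspace S (of_real \<mu>)) n f"
  shows "\<exists>u. (\<forall>i<n. eig (u i) \<mu>) \<and> (\<forall>i<n. \<forall>j<n. ip lborel (u i) (u j) = (if i = j then 1 else 0))"
proof -
  have "\<exists>f'. eig f' \<mu> \<and> (AE t in lborel. f' t = f i t)" if "i < n" for i
  proof -
    have "f i \<in> L2_eigenspace S (of_real \<mu>)" using assms that by (simp add: L2_independent_def)
    then obtain f' where "eig f' \<mu>" "AE t in lborel. f' t = f i t" by (rule eigenspace_representative)
    thus ?thesis by blast
  qed
  then obtain h where h: "\<And>i. i < n \<Longrightarrow> eig (h i) \<mu>" "\<And>i. i < n \<Longrightarrow> AE t in lborel. h i t = f i t"
    by metis
  have all: "AE t in lborel. \<forall>i\<in>{..<n}. h i t = f i t"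
    using h(2) by (intro AE_finite_allI) auto
  have "\<exists>u d. (\<forall>i<n. u i = (\<lambda>t. \<Sum>j<n. d i j * h j t)) \<and>
           (\<forall>i<n. \<forall>j<n. ip lborel (u i) (u j) = (if i = j then 1 else 0))"
  proof (rule gram_schmidt)
    show "sqint lborel (h i)" if "i < n" for i using h(1)[OF that] by (rule eig_sqint)
    fix c :: "nat \<Rightarrow> complex" assume "AE t in lborel. (\<Sum>i<n. c i * h i t) = 0"
    hence "AE t in lborel. (\<Sum>i<n. c i * f i t) = 0" using all by eventually_elim simp
    thus "\<forall>i<n. c i = 0" using assms unfolding L2_independent_def AE_lebesgue_iff by blast
  qed
  then obtain u d where u: "\<And>i. i < n \<Longrightarrow> u i = (\<lambda>t. \<Sum>j<n. d i j * h j t)"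
    "\<And>i j. i < n \<Longrightarrow> j < n \<Longrightarrow> ip lborel (u i) (u j) = (if i = j then 1 else 0)" by blast
  have "eig (u i) \<mu>" if "i < n" for i
    unfolding u(1)[OF that] using h(1) by (intro eig_combination) auto
  thus ?thesis using u(2) by blast
qed

text \<open>The family is grouped by eigenvalue: each group is orthonormal, hence independent, and
  no longer than the dimension of its eigenspace. Each \<open>l i\<close> is in the spectrum because
  the unit vector \<open>u i\<close> shows that \<open>S - l i\<close> is not bounded below.\<close>

lemma eigenfam_le_eigenvalue_count:
  assumes ef: "eigenfam \<delta> N u l"
  shows "of_nat N \<le> eigenvalue_count S \<delta>"
proof -
  let ?A = "{\<mu>::real. complex_of_real \<mu> \<in> L2_spectrum S \<and> \<mu> > \<delta>}"
  let ?f = "\<lambda>\<mu>::real. ennreal_of_enat (L2_dim (L2_eigenspace S (complex_of_real \<mu>)))"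
  have e: "eig (u i) (l i)" "l i > \<delta>" if "i < N" for i using ef that by (auto simp: eigenfam_def)
  have orth: "ip lborel (u i) (u j) = (if i = j then 1 else 0)" if "i < N" "j < N" for i j
    using ef that by (auto simp: eigenfam_def)
  have spec: "complex_of_real (l i) \<in> L2_spectrum S" if i: "i < N" for i
  proof -
    have su: "sqint lborel (u i)" using e(1)[OF i] by (rule eig_sqint)
    have "nsq lborel (u i) = 1" using orth[OF i i] by (simp add: ip_self)
    hence n1: "L2_norm (u i) = 1" using sqint_lebesgue_iff(2)[of "u i" "u i"] su by simp
    have "AE t in lborel. 0 = S (u i) t - of_real (l i) * u i t"
      using e(1)[OF i] S[OF su, of "u i"] by (auto simp: eig_def)
    hence n0: "L2_norm (\<lambda>t. S (u i) t - of_real (l i) * u i t) = 0"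
      using sqint_lebesgue_iff(2)[of "\<lambda>t. 0" "\<lambda>t. S (u i) t - of_real (l i) * u i t"] by (simp add: nsq_def)
    have "\<not> (\<exists>K. \<forall>f\<in>L2. L2_norm f \<le> K * L2_norm (\<lambda>t. S f t - of_real (l i) * f t))"
      using n1 n0 sqint_imp_L2[OF su] by (metis mult_zero_right not_one_le_zero)
    thus ?thesis by (auto simp: L2_spectrum_def)
  qed
  define J where "J \<mu> = {i. i < N \<and> l i = \<mu>}" for \<mu>
  have finJ: "finite (J \<mu>)" for \<mu> by (simp add: J_def)
  have dim: "of_nat (card (J \<mu>)) \<le> ?f \<mu>" for \<mu>
  proof -
    obtain b where b: "bij_betw b {..<card (J \<mu>)} (J \<mu>)"
      using ex_bij_betw_nat_finite[OF finJ] by (auto simp: atLeast0LessThan)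
    have bJ: "b i \<in> J \<mu>" if "i < card (J \<mu>)" for i using b that by (auto simp: bij_betw_def)
    have bi: "b i = b j \<longleftrightarrow> i = j" if "i < card (J \<mu>)" "j < card (J \<mu>)" for i j
      using b that by (auto simp: bij_betw_def inj_on_def)
    have bN: "b i < N" "l (b i) = \<mu>" if "i < card (J \<mu>)" for i using bJ[OF that] by (auto simp: J_def)
    have "L2_independent (L2_eigenspace S (of_real \<mu>)) (card (J \<mu>)) (\<lambda>i. u (b i))"
      unfolding L2_independent_def AE_lebesgue_iff
    proof (intro conjI allI impI)
      fix i assume "i < card (J \<mu>)"
      thus "u (b i) \<in> L2_eigenspace S (of_real \<mu>)" using bN e(1)[of "b i"] by (auto intro: eig_in_eigenspace)
    next
      fix c :: "nat \<Rightarrow> complex" and i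
      assume ae: "AE t in lborel. (\<Sum>i<card (J \<mu>). c i * u (b i) t) = 0" and i: "i < card (J \<mu>)"
      show "c i = 0"
        by (rule orthonormal_independent[OF _ _ ae i])
           (use bN bi eig_sqint[OF e(1)] orth in auto)
    qed
    from L2_dim_ge[OF this] have "ennreal_of_enat (enat (card (J \<mu>))) \<le> ?f \<mu>" by (simp only: ennreal_of_enat_le_iff)
    thus ?thesis by simp
  qed
  have "N = card (\<Union>\<mu>\<in>l ` {..<N}. J \<mu>)" by (subst card_lessThan[symmetric], rule arg_cong[where f = card]) (auto simp: J_def)
  also have "\<dots> = (\<Sum>\<mu>\<in>l ` {..<N}. card (J \<mu>))"
    by (rule card_UN_disjoint) (auto simp: J_def)
  finally have "(of_nat N :: ennreal) = (\<Sum>\<mu>\<in>l ` {..<N}. of_nat (card (J \<mu>)))" by (metis of_nat_sum)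
  also have "\<dots> \<le> (\<Sum>\<mu>\<in>l ` {..<N}. ?f \<mu>)" by (intro sum_mono dim)
  also have "\<dots> \<le> (SUP F\<in>{F. finite F \<and> F \<subseteq> ?A}. sum ?f F)"
    using spec e(2) by (intro SUP_upper) auto
  also have "\<dots> = eigenvalue_count S \<delta>"
    unfolding eigenvalue_count_def by (rule nonneg_infsum_complete[symmetric]) simp
  finally show ?thesis .
qed

text \<open>Conversely, orthonormal bases of the eigenspaces of finitely many spectral values are
  joined into one family, orthogonal across different eigenvalues. A spectral value without
  eigenvectors would contribute dimension 0, so eigenvectors account for the whole count.\<close>

lemma eigenvalue_count_le:
  assumes max: "\<And>n u l. eigenfam \<delta> n u l \<Longrightarrow> n \<le> N"
  shows "eigenvalue_count S \<delta> \<le> of_nat N"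
proof -
  let ?A = "{\<mu>::real. complex_of_real \<mu> \<in> L2_spectrum S \<and> \<mu> > \<delta>}"
  let ?f = "\<lambda>\<mu>::real. ennreal_of_enat (L2_dim (L2_eigenspace S (complex_of_real \<mu>)))"
  have "\<exists>n u. L2_dim (L2_eigenspace S (of_real \<mu>)) = enat n \<and> (\<forall>i<n. eig (u i) \<mu>) \<and>
     (\<forall>i<n. \<forall>j<n. ip lborel (u i) (u j) = (if i = j then 1 else 0))" if "\<mu> > \<delta>" for \<mu>
  proof -
    have bound: "n \<le> N" if ind: "L2_independent (L2_eigenspace S (of_real \<mu>)) n f" for n f
    proof -
      obtain u where "\<forall>i<n. eig (u i) \<mu>" "\<forall>i<n. \<forall>j<n. ip lborel (u i) (u j) = (if i = j then 1 else 0)"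
        using independent_orthonormal[OF ind] by blast
      hence "eigenfam \<delta> n u (\<lambda>_. \<mu>)" using \<open>\<mu> > \<delta>\<close> by (auto simp: eigenfam_def)
      thus ?thesis by (rule max)
    qed
    obtain n f where n: "L2_dim (L2_eigenspace S (of_real \<mu>)) = enat n"
       and ind: "L2_independent (L2_eigenspace S (of_real \<mu>)) n f"
      using L2_dim_attained[of "L2_eigenspace S (of_real \<mu>)" N] bound by blast
    show ?thesis using n independent_orthonormal[OF ind] by blast
  qed
  then obtain m v where mv: "\<And>\<mu>. \<mu> > \<delta> \<Longrightarrow> L2_dim (L2_eigenspace S (of_real \<mu>)) = enat (m \<mu>)"
    "\<And>\<mu> i. \<mu> > \<delta> \<Longrightarrow> i < m \<mu> \<Longrightarrow> eig (v \<mu> i) \<mu>"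
    "\<And>\<mu> i j. \<mu> > \<delta> \<Longrightarrow> i < m \<mu> \<Longrightarrow> j < m \<mu> \<Longrightarrow> ip lborel (v \<mu> i) (v \<mu> j) = (if i = j then 1 else 0)"
    by metis
  have "sum ?f F \<le> of_nat N" if F: "finite F" "F \<subseteq> ?A" for F
  proof -
    \<comment> \<open>Pairs of a spectral value and an index into its basis; the bijection
      \<open>b\<close> lists them as a single sequence.\<close>
    let ?I = "Sigma F (\<lambda>\<mu>. {..<m \<mu>})"
    have finI: "finite ?I" using F by auto
    obtain b where b: "bij_betw b {..<card ?I} ?I"
      using ex_bij_betw_nat_finite[OF finI] by (auto simp: atLeast0LessThan)
    have bI: "b i \<in> ?I" if "i < card ?I" for i using b that by (auto simp: bij_betw_def)
    have bi: "b i = b j \<longleftrightarrow> i = j" if "i < card ?I" "j < card ?I" for i j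
      using b that by (auto simp: bij_betw_def inj_on_def)
    have Fd: "\<mu> > \<delta>" if "\<mu> \<in> F" for \<mu> using F that by auto
    have "eigenfam \<delta> (card ?I) (\<lambda>k. v (fst (b k)) (snd (b k))) (\<lambda>k. fst (b k))"
      unfolding eigenfam_def
    proof (intro conjI allI impI)
      fix i assume "i < card ?I"
      from bI[OF this] show "eig (v (fst (b i)) (snd (b i))) (fst (b i))" "\<delta> < fst (b i)"
        using Fd mv(2) by auto
    next
      fix i j assume ij: "i < card ?I" "j < card ?I"
      obtain \<mu> p where 1: "b i = (\<mu>, p)" "\<mu> \<in> F" "p < m \<mu>" using bI[OF ij(1)] by auto
      obtain \<nu> q where 2: "b j = (\<nu>, q)" "\<nu> \<in> F" "q < m \<nu>" using bI[OF ij(2)] by auto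
      show "ip lborel (v (fst (b i)) (snd (b i))) (v (fst (b j)) (snd (b j))) = (if i = j then 1 else 0)"
      proof (cases "\<mu> = \<nu>")
        case True
        have "i = j \<longleftrightarrow> p = q" using bi[OF ij] 1(1) 2(1) True by auto
        thus ?thesis using mv(3)[OF Fd[OF 1(2)] 1(3), of q] 1 2 True by simp
      next
        case False
        have "i \<noteq> j" using 1(1) 2(1) False by auto
        thus ?thesis using eig_orthogonal[OF mv(2)[OF Fd[OF 1(2)] 1(3)] mv(2)[OF Fd[OF 2(2)] 2(3)] False] 1 2 by simp
      qed
    qed
    hence "card ?I \<le> N" by (rule max)
    moreover have "card ?I = (\<Sum>\<mu>\<in>F. m \<mu>)" using F(1) by (simp add: card_SigmaI)
    moreover have "sum ?f F = (\<Sum>\<mu>\<in>F. of_nat (m \<mu>))" using mv(1) Fd by (intro sum.cong) auto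
    ultimately show ?thesis by (simp flip: of_nat_sum)
  qed
  hence "(SUP F\<in>{F. finite F \<and> F \<subseteq> ?A}. sum ?f F) \<le> of_nat N" by (intro SUP_least) auto
  thus ?thesis unfolding eigenvalue_count_def by (subst nonneg_infsum_complete) auto
qed

lemma eigenvalue_count_maximal:
  assumes "maximal_eigenfam \<delta> N"
  shows "eigenvalue_count S \<delta> = of_nat N"
  using assms eigenfam_le_eigenvalue_count eigenvalue_count_le
  unfolding maximal_eigenfam_def by (metis antisym)

end

lemma maximal_eigenfam_exists:
  assumes "\<And>n u l. eigenfam \<delta> n u l \<Longrightarrow> n \<le> K"
  obtains N where "maximal_eigenfam \<delta> N"
proof -
  let ?P = "\<lambda>n. \<exists>u l. eigenfam \<delta> n u l"
  have "eigenfam \<delta> 0 (\<lambda>_ _. 0) (\<lambda>_. 0)" by (simp add: eigenfam_def)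
  hence "?P 0" by blast
  then obtain N where "?P N" "\<forall>n. ?P n \<longrightarrow> n \<le> N"
    using ex_has_greatest_nat[of ?P 0 "\<lambda>n. n" "Suc K"] assms by (auto simp: less_Suc_eq_le)
  thus thesis using that unfolding maximal_eigenfam_def by blast
qed

end

section \<open>Choice of the decay scale\<close>

lemma fact_add_le: "fact (n + k) \<le> (fact n :: nat) * (n + k) ^ k"
proof (induction k)
  case (Suc k)
  have "fact (n + Suc k) = (n + Suc k) * (fact (n + k) :: nat)" by simp
  also have "\<dots> \<le> (n + Suc k) * (fact n * (n + k) ^ k)" using Suc by (rule mult_left_mono) simp
  also have "\<dots> \<le> (n + Suc k) * (fact n * (n + Suc k) ^ k)"
    by (intro mult_left_mono power_mono) auto
  finally show ?case by (simp add: mult_ac)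
qed simp

text \<open>The extra factors are at most \<open>(n + k) ^ k \<le> (4 ^ n) ^ k\<close>, which costs
  only the constant \<open>4 ^ k\<close> in each of the \<open>n\<close> factors. The shift is later
  \<open>d + 1\<close>, the orders of decay spent on integrability.\<close>

lemma fact_shift_le:
  assumes "k \<le> n"
  shows "fact (n + k) \<le> (4 ^ k * real n) ^ n"
proof (cases "n = 0")
  case False
  have "n + k \<le> 4 ^ n"
  proof -
    have "2 ^ 1 \<le> (2 :: nat) ^ n" using False by (intro power_increasing) auto
    hence "2 * n \<le> 2 ^ n * 2 ^ n" using less_exp[of n] by (intro mult_le_mono) auto
    also have "\<dots> = (4::nat) ^ n" by (simp flip: power_mult_distrib)
    finally show ?thesis using assms by simp
  qed
  have "fact (n + k) \<le> (fact n :: nat) * (n + k) ^ k" by (rule fact_add_le)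
  also have "\<dots> \<le> n ^ n * (4 ^ n) ^ k"
    using \<open>n + k \<le> 4 ^ n\<close> fact_le_power[of n, where 'a = nat] by (intro mult_mono power_mono) auto
  also have "\<dots> = (4 ^ k * n) ^ n" by (simp add: power_mult_distrib flip: power_mult)
  finally have "real (fact (n + k)) \<le> real ((4 ^ k * n) ^ n)" by (rule of_nat_mono)
  thus ?thesis by simp
qed (use assms in simp)

text \<open>From \<open>1 + y \<le> 4 * k * exp (y / (4 * k))\<close> with
  \<open>y = ln x / \<beta>\<close>: on raising to the power \<open>k * \<beta>\<close> the two
  occurrences of \<beta> cancel and \<open>x powr (1 / 4)\<close> remains. With
  \<open>x = Cg\<close> this is half of the available \<open>sqrt Cg\<close>.\<close>

lemma one_plus_powr_le:
  fixes x \<beta> :: real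
  assumes "1 \<le> x" "0 < \<beta>" "1 \<le> (k::nat)"
  shows "(1 + ln x / \<beta>) powr (k * \<beta>) \<le> (4 * real k) powr (k * \<beta>) * x powr (1 / 4)"
proof -
  define y where "y = ln x / \<beta>"
  have y: "y \<ge> 0" using assms by (simp add: y_def)
  have "1 + y / (4 * k) \<le> exp (y / (4 * k))" by (rule exp_ge_add_one_self)
  hence "4 * k * (1 + y / (4 * k)) \<le> 4 * k * exp (y / (4 * k))" by (rule mult_left_mono) simp
  moreover have "4 * k * (1 + y / (4 * k)) = 4 * k + y" using assms by (simp add: field_simps)
  ultimately have "1 + y \<le> 4 * k * exp (y / (4 * k))" using assms by linarith
  hence "(1 + y) powr (k * \<beta>) \<le> (4 * k * exp (y / (4 * k))) powr (k * \<beta>)"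
    using y assms by (intro powr_mono2) auto
  also have "\<dots> = (4 * real k) powr (k * \<beta>) * exp (y / (4 * k)) powr (k * \<beta>)"
    by (simp add: powr_mult)
  also have "exp (y / (4 * k)) powr (k * \<beta>) = exp (y * \<beta> / 4)"
    using assms by (simp add: powr_def)
  also have "\<dots> = x powr (1 / 4)" using assms by (simp add: y_def powr_def)
  finally show ?thesis by (simp add: y_def)
qed

text \<open>For \<open>A < 1\<close> the left side is 1, and the fourth root of the lower bound at
  \<open>n = 4 * m\<close> provides the factor \<open>A ^ m\<close>. The price
  \<open>Cg powr (1 / 4)\<close> is the other half of \<open>sqrt Cg\<close>.\<close>

lemma small_dilation_absorbed:
  fixes A Cg \<beta> :: real
  assumes "0 < A" and lower: "\<And>n::nat. 1 \<le> Cg * A ^ n * (fact n) powr \<beta>" and "0 < \<beta>" "0 < Cg" and e: "0 \<le> e" "e \<le> m"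
  shows "max A 1 powr e \<le> A ^ m * Cg powr (1 / 4) * (fact (4 * m)) powr \<beta>"
proof -
  have Cg1: "1 \<le> Cg" using lower[of 0] by simp
  have C4: "1 \<le> Cg powr (1 / 4)" using Cg1 by (simp add: ge_one_powr_ge_zero)
  have f1: "1 \<le> (fact (4 * m) :: real)" by (rule fact_ge_1)
  have F: "1 \<le> (fact (4 * m) :: real) powr \<beta>" using f1 \<open>0 < \<beta>\<close> by (simp add: ge_one_powr_ge_zero)
  show ?thesis
  proof (cases "A \<ge> 1")
    case True
    have "A powr e \<le> A powr (real m)" using True e by (intro powr_mono) auto
    also have "\<dots> = A ^ m * 1 * 1" using True by (simp add: powr_realpow)
    also have "\<dots> \<le> A ^ m * Cg powr (1 / 4) * (fact (4 * m)) powr \<beta>"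
      using True C4 F by (intro mult_mono) auto
    finally show ?thesis using True by simp
  next
    case False
    have "1 \<le> (Cg * A ^ (4 * m) * (fact (4 * m)) powr \<beta>) powr (1 / 4)"
      using lower[of "4 * m"] by (rule ge_one_powr_ge_zero) simp
    also have "\<dots> = Cg powr (1 / 4) * (A ^ (4 * m)) powr (1 / 4) * ((fact (4 * m)) powr \<beta>) powr (1 / 4)"
      using assms by (simp add: powr_mult)
    also have "(A ^ (4 * m)) powr (1 / 4) = A ^ m"
      using \<open>0 < A\<close> by (simp add: powr_realpow[symmetric] powr_powr)
    also have "((fact (4 * m)) powr \<beta>) powr (1 / 4) \<le> ((fact (4 * m)) powr \<beta>) powr 1"
      using F by (intro powr_mono) auto
    finally have "1 \<le> Cg powr (1 / 4) * A ^ m * (fact (4 * m)) powr \<beta>"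
      using \<open>0 < A\<close> C4 by (simp add: mult_left_mono)
    thus ?thesis using False by (simp add: max_def mult_ac)
  qed
qed

text \<open>
  The order \<open>n\<close> is about \<open>ln (Cg\<^sup>2 \<tau>) / (2 \<beta>)\<close>.  The denominator \<open>\<beta>\<close> matters: without it, absorbing
  powers of \<open>ln Cg\<close> into \<open>sqrt Cg\<close> would cost a factor of order \<open>\<beta> powr \<beta>\<close>, which no \<open>K powr \<beta>\<close> bounds.
\<close>

lemma decay_scale:
  fixes d :: nat
  assumes "d \<ge> 1"
  shows "\<exists>K\<ge>1. \<forall>\<beta> Cg A \<tau> :: real. \<beta> \<ge> 1 / 2 \<longrightarrow> Cg > 0 \<longrightarrow> A > 0 \<longrightarrow> \<tau> \<ge> 2 \<longrightarrow>
    (\<forall>n::nat. 1 \<le> Cg * A ^ n * (fact n) powr \<beta>) \<longrightarrow>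
    (\<exists>n r. n \<ge> d + 1 \<and> r > 0 \<and> \<tau> * (Cg * A ^ (n + d + 1) * (fact (n + d + 1)) powr \<beta>)\<^sup>2 \<le> r ^ (2 * n) \<and>
       (\<forall>k\<in>{1..2 * d}. r ^ k \<le> sqrt Cg * A ^ (3 * d + 2) * K powr \<beta> * ln \<tau> powr (real k * \<beta>)))"
proof -
  define m where "m = 3 * d + 2"
  \<comment> \<open>Large enough for \<open>2 * d + 3 + L + y \<le> c * (L * (1 + y))\<close>
    whenever \<open>L \<ge> 1 / 2\<close>.\<close>
  define c where "c = real (4 * d + 8)"
  define Kf where "Kf = (4::real) ^ (d + 1)"
  define b where "b = exp 1 * Kf * c"
  \<comment> \<open>The factors come from \<open>small_dilation_absorbed\<close>, from the constants
    in the bound for \<open>n\<close>, and from \<open>one_plus_powr_le\<close>, each taken at the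
    largest exponent \<open>2 * d\<close>.\<close>
  define K where "K = fact (4 * m) * b ^ (2 * d) * (4 * real (2 * d)) ^ (2 * d)"
  have Kf1: "Kf \<ge> 1" unfolding Kf_def by (rule one_le_power) simp
  have c1: "c \<ge> 1" by (simp add: c_def)
  have b1: "b \<ge> 1"
  proof -
    have "1 * 1 * 1 \<le> exp 1 * Kf * c" using Kf1 c1 by (intro mult_mono) auto
    thus ?thesis by (simp add: b_def)
  qed
  have d4: "1 \<le> 4 * real (2 * d)" using assms by simp
  have bd1: "1 \<le> b ^ (2 * d)" and dd1: "1 \<le> (4 * real (2 * d)) ^ (2 * d)"
    by (rule one_le_power[OF b1], rule one_le_power[OF d4])
  have K1: "K \<ge> 1"
  proof -
    have "1 * 1 * 1 \<le> K" unfolding K_def using bd1 dd1 fact_ge_1[of "4 * m"] by (intro mult_mono) auto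
    thus ?thesis by simp
  qed
  show ?thesis
  proof (intro exI[of _ K] conjI allI impI K1)
    fix \<beta> Cg A \<tau> :: real
    assume \<beta>: "\<beta> \<ge> 1 / 2" and Cg: "Cg > 0" and A: "A > 0" and \<tau>: "\<tau> \<ge> 2"
      and lower: "\<forall>n::nat. 1 \<le> Cg * A ^ n * (fact n) powr \<beta>"
    have Cg1: "1 \<le> Cg" using lower[rule_format, of 0] by simp
    define L where "L = ln \<tau>"
    define y where "y = ln Cg / \<beta>"
    define a where "a = max A 1"
    define q where "q = ln (Cg\<^sup>2 * \<tau>) / (2 * \<beta>)"
    \<comment> \<open>\<open>n \<ge> q\<close> gives
      \<open>Cg\<^sup>2 * \<tau> \<le> exp (2 * \<beta> * n)\<close>; the offset ensures
      \<open>n + d + 1 \<le> 3 / 2 * n\<close>, the origin of the exponent \<open>3 / 2\<close> of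
      \<open>a\<close>.\<close>
    define n where "n = 2 * (d + 1) + nat \<lceil>q\<rceil>"
    \<comment> \<open>In \<open>r ^ n\<close> the power of \<open>exp 1\<close> absorbs
      \<open>Cg\<close> and the square root of \<tau>, the power of \<open>a\<close> absorbs
      \<open>A ^ (n + d + 1)\<close>, and \<open>Kf * n\<close> absorbs the factorial.\<close>
    define r where "r = a powr (3 / 2) * (exp 1 * Kf * n) powr \<beta>"
    have a1: "a \<ge> 1" by (simp add: a_def)
    have L: "L \<ge> 1 / 2"
    proof -
      have "ln 2 \<le> L" unfolding L_def using \<tau> by (intro ln_mono) auto
      thus ?thesis using ln2_ge_two_thirds by linarith
    qed
    have y0: "y \<ge> 0" using Cg1 \<beta> by (simp add: y_def)
    have lnq: "ln (Cg\<^sup>2 * \<tau>) = 2 * ln Cg + L" using Cg \<tau> by (simp add: L_def ln_mult ln_realpow)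
    have lnCg: "ln Cg \<ge> 0" using Cg1 by simp
    have q0: "q \<ge> 0" unfolding q_def lnq using L lnCg \<beta> by (intro divide_nonneg_nonneg) auto
    have nq: "q \<le> n" unfolding n_def using real_nat_ceiling_ge[of q] by linarith
    have n2: "n \<ge> 2 * (d + 1)" by (simp add: n_def)
    hence npos: "real n > 0" by simp
    have rpos: "r > 0" unfolding r_def using a1 Kf1 npos by (intro mult_pos_pos) auto
    have "real (nat \<lceil>q\<rceil>) \<le> q + 1" using q0 by linarith
    hence nq': "real n \<le> real (2 * d + 3) + q" by (simp add: n_def)
    have qL: "q \<le> L + y"
    proof -
      have "L / (2 * \<beta>) \<le> L / 1" using \<beta> L by (intro divide_left_mono) auto
      thus ?thesis using \<beta> by (simp add: q_def lnq y_def add_divide_distrib)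
    qed
    have "real (2 * d + 3) + (L + y) \<le> c * (L * (1 + y))"
    proof -
      have "real (2 * d + 3) * 1 \<le> real (2 * d + 3) * (2 * L)" using L by (intro mult_left_mono) auto
      moreover have "1 * y \<le> 2 * L * y" using L y0 by (intro mult_right_mono) auto
      moreover have "0 \<le> real d * (L * y)" "0 \<le> L * y" "0 \<le> real d * L" using L y0 by auto
      ultimately show ?thesis using L by (simp add: c_def algebra_simps)
    qed
    hence nL: "real n \<le> c * (L * (1 + y))" using nq' qL by linarith
    have cond: "\<tau> * (Cg * A ^ (n + d + 1) * (fact (n + d + 1)) powr \<beta>)\<^sup>2 \<le> r ^ (2 * n)"
    proof -
      have f: "fact (n + (d + 1)) \<le> (Kf * real n) ^ n"
        unfolding Kf_def by (rule fact_shift_le) (use n2 in simp)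
      have fb: "(fact (n + d + 1)) powr \<beta> \<le> ((Kf * real n) ^ n) powr \<beta>"
        using f \<beta> by (intro powr_mono2) (auto simp: add.assoc)
      have "A ^ (n + d + 1) \<le> a ^ (n + d + 1)" using A by (intro power_mono) (auto simp: a_def)
      also have "\<dots> = a powr real (n + d + 1)" using a1 by (subst powr_realpow) auto
      also have "\<dots> \<le> a powr (3 / 2 * n)" using n2 a1 by (intro powr_mono) auto
      finally have Ab: "A ^ (n + d + 1) \<le> a powr (3 / 2 * n)" .
      have "(Cg * A ^ (n + d + 1) * (fact (n + d + 1)) powr \<beta>)\<^sup>2 \<le> (Cg * a powr (3 / 2 * n) * ((Kf * real n) ^ n) powr \<beta>)\<^sup>2"
        using Ab fb Cg A by (intro power_mono mult_mono) auto
      hence "\<tau> * (Cg * A ^ (n + d + 1) * (fact (n + d + 1)) powr \<beta>)\<^sup>2 \<le> \<tau> * (Cg * a powr (3 / 2 * n) * ((Kf * real n) ^ n) powr \<beta>)\<^sup>2"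
        using \<tau> by (intro mult_left_mono) auto
      also have "\<dots> = (Cg\<^sup>2 * \<tau>) * (a powr (3 / 2 * n) * ((Kf * real n) ^ n) powr \<beta>)\<^sup>2"
        by (simp add: power_mult_distrib mult_ac)
      also have "\<dots> \<le> exp (\<beta> * n) ^ 2 * (a powr (3 / 2 * n) * ((Kf * real n) ^ n) powr \<beta>)\<^sup>2"
      proof (rule mult_right_mono)
        have "ln (Cg\<^sup>2 * \<tau>) \<le> 2 * (\<beta> * n)" using nq \<beta> by (simp add: q_def field_simps)
        hence "exp (ln (Cg\<^sup>2 * \<tau>)) \<le> exp (2 * (\<beta> * n))" by (simp only: exp_le_cancel_iff)
        moreover have "exp (ln (Cg\<^sup>2 * \<tau>)) = Cg\<^sup>2 * \<tau>" using Cg \<tau> by (intro exp_ln) auto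
        moreover have "exp (2 * (\<beta> * n)) = exp (\<beta> * n) ^ 2" by (rule exp_double)
        ultimately show "Cg\<^sup>2 * \<tau> \<le> exp (\<beta> * n) ^ 2" by simp
      qed simp
      also have "\<dots> = (r ^ n)\<^sup>2"
      proof -
        have "(a powr (3 / 2)) ^ n = a powr (3 / 2 * n)"
          using a1 by (simp add: powr_realpow[symmetric] powr_powr)
        moreover have "((exp 1 * Kf * n) powr \<beta>) ^ n = exp (\<beta> * n) * ((Kf * real n) ^ n) powr \<beta>"
        proof -
          have "((exp 1 * Kf * n) powr \<beta>) ^ n = (exp 1 * (Kf * n)) powr (\<beta> * n)"
            using Kf1 npos by (simp add: powr_realpow[symmetric] powr_powr mult.assoc)
          also have "\<dots> = exp 1 powr (\<beta> * n) * (Kf * n) powr (\<beta> * n)" by (rule powr_mult)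
          also have "exp 1 powr (\<beta> * n) = exp (\<beta> * n)" by (simp add: powr_def)
          also have "(Kf * n) powr (\<beta> * n) = ((Kf * real n) ^ n) powr \<beta>"
            using Kf1 npos by (simp add: powr_realpow[symmetric] powr_powr mult.commute)
          finally show ?thesis .
        qed
        ultimately have "r ^ n = exp (\<beta> * n) * (a powr (3 / 2 * n) * ((Kf * real n) ^ n) powr \<beta>)"
          by (simp add: r_def power_mult_distrib mult_ac)
        thus ?thesis by (simp only: power_mult_distrib)
      qed
      also have "\<dots> = r ^ (2 * n)" by (simp flip: power_mult add: mult.commute)
      finally show ?thesis .
    qed
    have size: "r ^ k \<le> sqrt Cg * A ^ (3 * d + 2) * K powr \<beta> * ln \<tau> powr (real k * \<beta>)" if k: "k \<in> {1..2 * d}" for k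
    proof -
      have k1: "1 \<le> k" "k \<le> 2 * d" using k by auto
      have B: "0 < \<beta>" using \<beta> by simp
      have "exp 1 * Kf * n \<le> b * L * (1 + y)"
      proof -
        have "(exp 1 * Kf) * n \<le> (exp 1 * Kf) * (c * (L * (1 + y)))" using nL Kf1 by (intro mult_left_mono) auto
        thus ?thesis by (simp add: b_def mult_ac)
      qed
      hence "(exp 1 * Kf * n) powr (k * \<beta>) \<le> (b * L * (1 + y)) powr (k * \<beta>)"
        using Kf1 B by (intro powr_mono2) auto
      also have "\<dots> = b powr (k * \<beta>) * L powr (k * \<beta>) * (1 + y) powr (k * \<beta>)"
        by (simp add: powr_mult)
      also have "\<dots> \<le> b powr (k * \<beta>) * L powr (k * \<beta>) * ((4 * real k) powr (k * \<beta>) * Cg powr (1 / 4))"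
        unfolding y_def by (intro mult_left_mono one_plus_powr_le Cg1 B k1) auto
      finally have P: "(exp 1 * Kf * n) powr (k * \<beta>) \<le> b powr (k * \<beta>) * L powr (k * \<beta>) * ((4 * real k) powr (k * \<beta>) * Cg powr (1 / 4))" .
      \<comment> \<open>\<open>k \<le> 2 * d\<close> gives at most \<open>3 * d\<close>, within
        \<open>m = 3 * d + 2\<close>.\<close>
      have "real k * 3 / 2 \<le> real m" using k1 by (simp add: m_def)
      hence a: "a powr (real k * 3 / 2) \<le> A ^ m * Cg powr (1 / 4) * (fact (4 * m)) powr \<beta>"
        unfolding a_def using lower by (intro small_dilation_absorbed A B Cg) auto
      have "r ^ k = (a powr (3 / 2)) ^ k * ((exp 1 * Kf * n) powr \<beta>) ^ k" by (simp add: r_def power_mult_distrib)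
      also have "(a powr (3 / 2)) ^ k = a powr (real k * 3 / 2)" using a1 by (simp add: powr_realpow[symmetric] powr_powr mult.commute)
      also have "((exp 1 * Kf * n) powr \<beta>) ^ k = (exp 1 * Kf * n) powr (k * \<beta>)"
        using Kf1 npos by (simp add: powr_realpow[symmetric] powr_powr mult.commute)
      also have "a powr (real k * 3 / 2) * (exp 1 * Kf * n) powr (k * \<beta>) \<le>
         (A ^ m * Cg powr (1 / 4) * (fact (4 * m)) powr \<beta>) * (b powr (k * \<beta>) * L powr (k * \<beta>) * ((4 * real k) powr (k * \<beta>) * Cg powr (1 / 4)))"
        using a P A by (intro mult_mono) auto
      also have "\<dots> = (Cg powr (1 / 4) * Cg powr (1 / 4)) * A ^ m * ((fact (4 * m)) powr \<beta> * b powr (k * \<beta>) * (4 * real k) powr (k * \<beta>)) * L powr (k * \<beta>)"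
        by (simp add: mult_ac)
      also have "Cg powr (1 / 4) * Cg powr (1 / 4) = sqrt Cg"
        using Cg by (simp add: powr_add[symmetric] powr_half_sqrt)
      also have "sqrt Cg * A ^ m * ((fact (4 * m)) powr \<beta> * b powr (k * \<beta>) * (4 * real k) powr (k * \<beta>)) * L powr (k * \<beta>)
         \<le> sqrt Cg * A ^ m * K powr \<beta> * L powr (k * \<beta>)"
      proof (intro mult_right_mono mult_left_mono)
        have e1: "b powr (k * \<beta>) \<le> (b ^ (2 * d)) powr \<beta>"
        proof -
          have "b powr (k * \<beta>) \<le> b powr (real (2 * d) * \<beta>)" using b1 k1 B by (intro powr_mono mult_right_mono) auto
          also have "\<dots> = (b ^ (2 * d)) powr \<beta>" using b1 by (subst powr_powr[symmetric], subst powr_realpow) auto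
          finally show ?thesis .
        qed
        have e2: "(4 * real k) powr (k * \<beta>) \<le> ((4 * real (2 * d)) ^ (2 * d)) powr \<beta>"
        proof -
          have "(4 * real k) powr (k * \<beta>) \<le> (4 * real (2 * d)) powr (k * \<beta>)" using k1 B by (intro powr_mono2) auto
          also have "\<dots> \<le> (4 * real (2 * d)) powr (real (2 * d) * \<beta>)" using d4 k1 B by (intro powr_mono mult_right_mono) auto
          also have "\<dots> = ((4 * real (2 * d)) ^ (2 * d)) powr \<beta>" using d4 by (subst powr_powr[symmetric], subst powr_realpow) auto
          finally show ?thesis .
        qed
        have "(fact (4 * m)) powr \<beta> * b powr (k * \<beta>) * (4 * real k) powr (k * \<beta>)
          \<le> (fact (4 * m)) powr \<beta> * (b ^ (2 * d)) powr \<beta> * ((4 * real (2 * d)) ^ (2 * d)) powr \<beta>"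
          using e1 e2 by (intro mult_mono) auto
        also have "\<dots> = K powr \<beta>" by (simp only: K_def powr_mult)
        finally show "(fact (4 * m)) powr \<beta> * b powr (k * \<beta>) * (4 * real k) powr (k * \<beta>) \<le> K powr \<beta>" .
      qed (use Cg A in auto)
      finally show ?thesis by (simp add: m_def L_def)
    qed
    show "\<exists>n r. n \<ge> d + 1 \<and> r > 0 \<and> \<tau> * (Cg * A ^ (n + d + 1) * (fact (n + d + 1)) powr \<beta>)\<^sup>2 \<le> r ^ (2 * n) \<and>
       (\<forall>k\<in>{1..2 * d}. r ^ k \<le> sqrt Cg * A ^ (3 * d + 2) * K powr \<beta> * ln \<tau> powr (real k * \<beta>))"
    proof (intro exI conjI)
      show "d + 1 \<le> n" using n2 by simp
    qed (use rpos cond size in blast)+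
  qed
qed

section \<open>The deviation estimate\<close>

text \<open>The shell between \<open>2 ^ k * r\<close> and \<open>2 ^ (k + 1) * r\<close> has volume
  of order \<open>2 ^ (k * D)\<close>, while \<open>f\<close> is of order
  \<open>2 ^ (- k * (D + 1))\<close> there. The products form a geometric series with sum 2; the
  core \<open>\<psi> x \<le> r\<close> contributes at most \<open>B\<close>.\<close>

lemma dyadic_integral_le:
  fixes \<psi> f :: "'b::euclidean_space \<Rightarrow> real"
  assumes [measurable]: "\<psi> \<in> borel_measurable borel" and "r > 0" "B \<ge> 0" "c \<ge> 0"
    and vol: "\<And>k::nat. emeasure lborel {x. \<psi> x \<le> 2 ^ k * r} \<le> ennreal (B * 2 ^ (k * D))"
    and f1: "\<And>x. f x \<le> 1" and decay: "\<And>x. r < \<psi> x \<Longrightarrow> f x \<le> c * (r / \<psi> x) ^ (D + 1)"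
  shows "(\<integral>\<^sup>+x. ennreal (f x) \<partial>lborel) \<le> ennreal (B * (1 + c * 2 ^ (D + 1)))"
proof -
  let ?N = "\<lambda>k::nat. {x. \<psi> x \<le> 2 ^ k * r}"
  let ?w = "\<lambda>k::nat. ennreal (c * (1 / 2) ^ (k * (D + 1)))"
  have [measurable]: "?N k \<in> sets borel" for k by measurable
  have "(\<integral>\<^sup>+x. ennreal (f x) \<partial>lborel) \<le> (\<integral>\<^sup>+x. indicator (?N 0) x + (\<Sum>k. ?w k * indicator (?N (Suc k)) x) \<partial>lborel)"
  proof (rule nn_integral_mono)
    fix x
    show "ennreal (f x) \<le> indicator (?N 0) x + (\<Sum>k. ?w k * indicator (?N (Suc k)) x)"
    proof (cases "\<psi> x \<le> r")
      case True
      have "ennreal (f x) \<le> 1" using ennreal_leI[OF f1[of x]] by simp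
      thus ?thesis using True by (simp add: add_increasing2)
    next
      case False
      obtain n where n: "\<psi> x \<le> 2 ^ n * r" and least: "\<And>m. m < n \<Longrightarrow> \<not> \<psi> x \<le> 2 ^ m * r"
      proof -
        obtain n0 :: nat where "\<psi> x / r < 2 ^ n0" using real_arch_pow[of 2] by auto
        hence "\<psi> x \<le> 2 ^ n0 * r" using \<open>r > 0\<close> by (simp add: field_simps)
        thus thesis using exists_least_iff[of "\<lambda>n. \<psi> x \<le> 2 ^ n * r"] that by blast
      qed
      have "n \<noteq> 0" using n False by (intro notI) simp
      then obtain k where k: "n = Suc k" by (cases n) auto
      have gt: "2 ^ k * r < \<psi> x" using least[of k] k by simp
      have "f x \<le> c * (r / \<psi> x) ^ (D + 1)" using decay False by simp
      also have "\<dots> \<le> c * ((1 / 2) ^ k) ^ (D + 1)"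
      proof (intro mult_left_mono power_mono)
        have "0 < 2 ^ k * r" using \<open>r > 0\<close> by simp
        hence pos: "0 < \<psi> x" using gt by linarith
        show "r / \<psi> x \<le> (1 / 2) ^ k" using gt pos by (simp add: field_simps power_divide)
        show "0 \<le> r / \<psi> x" using pos \<open>r > 0\<close> by simp
      qed fact
      finally have "ennreal (f x) \<le> ?w k" by (intro ennreal_leI) (simp only: power_mult)
      also have "\<dots> = (\<Sum>k\<in>{k}. ?w k * indicator (?N (Suc k)) x)" using n k by simp
      also have "\<dots> \<le> (\<Sum>k. ?w k * indicator (?N (Suc k)) x)" by (rule sum_le_suminf) auto
      finally show ?thesis by (simp add: add_increasing)
    qed
  qed
  also have "\<dots> = emeasure lborel (?N 0) + (\<Sum>k. ?w k * emeasure lborel (?N (Suc k)))"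
    by (subst nn_integral_add) (auto simp: nn_integral_suminf nn_integral_cmult)
  also have "\<dots> \<le> ennreal B + (\<Sum>k. ennreal (c * B * 2 ^ D * (1 / 2) ^ k))"
  proof (intro add_mono suminf_le)
    show "emeasure lborel (?N 0) \<le> ennreal B" using vol[of 0] by simp
    fix k
    have "?w k * emeasure lborel (?N (Suc k)) \<le> ?w k * ennreal (B * 2 ^ (Suc k * D))"
      by (intro mult_left_mono vol) auto
    also have "\<dots> = ennreal (c * (1 / 2) ^ (k * (D + 1)) * (B * 2 ^ (Suc k * D)))"
      using assms by (intro ennreal_mult[symmetric]) auto
    also have "c * (1 / 2) ^ (k * (D + 1)) * (B * 2 ^ (Suc k * D)) = c * B * 2 ^ D * (1 / 2) ^ k"
      by (simp add: power_add power_divide)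
    finally show "?w k * emeasure lborel (?N (Suc k)) \<le> ennreal (c * B * 2 ^ D * (1 / 2) ^ k)" .
  qed auto
  also have "(\<Sum>k. ennreal (c * B * 2 ^ D * (1 / 2) ^ k)) = ennreal (c * B * 2 ^ D * 2)"
  proof (rule suminf_ennreal_eq)
    have "(\<lambda>k. (1 / 2 :: real) ^ k) sums 2" using geometric_sums[of "1 / 2 :: real"] by simp
    thus "(\<lambda>k. c * B * 2 ^ D * (1 / 2) ^ k) sums (c * B * 2 ^ D * 2)" by (rule sums_mult)
  qed (use assms in auto)
  also have "ennreal B + ennreal (c * B * 2 ^ D * 2) = ennreal (B * (1 + c * 2 ^ (D + 1)))"
    using assms by (subst ennreal_plus[symmetric]) (auto simp: algebra_simps)
  finally show ?thesis .
qed

lemma integrable_inverse_power_norm: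
  "integrable lborel (\<lambda>x::'b::euclidean_space. 1 / (1 + norm x) ^ (DIM('b) + 2))"
proof (rule integrableI_bounded)
  let ?D = "DIM('b)"
  have "(\<integral>\<^sup>+x. ennreal (1 / (1 + norm (x :: 'b)) ^ (?D + 2)) \<partial>lborel) \<le> ennreal (unit_ball_vol ?D * (1 + 1 * 2 ^ (?D + 1)))"
  proof (rule dyadic_integral_le[where r = 1 and \<psi> = norm])
    fix k :: nat
    have "{x :: 'b. norm x \<le> 2 ^ k * 1} = cball 0 (2 ^ k)" by (auto simp: dist_norm)
    thus "emeasure lborel {x :: 'b. norm x \<le> 2 ^ k * 1} \<le> ennreal (unit_ball_vol ?D * 2 ^ (k * ?D))"
      by (simp add: emeasure_cball power_mult)
  next
    fix x :: 'b
    have "1 \<le> (1 + norm x) ^ (?D + 2)" by (rule one_le_power) simp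
    thus "1 / (1 + norm x) ^ (?D + 2) \<le> 1" by simp
    assume x: "1 < norm x"
    have "norm x ^ (?D + 1) \<le> (1 + norm x) ^ (?D + 1)" by (intro power_mono) auto
    also have "\<dots> \<le> (1 + norm x) ^ (?D + 2)" by (intro power_increasing) auto
    finally have "1 / (1 + norm x) ^ (?D + 2) \<le> 1 / norm x ^ (?D + 1)" using x by (intro divide_left_mono mult_pos_pos zero_less_power) auto
    thus "1 / (1 + norm x) ^ (?D + 2) \<le> 1 * (1 / norm x) ^ (?D + 1)" by (simp only: power_one_over mult_1)
  qed auto
  also have "\<dots> < \<infinity>" by simp
  finally show "(\<integral>\<^sup>+x. ennreal (norm (1 / (1 + norm (x :: 'b)) ^ (?D + 2))) \<partial>lborel) < \<infinity>" by simp
qed measurable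

text \<open>The argument is a type only, so the value may enter a constant depending on the
  dimension alone.\<close>

definition decay_const :: "'b::euclidean_space itself \<Rightarrow> real" where
  "decay_const _ = (LINT x|lborel. 1 / (1 + norm (x :: 'b)) ^ (DIM('b) + 2))"

lemma decay_const_nonneg: "0 \<le> decay_const TYPE('b::euclidean_space)"
  unfolding decay_const_def by (rule Bochner_Integration.integral_nonneg) simp

text \<open>The segment from \<open>z\<close> to \<open>w\<close> is connected and meets both the
  set and its complement, so it crosses the frontier.\<close>

lemma infdist_frontier_le:
  fixes S :: "'b::euclidean_space set"
  assumes "z \<in> S \<longleftrightarrow> w \<notin> S"
  shows "infdist z (frontier S) \<le> dist z w"
proof -
  have "connected (closed_segment z w)" by (rule connected_segment)
  moreover have "z \<in> closed_segment z w" "w \<in> closed_segment z w" by auto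
  hence "closed_segment z w \<inter> S \<noteq> {}" "closed_segment z w - S \<noteq> {}" using assms by blast+
  ultimately have "closed_segment z w \<inter> frontier S \<noteq> {}" by (rule connected_Int_frontier)
  then obtain p where p: "p \<in> closed_segment z w" "p \<in> frontier S" by blast
  have "infdist z (frontier S) \<le> dist z p" using p(2) by (rule infdist_le)
  also have "\<dots> \<le> dist z w" using dist_in_closed_segment[OF p(1)] by (simp add: dist_commute)
  finally show ?thesis .
qed

section \<open>Decay away from the boundary\<close>

context window begin

text \<open>Covariance under time-frequency shifts: translating the integration variable reduces to
  \<open>stft g g (w - z)\<close> up to a unimodular phase.\<close>

lemma stft_tfshift: "cmod (stft g (tfshift z) w) = cmod (stft g g (w - z))"
proof -
  let ?x = "fst z" and ?u = "fst w - fst z" and ?\<eta> = "snd w - snd z"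
  let ?h = "\<lambda>t. g t * cnj (g (t - ?u)) * cis (- 2 * pi * (?\<eta> \<bullet> (t + ?x)))"
  have [measurable]: "tfshift z \<in> borel_measurable borel" using tfshift_sqint[of z] by simp
  have "stft g (tfshift z) w = (LINT t|lborel. tfshift z t * cnj (g (t - fst w)) * cis (- 2 * pi * (snd w \<bullet> t)))"
    using stft_lborel[of "tfshift z" g "fst w" "snd w"] by (simp add: fourier_def)
  also have "\<dots> = (LINT t|lborel. ?h (t - ?x))"
  proof (intro Bochner_Integration.integral_cong refl)
    fix t
    have e1: "cis (2 * pi * (snd z \<bullet> t)) * cis (- 2 * pi * (snd w \<bullet> t)) = cis (- 2 * pi * (?\<eta> \<bullet> t))"
      by (simp add: cis_mult inner_diff_left algebra_simps)
    have e2: "t - ?x - ?u = t - fst w" "t - ?x + ?x = t" by auto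
    have "?h (t - ?x) = g (t - ?x) * cnj (g (t - fst w)) * (cis (2 * pi * (snd z \<bullet> t)) * cis (- 2 * pi * (snd w \<bullet> t)))"
      by (simp only: e1 e2)
    thus "tfshift z t * cnj (g (t - fst w)) * cis (- 2 * pi * (snd w \<bullet> t)) = ?h (t - ?x)"
      by (simp only: tfshift_def mult_ac)
  qed
  also have "\<dots> = (LINT t|lborel. ?h t)" by (rule integral_translate) measurable
  also have "\<dots> = (LINT t|lborel. cis (- 2 * pi * (?\<eta> \<bullet> ?x)) * (g t * cnj (g (t - ?u)) * cis (- 2 * pi * (?\<eta> \<bullet> t))))"
  proof (intro Bochner_Integration.integral_cong refl)
    fix t
    have "cis (- 2 * pi * (?\<eta> \<bullet> (t + ?x))) = cis (- 2 * pi * (?\<eta> \<bullet> ?x)) * cis (- 2 * pi * (?\<eta> \<bullet> t))"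
      by (simp add: cis_mult inner_add_right algebra_simps)
    thus "?h t = cis (- 2 * pi * (?\<eta> \<bullet> ?x)) * (g t * cnj (g (t - ?u)) * cis (- 2 * pi * (?\<eta> \<bullet> t)))"
      by (simp only: mult_ac)
  qed
  also have "\<dots> = cis (- 2 * pi * (?\<eta> \<bullet> ?x)) * stft g g (w - z)"
    using stft_lborel[of g g ?u ?\<eta>] by (simp add: fourier_def minus_prod_def)
  finally show ?thesis by (simp add: norm_mult)
qed

text \<open>The function \<open>\<Phi>\<close> of the overview.\<close>

definition tail :: "real \<Rightarrow> real" where
  "tail s = (LINT w|lborel. indicator {w. s \<le> norm w} w * (cmod (stft g g w))\<^sup>2)"

lemma stft_g_borel [measurable]: "stft g g \<in> borel_measurable borel"
  using moyal(1)[OF g] by simp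

lemma stft_g_integrable: "integrable lborel (\<lambda>w. (cmod (stft g g w))\<^sup>2)"
  by (rule sqint_integrable[OF moyal(1)[OF g]])

lemma integrable_restrict_stft_g:
  assumes [measurable]: "S \<in> sets borel"
  shows "integrable lborel (\<lambda>w. indicator S w * (cmod (stft g g w))\<^sup>2)"
  by (rule Bochner_Integration.integrable_bound[OF stft_g_integrable]) (auto split: split_indicator)

lemma tail_nonneg: "0 \<le> tail s"
  unfolding tail_def by (rule Bochner_Integration.integral_nonneg) (auto split: split_indicator)

lemma integral_le_tail:
  assumes [measurable]: "S \<in> sets borel" and far: "\<And>w. w \<in> S \<Longrightarrow> s \<le> dist z w"
  shows "(LINT w|lborel. indicator S w * (cmod (stft g g (w - z)))\<^sup>2) \<le> tail s"
proof -
  let ?N = "{w :: 'a \<times> 'a. s \<le> norm w}"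
  have [measurable]: "?N \<in> sets borel" by measurable
  have i: "integrable lborel (\<lambda>w. indicator ?N (w - z) * (cmod (stft g g (w - z)))\<^sup>2)"
    by (rule integrable_translate[OF integrable_restrict_stft_g]) measurable
  have "(LINT w|lborel. indicator S w * (cmod (stft g g (w - z)))\<^sup>2)
      \<le> (LINT w|lborel. indicator ?N (w - z) * (cmod (stft g g (w - z)))\<^sup>2)"
  proof (rule integral_mono[OF _ i])
    have le: "indicator S w * (cmod (stft g g (w - z)))\<^sup>2 \<le> indicator ?N (w - z) * (cmod (stft g g (w - z)))\<^sup>2" for w
      using far[of w] by (auto split: split_indicator simp: dist_norm norm_minus_commute)
    show "indicator S w * (cmod (stft g g (w - z)))\<^sup>2 \<le> indicator ?N (w - z) * (cmod (stft g g (w - z)))\<^sup>2" for w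
      by (rule le)
    show "integrable lborel (\<lambda>w. indicator S w * (cmod (stft g g (w - z)))\<^sup>2)"
      by (rule Bochner_Integration.integrable_bound[OF integrable_translate[OF stft_g_integrable, of z]])
         (measurable, auto split: split_indicator)
  qed
  also have "\<dots> = tail s" unfolding tail_def by (rule integral_translate) measurable
  finally show ?thesis .
qed

lemma W_tfshift_nsq: "nsq lborel (W (tfshift z)) = (LINT w|lborel. indicator \<Omega> w * (cmod (stft g g (w - z)))\<^sup>2)"
  unfolding nsq_def W_def
  by (intro Bochner_Integration.integral_cong refl) (auto simp: norm_mult stft_tfshift split: split_indicator)

lemma W_tfshift_outside:
  assumes "z \<notin> \<Omega>"
  shows "nsq lborel (W (tfshift z)) \<le> tail (infdist z (frontier \<Omega>))"
  unfolding W_tfshift_nsq using assms by (intro integral_le_tail infdist_frontier_le) auto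

text \<open>The form at \<open>tfshift z\<close> is the mass over \<Omega> of a density of total
  mass 1, so the missing part lies off \<Omega> and hence beyond the distance from \<open>z\<close>
  to the frontier.\<close>

lemma W_tfshift_inside:
  assumes "z \<in> \<Omega>"
  shows "1 - nsq lborel (W (tfshift z)) \<le> tail (infdist z (frontier \<Omega>))"
proof -
  let ?G = "\<lambda>w. (cmod (stft g g (w - z)))\<^sup>2"
  have G: "integrable lborel ?G" by (rule integrable_translate[OF stft_g_integrable])
  have res: "integrable lborel (\<lambda>w. indicator S w * ?G w)" if [measurable]: "S \<in> sets borel" for S
    by (rule Bochner_Integration.integrable_bound[OF G]) (measurable, auto split: split_indicator)
  have "1 = (LINT w|lborel. ?G w)"
    using moyal(2)[OF g] g1 integral_translate[of "\<lambda>w. (cmod (stft g g w))\<^sup>2" z] by (simp add: nsq_def)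
  also have "\<dots> = (LINT w|lborel. indicator \<Omega> w * ?G w + indicator (- \<Omega>) w * ?G w)"
    by (intro Bochner_Integration.integral_cong refl) (auto split: split_indicator)
  also have "\<dots> = (LINT w|lborel. indicator \<Omega> w * ?G w) + (LINT w|lborel. indicator (- \<Omega>) w * ?G w)"
    by (intro Bochner_Integration.integral_add res) auto
  finally have "1 - nsq lborel (W (tfshift z)) = (LINT w|lborel. indicator (- \<Omega>) w * ?G w)"
    by (simp add: W_tfshift_nsq)
  also have "\<dots> \<le> tail (infdist z (frontier \<Omega>))"
    using assms by (intro integral_le_tail infdist_frontier_le) auto
  finally show ?thesis .
qed

text \<open>Squaring decay of order \<open>n + DIM('a) + 1\<close> leaves exponent
  \<open>2 * n + D + 2\<close>, with \<open>D = DIM('a \<times> 'a)\<close>: the part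
  \<open>2 * n\<close> gives the decay in \<open>s\<close>, and \<open>D + 2\<close> makes the
  remaining integral converge.\<close>

lemma tail_le:
  assumes decay: "\<And>w. cmod (stft g g w) \<le> M / (1 + norm w) ^ (n + DIM('a) + 1)" and "s > 0"
  shows "tail s \<le> M\<^sup>2 * decay_const TYPE('a \<times> 'a) / s ^ (2 * n)"
proof -
  let ?D = "DIM('a \<times> 'a)"
  let ?N = "{w :: 'a \<times> 'a. s \<le> norm w}"
  have [measurable]: "?N \<in> sets borel" by measurable
  have "tail s \<le> (LINT w|lborel. M\<^sup>2 / s ^ (2 * n) * (1 / (1 + norm (w :: 'a \<times> 'a)) ^ (?D + 2)))"
    unfolding tail_def
  proof (rule integral_mono[OF integrable_restrict_stft_g])
    show "integrable lborel (\<lambda>w :: 'a \<times> 'a. M\<^sup>2 / s ^ (2 * n) * (1 / (1 + norm w) ^ (?D + 2)))"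
      using integrable_inverse_power_norm[where 'b = "'a \<times> 'a"] by (intro integrable_mult_right) auto
    fix w :: "'a \<times> 'a"
    show "indicator ?N w * (cmod (stft g g w))\<^sup>2 \<le> M\<^sup>2 / s ^ (2 * n) * (1 / (1 + norm w) ^ (?D + 2))"
    proof (cases "s \<le> norm w")
      case True
      have e: "(q ^ (n + DIM('a) + 1))\<^sup>2 = q ^ (2 * n) * q ^ (?D + 2)" for q :: real
        unfolding power_even_eq[symmetric] power_add[symmetric] by (simp add: add.commute)
      have "(cmod (stft g g w))\<^sup>2 \<le> (M / (1 + norm w) ^ (n + DIM('a) + 1))\<^sup>2"
        using decay by (intro power_mono) auto
      also have "\<dots> = M\<^sup>2 / ((1 + norm w) ^ (2 * n) * (1 + norm w) ^ (?D + 2))"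
        by (simp only: power_divide e)
      also have "\<dots> \<le> M\<^sup>2 / (s ^ (2 * n) * (1 + norm w) ^ (?D + 2))"
        using True \<open>s > 0\<close> by (intro divide_left_mono mult_right_mono power_mono mult_pos_pos zero_less_power) (auto intro: add_pos_nonneg)
      finally show ?thesis using True by simp
    qed simp
  qed measurable
  also have "\<dots> = M\<^sup>2 / s ^ (2 * n) * decay_const TYPE('a \<times> 'a)"
    by (simp only: decay_const_def integral_mult_right_zero)
  also have "\<dots> = M\<^sup>2 * decay_const TYPE('a \<times> 'a) / s ^ (2 * n)" by simp
  finally show ?thesis .
qed

lemma eigenvalue_count_deviation:
  fixes S :: "('a \<Rightarrow> complex) \<Rightarrow> 'a \<Rightarrow> complex"
  defines "D \<equiv> DIM('a \<times> 'a)"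
  assumes S: "\<And>f f'. sqint lborel f' \<Longrightarrow> AE t in lborel. f' t = f t \<Longrightarrow> S f = T f'"
    and \<delta>: "0 < \<delta>" "\<delta> < 1" and \<tau>: "1 / \<delta> \<le> \<tau>" "1 / (1 - \<delta>) \<le> \<tau>"
    and ne: "frontier \<Omega> \<noteq> {}" and H: "hausdorff_measure (D - 1) (frontier \<Omega>) \<le> ennreal h"
    and pos: "h \<ge> 0" "\<kappa> > 0" "\<eta> > 0" "r > 0"
    and reg: "\<And>r z. 0 < r \<Longrightarrow> r \<le> \<eta> \<Longrightarrow> z \<in> frontier \<Omega> \<Longrightarrow>
        ennreal (\<kappa> * r ^ (D - 1)) \<le> hausdorff_measure (D - 1) (frontier \<Omega> \<inter> ball z r)"
    and decay: "\<And>w. cmod (stft g g w) \<le> M / (1 + norm w) ^ (n + DIM('a) + 1)"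
    and n: "n \<ge> DIM('a) + 1" and r: "\<tau> * M\<^sup>2 \<le> r ^ (2 * n)"
  shows "\<exists>N. eigenvalue_count S \<delta> = of_nat N \<and> \<bar>real N - measure lborel \<Omega>\<bar>
     \<le> 4 ^ D * unit_ball_vol D * (h / \<kappa>) * r * (1 + (r / \<eta>) ^ (D - 1)) * (1 + decay_const TYPE('a \<times> 'a) * 2 ^ (D + 1))"
proof -
  let ?I = "decay_const TYPE('a \<times> 'a)"
  define \<psi> where "\<psi> z = infdist z (frontier \<Omega>)" for z
  define \<Psi> where "\<Psi> z = tail (\<psi> z)" for z
  define B where "B = 4 ^ D * unit_ball_vol D * (h / \<kappa>) * r * (1 + (r / \<eta>) ^ (D - 1))"
  define E where "E = B * (1 + ?I * 2 ^ (D + 1))"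
  have D1: "D = Suc (D - 1)" unfolding D_def using DIM_positive[where 'a = "'a \<times> 'a"] by simp
  have B0: "B \<ge> 0" using pos by (simp add: B_def)
  have E0: "E \<ge> 0" unfolding E_def using B0 decay_const_nonneg[where 'b = "'a \<times> 'a"] by (intro mult_nonneg_nonneg add_nonneg_nonneg) auto
  have \<Psi>0: "0 \<le> \<Psi> z" for z unfolding \<Psi>_def by (rule tail_nonneg)
  have "0 < 1 / \<delta>" using \<delta> by simp
  hence \<tau>0: "0 < \<tau>" using \<tau>(1) by linarith
  have cpt: "compact (frontier \<Omega>)" using \<Omega> by (rule compact_frontier)
  have int: "(\<integral>\<^sup>+z. ennreal (min 1 (\<tau> * \<Psi> z)) \<partial>lborel) \<le> ennreal E"
    unfolding E_def
  proof (rule dyadic_integral_le[where r = r and \<psi> = \<psi>])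
    show "\<psi> \<in> borel_measurable borel" unfolding \<psi>_def
      by (intro borel_measurable_continuous_onI continuous_intros)
    fix k :: nat
    have "emeasure lborel {z. \<psi> z \<le> 2 ^ k * r}
      \<le> ennreal (4 ^ D * unit_ball_vol D * (h / \<kappa>) * (2 ^ k * r) * (1 + (2 ^ k * r / \<eta>) ^ (D - 1)))"
      unfolding \<psi>_def D_def
      by (rule emeasure_neighbourhood_le[OF cpt ne H[unfolded D_def] pos(1-3) _ reg[unfolded D_def]]) (use pos in auto)
    also have "\<dots> \<le> ennreal (B * 2 ^ (k * D))"
    proof (rule ennreal_leI)
      \<comment> \<open>Neighbourhoods of radius \<open>2 ^ k * r\<close> grow at most like
        \<open>2 ^ (k * D)\<close>: one factor \<open>2 ^ k\<close> comes from the radius, the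
        others from the power \<open>D - 1\<close>.\<close>
      have "2 ^ k * (1 + (2 ^ k * r / \<eta>) ^ (D - 1)) \<le> 2 ^ (k * D) * (1 + (r / \<eta>) ^ (D - 1))"
      proof -
        have "2 ^ (k * D) = (2 :: real) ^ k * (2 ^ k) ^ (D - 1)"
          by (subst D1) (simp add: power_mult power_add)
        moreover have "1 + (2 ^ k * r / \<eta>) ^ (D - 1) \<le> (2 ^ k) ^ (D - 1) * (1 + (r / \<eta>) ^ (D - 1))"
        proof -
          have "(2 ^ k * r / \<eta>) ^ (D - 1) = (2 ^ k) ^ (D - 1) * (r / \<eta>) ^ (D - 1)"
            by (simp add: power_mult_distrib power_divide)
          moreover have "(1::real) \<le> (2 ^ k) ^ (D - 1)" by (intro one_le_power) simp
          ultimately show ?thesis by (simp only: distrib_left mult_1_right add_right_mono)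
        qed
        ultimately show ?thesis by (simp add: mult.assoc)
      qed
      hence "(4 ^ D * unit_ball_vol D * (h / \<kappa>) * r) * (2 ^ k * (1 + (2 ^ k * r / \<eta>) ^ (D - 1)))
         \<le> (4 ^ D * unit_ball_vol D * (h / \<kappa>) * r) * (2 ^ (k * D) * (1 + (r / \<eta>) ^ (D - 1)))"
        using pos by (intro mult_left_mono) auto
      thus "4 ^ D * unit_ball_vol D * (h / \<kappa>) * (2 ^ k * r) * (1 + (2 ^ k * r / \<eta>) ^ (D - 1)) \<le> B * 2 ^ (k * D)"
        by (simp add: B_def mult_ac)
    qed
    finally show "emeasure lborel {z. \<psi> z \<le> 2 ^ k * r} \<le> ennreal (B * 2 ^ (k * D))" .
  next
    fix z assume z: "r < \<psi> z"
    hence pz: "0 < \<psi> z" using pos by linarith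
    have "\<tau> * \<Psi> z \<le> \<tau> * (M\<^sup>2 * ?I / \<psi> z ^ (2 * n))"
      unfolding \<Psi>_def using \<tau>0 by (intro mult_left_mono tail_le decay pz) auto
    also have "\<dots> = (\<tau> * M\<^sup>2) * (?I / \<psi> z ^ (2 * n))" by simp
    also have "\<dots> \<le> r ^ (2 * n) * (?I / \<psi> z ^ (2 * n))"
      using r decay_const_nonneg[where 'b = "'a \<times> 'a"] pz by (intro mult_right_mono) auto
    also have "\<dots> = ?I * (r / \<psi> z) ^ (2 * n)" by (simp add: power_divide)
    \<comment> \<open>Here \<open>r / \<psi> z < 1\<close>, and \<open>n \<ge> DIM('a) + 1\<close>
      gives \<open>2 * n \<ge> D + 1\<close>, the order that the dyadic sum requires.\<close>
    also have "\<dots> \<le> ?I * (r / \<psi> z) ^ (D + 1)"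
      using n z pz pos decay_const_nonneg[where 'b = "'a \<times> 'a"] by (intro mult_left_mono power_decreasing) (auto simp: D_def)
    finally show "min 1 (\<tau> * \<Psi> z) \<le> ?I * (r / \<psi> z) ^ (D + 1)" by simp
  qed (use pos B0 decay_const_nonneg[where 'b = "'a \<times> 'a"] in auto)
  have em: "emeasure lborel \<Omega> = ennreal (measure lborel \<Omega>)"
    using \<Omega>_finite by (intro emeasure_eq_ennreal_measure) auto
  have upper: "real n \<le> measure lborel \<Omega> + E" if "eigenfam \<delta> n u l" for n u l
  proof -
    have "of_nat n \<le> emeasure lborel \<Omega> + (\<integral>\<^sup>+z. ennreal (min 1 (\<tau> * \<Psi> z)) \<partial>lborel)"
      by (rule eigenfam_upper[OF that \<delta>(1) \<tau>(1) _ \<Psi>0]) (simp add: \<Psi>_def \<psi>_def W_tfshift_outside)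
    also have "\<dots> \<le> ennreal (measure lborel \<Omega>) + ennreal E" unfolding em using int by (rule add_left_mono)
    finally have "ennreal (real n) \<le> ennreal (measure lborel \<Omega> + E)"
      using E0 by (simp add: ennreal_of_nat_eq_real_of_nat)
    thus ?thesis using E0 by (subst (asm) ennreal_le_iff) auto
  qed
  obtain N where N: "maximal_eigenfam \<delta> N"
  proof (rule maximal_eigenfam_exists)
    fix n u l assume "eigenfam \<delta> n u l"
    from upper[OF this] show "n \<le> nat \<lceil>measure lborel \<Omega> + E\<rceil>" by linarith
  qed
  have "real N \<le> measure lborel \<Omega> + E" using N upper by (auto simp: maximal_eigenfam_def)
  moreover have "measure lborel \<Omega> \<le> real N + E"
  proof -
    have "emeasure lborel \<Omega> \<le> of_nat N + (\<integral>\<^sup>+z. ennreal (min 1 (\<tau> * \<Psi> z)) \<partial>lborel)"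
      by (rule eigenfam_lower[OF N \<delta> \<tau>(2) _ \<Psi>0]) (simp add: \<Psi>_def \<psi>_def W_tfshift_inside)
    also have "\<dots> \<le> of_nat N + ennreal E" using int by (rule add_left_mono)
    finally have "ennreal (measure lborel \<Omega>) \<le> ennreal (real N + E)"
      using E0 by (simp add: em ennreal_of_nat_eq_real_of_nat)
    thus ?thesis using E0 by (subst (asm) ennreal_le_iff) auto
  qed
  ultimately have "\<bar>real N - measure lborel \<Omega>\<bar> \<le> E" by linarith
  moreover have "eigenvalue_count S \<delta> = of_nat N" by (rule eigenvalue_count_maximal[OF _ N]) (rule S)
  ultimately show ?thesis unfolding E_def B_def by blast
qed

end

section \<open>Dilation of the boundary data\<close>

lemma frontier_scaleR:
  fixes S :: "'a::euclidean_space set"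
  assumes "R \<noteq> 0"
  shows "frontier ((\<lambda>x. R *\<^sub>R x) ` S) = (\<lambda>x. R *\<^sub>R x) ` frontier S"
proof -
  have inj: "inj (\<lambda>x::'a. R *\<^sub>R x)" using assms by (auto simp: inj_on_def)
  have "interior ((\<lambda>x. R *\<^sub>R x) ` S) = (\<lambda>x. R *\<^sub>R x) ` interior S"
    by (rule interior_injective_linear_image[OF _ inj]) (rule linear_scaleR)
  thus ?thesis unfolding frontier_def closure_scaleR[symmetric] by (simp add: image_set_diff[OF inj])
qed

lemma boundary_kappa_le:
  fixes \<Omega> :: "'b::euclidean_space set"
  assumes "0 < r" "r \<le> \<eta>" "z \<in> frontier \<Omega>"
  shows "boundary_kappa \<eta> \<Omega> * ennreal (r ^ (DIM('b) - 1)) \<le> hausdorff_measure (DIM('b) - 1) (frontier \<Omega> \<inter> ball z r)"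
proof -
  let ?q = "ennreal (r ^ (DIM('b) - 1))" and ?H = "hausdorff_measure (DIM('b) - 1) (frontier \<Omega> \<inter> ball z r)"
  have "boundary_kappa \<eta> \<Omega> \<le> ?H / ?q"
    unfolding boundary_kappa_def using assms by (intro INF_lower2[of r] INF_lower) auto
  hence "boundary_kappa \<eta> \<Omega> * ?q \<le> ?H / ?q * ?q" by (rule mult_right_mono) simp
  also have "\<dots> = ?H" using assms by (simp add: ennreal_divide_times ennreal_divide_self)
  finally show ?thesis .
qed

lemma boundary_kappa_pos:
  fixes \<Omega> :: "'b::euclidean_space set"
  assumes "regular_boundary \<eta> \<Omega>"
  shows "0 < boundary_kappa \<eta> \<Omega>"
proof -
  obtain \<kappa> where \<kappa>: "\<kappa> > 0" "\<And>r z. 0 < r \<Longrightarrow> r \<le> \<eta> \<Longrightarrow> z \<in> frontier \<Omega> \<Longrightarrow>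
      ennreal (\<kappa> * r ^ (DIM('b) - 1)) \<le> hausdorff_measure (DIM('b) - 1) (frontier \<Omega> \<inter> ball z r)"
    using assms by (auto simp: regular_boundary_def)
  have "ennreal \<kappa> \<le> boundary_kappa \<eta> \<Omega>"
    unfolding boundary_kappa_def
  proof (intro INF_greatest)
    fix r z assume rz: "r \<in> {0<..\<eta>}" "z \<in> frontier \<Omega>"
    have "ennreal \<kappa> = ennreal (\<kappa> * r ^ (DIM('b) - 1)) / ennreal (r ^ (DIM('b) - 1))"
      using rz \<kappa>(1) by (subst divide_ennreal) auto
    also have "\<dots> \<le> hausdorff_measure (DIM('b) - 1) (frontier \<Omega> \<inter> ball z r) / ennreal (r ^ (DIM('b) - 1))"
      using rz by (intro divide_right_mono_ennreal \<kappa>(2)) auto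
    finally show "ennreal \<kappa> \<le> \<dots>" .
  qed
  thus ?thesis using \<kappa>(1) by (meson ennreal_less_zero_iff less_le_trans)
qed

text \<open>Superadditivity over a one-point index set, for which separation is vacuous.\<close>

lemma hausdorff_measure_mono:
  assumes "A \<subseteq> B"
  shows "hausdorff_measure s A \<le> hausdorff_measure s B"
  using hausdorff_measure_separated_sum[of "{()}" "\<lambda>_. A" B 1 s] assms by simp

text \<open>A single boundary point tested at radius \<eta> suffices. Finiteness matters because
  \<open>enn2real\<close> in the final bound would send an infinite value to 0.\<close>

lemma boundary_kappa_finite:
  fixes \<Omega> :: "'b::euclidean_space set"
  assumes "\<eta> > 0" "frontier \<Omega> \<noteq> {}" "hausdorff_measure (DIM('b) - 1) (frontier \<Omega>) < \<infinity>"
  shows "boundary_kappa \<eta> \<Omega> < \<infinity>"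
proof -
  obtain z where z: "z \<in> frontier \<Omega>" using assms by blast
  have "boundary_kappa \<eta> \<Omega> * ennreal (\<eta> ^ (DIM('b) - 1)) \<le> hausdorff_measure (DIM('b) - 1) (frontier \<Omega> \<inter> ball z \<eta>)"
    by (rule boundary_kappa_le[OF assms(1) order_refl z])
  also have "\<dots> \<le> hausdorff_measure (DIM('b) - 1) (frontier \<Omega>)" by (rule hausdorff_measure_mono) auto
  also note assms(3)
  finally show ?thesis using assms(1) by (auto simp: ennreal_mult_less_top)
qed

lemma hausdorff_measure_empty [simp]: "hausdorff_measure s {} = 0"
proof -
  have "hausdorff_premeasure s \<epsilon> ({} :: 'a set) \<le> 0" if "\<epsilon> > 0" for \<epsilon>
    using hausdorff_premeasure_le[of "{} :: 'a set" "\<lambda>_. {}" \<epsilon> s] that by (simp add: diameter_def)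
  hence "hausdorff_measure s ({} :: 'a set) \<le> 0" unfolding hausdorff_measure_def by (intro SUP_least) auto
  thus ?thesis by simp
qed

text \<open>The dilated set is regular at scale \<open>R * \<eta>\<close> with the same constant,
  since both sides of the regularity inequality scale by \<open>R ^ (D - 1)\<close>.\<close>

lemma hausdorff_ball_scaleR:
  fixes \<Omega> :: "'b::euclidean_space set"
  assumes "R > 0" "0 < r" "r \<le> R * \<eta>" "z \<in> frontier ((\<lambda>z. R *\<^sub>R z) ` \<Omega>)"
    and "ennreal \<kappa> \<le> boundary_kappa \<eta> \<Omega>" "\<kappa> \<ge> 0"
  shows "ennreal (\<kappa> * r ^ (DIM('b) - 1)) \<le>
    hausdorff_measure (DIM('b) - 1) (frontier ((\<lambda>z. R *\<^sub>R z) ` \<Omega>) \<inter> ball z r)"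
proof -
  let ?s = "DIM('b) - 1"
  obtain z0 where z0: "z0 \<in> frontier \<Omega>" "z = R *\<^sub>R z0"
    using assms(1,4) by (auto simp: frontier_scaleR)
  have sub: "(\<lambda>z. R *\<^sub>R z) ` (frontier \<Omega> \<inter> ball z0 (r / R)) \<subseteq> frontier ((\<lambda>z. R *\<^sub>R z) ` \<Omega>) \<inter> ball z r"
  proof
    fix y assume "y \<in> (\<lambda>z. R *\<^sub>R z) ` (frontier \<Omega> \<inter> ball z0 (r / R))"
    then obtain x where x: "x \<in> frontier \<Omega>" "dist z0 x < r / R" "y = R *\<^sub>R x" by auto
    have "dist z y = R * dist z0 x"
      using assms(1) by (simp add: z0(2) x(3) dist_norm scaleR_diff_right[symmetric] del: scaleR_diff_right)
    also have "\<dots> < r" using x(2) assms(1) by (simp add: field_simps)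
    finally show "y \<in> frontier ((\<lambda>z. R *\<^sub>R z) ` \<Omega>) \<inter> ball z r"
      using x assms(1) by (auto simp: frontier_scaleR)
  qed
  have "ennreal (\<kappa> * r ^ ?s) = ennreal (R ^ ?s) * (ennreal \<kappa> * ennreal ((r / R) ^ ?s))"
    using assms by (simp add: ennreal_mult[symmetric] power_divide)
  also have "\<dots> \<le> ennreal (R ^ ?s) * (boundary_kappa \<eta> \<Omega> * ennreal ((r / R) ^ ?s))"
    by (intro mult_left_mono mult_right_mono assms) auto
  also have "\<dots> \<le> ennreal (R ^ ?s) * hausdorff_measure ?s (frontier \<Omega> \<inter> ball z0 (r / R))"
    using assms(1-3) z0(1) by (intro mult_left_mono boundary_kappa_le) (auto simp: field_simps)
  also have "\<dots> \<le> hausdorff_measure ?s ((\<lambda>z. R *\<^sub>R z) ` (frontier \<Omega> \<inter> ball z0 (r / R)))"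
    by (rule hausdorff_measure_scaleR_ge[OF assms(1)])
  also have "\<dots> \<le> hausdorff_measure ?s (frontier ((\<lambda>z. R *\<^sub>R z) ` \<Omega>) \<inter> ball z r)"
    by (rule hausdorff_measure_mono[OF sub])
  finally show ?thesis .
qed

text \<open>Allows the doubly logarithmic factor to be introduced at the cost of a factor 3 in the
  constant.\<close>

lemma log_log_lower_bound:
  fixes \<tau> :: real
  assumes "\<tau> \<ge> 2"
  shows "1 / 3 \<le> ln (ln \<tau> + 1)"
proof -
  have "2 / 3 \<le> ln \<tau>" using ln2_ge_two_thirds ln_mono[of 2 \<tau>] assms by linarith
  hence "ln (5 / 3) \<le> ln (ln \<tau> + 1)" by (intro ln_mono) auto
  moreover have "ln (3 / 5) \<le> (3 / 5 :: real) - 1" by (rule ln_le_minus_one) simp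
  moreover have "ln (3 / 5 :: real) = - ln (5 / 3)" using ln_inverse[of "5 / 3 :: real"] by simp
  ultimately show ?thesis by simp
qed

theorem corollary1p3:
  shows "\<exists>C::real. C > 0 \<and>
    (\<forall>(\<Omega> :: ((real ^ 'n) \<times> (real ^ 'n)) set) (\<eta>::real) (g :: real ^ 'n \<Rightarrow> complex)
      (\<beta>::real) (Cg::real) (A::real) (\<delta>::real) (\<tau>::real) (R::real).
      compact \<Omega> \<longrightarrow>
      0 < hausdorff_measure (2 * CARD('n) - 1) (frontier \<Omega>) \<longrightarrow>
      hausdorff_measure (2 * CARD('n) - 1) (frontier \<Omega>) < \<infinity> \<longrightarrow>
      \<eta> > 0 \<longrightarrow> regular_boundary \<eta> \<Omega> \<longrightarrow>
      g \<in> L2 \<longrightarrow> L2_norm g = 1 \<longrightarrow>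
      \<beta> \<ge> 1 / 2 \<longrightarrow> Cg > 0 \<longrightarrow> A > 0 \<longrightarrow>
      (\<forall>(n::nat) z. cmod (stft g g z) \<le> Cg * A ^ n * (fact n) powr \<beta> / (1 + norm z) ^ n) \<longrightarrow>
      0 < \<delta> \<longrightarrow> \<delta> < 1 \<longrightarrow> \<tau> = max (1 / \<delta>) (1 / (1 - \<delta>)) \<longrightarrow> R > 0 \<longrightarrow>
      \<bar>enn2ereal (eigenvalue_count (concentration_op g ((\<lambda>z. R *\<^sub>R z) ` \<Omega>)) \<delta>)
         - ereal (measure lebesgue ((\<lambda>z. R *\<^sub>R z) ` \<Omega>))\<bar>
      \<le> ereal (sqrt Cg * A ^ (3 * CARD('n) + 2) * C powr \<beta>
          * enn2real (hausdorff_measure (2 * CARD('n) - 1) (frontier ((\<lambda>z. R *\<^sub>R z) ` \<Omega>)))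
          * (ln \<tau>) powr \<beta>
          * (1 + (ln \<tau>) powr ((2 * real CARD('n) - 1) * \<beta>) / (R * \<eta>) ^ (2 * CARD('n) - 1))
          * (ln (ln \<tau> + 1) / enn2real (boundary_kappa \<eta> \<Omega>))))"
proof -
  define d where "d = CARD('n)"
  define c0 where "c0 = 4 ^ (2 * d) * unit_ball_vol (real (2 * d)) * (1 + decay_const TYPE((real ^ 'n) \<times> (real ^ 'n)) * 2 ^ (2 * d + 1))"
  \<comment> \<open>The square compensates the smallest exponent \<open>\<beta> = 1 / 2\<close>: for
    every admissible \<beta>, \<open>C1 powr \<beta>\<close> is at least \<open>3 * c0\<close>,
    where the 3 pays for the doubly logarithmic factor.\<close>
  define C1 where "C1 = (max 1 (3 * c0))\<^sup>2"
  have d1: "d \<ge> 1" by (simp add: d_def Suc_leI)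
  have dimD: "DIM((real ^ 'n) \<times> (real ^ 'n)) = 2 * d" by (simp add: d_def)
  have c00: "c0 \<ge> 0" unfolding c0_def
    using decay_const_nonneg[where 'b = "(real ^ 'n) \<times> (real ^ 'n)"] by (intro mult_nonneg_nonneg add_nonneg_nonneg) auto
  have C1: "C1 \<ge> 1" unfolding C1_def by (rule one_le_power) simp
  obtain K where K1: "K \<ge> 1" and K: "\<And>\<beta> Cg A \<tau> :: real. \<beta> \<ge> 1 / 2 \<Longrightarrow> Cg > 0 \<Longrightarrow> A > 0 \<Longrightarrow> \<tau> \<ge> 2 \<Longrightarrow>
    (\<forall>n::nat. 1 \<le> Cg * A ^ n * (fact n) powr \<beta>) \<Longrightarrow>
    (\<exists>n r. n \<ge> d + 1 \<and> r > 0 \<and> \<tau> * (Cg * A ^ (n + d + 1) * (fact (n + d + 1)) powr \<beta>)\<^sup>2 \<le> r ^ (2 * n) \<and>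
       (\<forall>k\<in>{1..2 * d}. r ^ k \<le> sqrt Cg * A ^ (3 * d + 2) * K powr \<beta> * ln \<tau> powr (real k * \<beta>)))"
    using decay_scale[OF d1] by blast
  show ?thesis
  proof (intro exI[of _ "K * C1"] conjI allI impI)
    show "K * C1 > 0" using K1 C1 by (intro mult_pos_pos) auto
    fix \<Omega> :: "((real ^ 'n) \<times> (real ^ 'n)) set" and \<eta> :: real and g :: "real ^ 'n \<Rightarrow> complex"
      and \<beta> Cg A \<delta> \<tau> R :: real
    assume \<Omega>: "compact \<Omega>" and H0: "0 < hausdorff_measure (2 * CARD('n) - 1) (frontier \<Omega>)"
      and Hfin: "hausdorff_measure (2 * CARD('n) - 1) (frontier \<Omega>) < \<infinity>"
      and \<eta>: "\<eta> > 0" and reg: "regular_boundary \<eta> \<Omega>" and g: "g \<in> L2" "L2_norm g = 1"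
      and \<beta>: "\<beta> \<ge> 1 / 2" and Cg: "Cg > 0" and A: "A > 0"
      and decay: "\<forall>(n::nat) z. cmod (stft g g z) \<le> Cg * A ^ n * (fact n) powr \<beta> / (1 + norm z) ^ n"
      and \<delta>: "0 < \<delta>" "\<delta> < 1" and \<tau>: "\<tau> = max (1 / \<delta>) (1 / (1 - \<delta>))" and R: "R > 0"
    let ?R\<Omega> = "(\<lambda>z. R *\<^sub>R z) ` \<Omega>"
    obtain g' where g': "sqint lborel g'" "AE t in lborel. g' t = g t" using L2_borel_representative[OF g(1)] .
    have g'm: "g' \<in> borel_measurable borel" using g'(1) by simp
    have g'1: "nsq lborel g' = 1" using sqint_lebesgue_iff(2)[OF g'm g'(2)] g(2) by simp
    have R\<Omega>: "compact ?R\<Omega>" using \<Omega> by (rule compact_scaling)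
    interpret window g' ?R\<Omega> by standard (use g' g'1 R\<Omega> in auto)
    have stft_g: "stft g g = stft g' g'" by (rule stft_cong_AE[OF g'm g'm g'(2) g'(2)])
    have ne: "frontier \<Omega> \<noteq> {}" using H0 by auto
    have neR: "frontier ?R\<Omega> \<noteq> {}" using ne R by (simp add: frontier_scaleR)
    have HRfin: "hausdorff_measure (2 * d - 1) (frontier ?R\<Omega>) < \<infinity>"
      using hausdorff_measure_scaleR_finite[OF R Hfin] R by (simp add: frontier_scaleR d_def)
    define h where "h = enn2real (hausdorff_measure (2 * d - 1) (frontier ?R\<Omega>))"
    define \<kappa> where "\<kappa> = enn2real (boundary_kappa \<eta> \<Omega>)"
    have h: "hausdorff_measure (2 * d - 1) (frontier ?R\<Omega>) \<le> ennreal h" "h \<ge> 0"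
      using HRfin by (auto simp: h_def)
    have kfin: "boundary_kappa \<eta> \<Omega> < \<infinity>"
      by (rule boundary_kappa_finite[OF \<eta> ne, unfolded dimD d_def, OF Hfin])
    have \<kappa>: "\<kappa> > 0" "ennreal \<kappa> \<le> boundary_kappa \<eta> \<Omega>"
      using boundary_kappa_pos[OF reg] kfin by (auto simp: \<kappa>_def enn2real_positive_iff)
    have \<tau>2: "\<tau> \<ge> 2"
    proof (cases "\<delta> \<le> 1 / 2")
      case True
      hence "2 \<le> 1 / \<delta>" using \<delta> by (simp add: field_simps)
      thus ?thesis by (simp add: \<tau>)
    next
      case False
      hence "2 \<le> 1 / (1 - \<delta>)" using \<delta> by (simp add: field_simps)
      thus ?thesis by (simp add: \<tau>)
    qed
    \<comment> \<open>At the origin \<open>stft g g\<close> equals the squared norm of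
      \<open>g\<close>, that is 1, and the weight \<open>(1 + norm z) ^ n\<close> is 1 too.\<close>
    have lower: "\<forall>n::nat. 1 \<le> Cg * A ^ n * (fact n) powr \<beta>"
    proof
      fix n :: nat
      have t0: "tfshift 0 = g'" by (auto simp: tfshift_def)
      have "stft g' g' 0 = 1" using stft_ip[OF g'(1), of 0] g'1 by (simp add: t0 ip_self)
      thus "1 \<le> Cg * A ^ n * (fact n) powr \<beta>" using decay[rule_format, of 0 n] by (simp add: stft_g)
    qed
    obtain n r where n: "n \<ge> d + 1" and r: "r > 0"
      and rn: "\<tau> * (Cg * A ^ (n + d + 1) * (fact (n + d + 1)) powr \<beta>)\<^sup>2 \<le> r ^ (2 * n)"
      and rk: "\<And>k. k \<in> {1..2 * d} \<Longrightarrow> r ^ k \<le> sqrt Cg * A ^ (3 * d + 2) * K powr \<beta> * ln \<tau> powr (real k * \<beta>)"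
      using K[OF \<beta> Cg A \<tau>2 lower] by blast
    let ?S = "concentration_op g ?R\<Omega>"
    have S: "?S f = T f'" if f': "sqint lborel f'" "AE t in lborel. f' t = f t" for f f'
    proof -
      have "?S f = synth g' (\<lambda>z. indicator ?R\<Omega> z * stft g' f' z)"
        by (rule concentration_op_cong_AE[OF _ g'm \<Omega>_borel f'(2) g'(2)]) (use f'(1) in simp)
      thus ?thesis by (simp add: T_def W_def[abs_def])
    qed
    have "\<exists>N. eigenvalue_count ?S \<delta> = of_nat N \<and> \<bar>real N - measure lborel ?R\<Omega>\<bar>
     \<le> 4 ^ (2 * d) * unit_ball_vol (real (2 * d)) * (h / \<kappa>) * r * (1 + (r / (R * \<eta>)) ^ (2 * d - 1))
        * (1 + decay_const TYPE((real ^ 'n) \<times> (real ^ 'n)) * 2 ^ (2 * d + 1))"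
    proof (rule eigenvalue_count_deviation[unfolded dimD])
      show "?S f = T f'" if "sqint lborel f'" "AE t in lborel. f' t = f t" for f f' using that by (rule S)
      show "1 / \<delta> \<le> \<tau>" "1 / (1 - \<delta>) \<le> \<tau>" by (auto simp: \<tau>)
      show "ennreal (\<kappa> * r ^ (2 * d - 1)) \<le> hausdorff_measure (2 * d - 1) (frontier ?R\<Omega> \<inter> ball z r)"
        if "0 < r" "r \<le> R * \<eta>" "z \<in> frontier ?R\<Omega>" for r z
        using hausdorff_ball_scaleR[OF R that \<kappa>(2) less_imp_le[OF \<kappa>(1)]] unfolding dimD .
      show "cmod (stft g' g' w) \<le> Cg * A ^ (n + d + 1) * (fact (n + d + 1)) powr \<beta> / (1 + norm w) ^ (n + DIM(real ^ 'n) + 1)" for w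
        using decay[rule_format, of w "n + d + 1"] by (simp add: stft_g d_def)
      show "n \<ge> DIM(real ^ 'n) + 1" using n by (simp add: d_def)
    qed (use \<delta> neR h \<kappa> \<eta> R r rn in auto)
    then obtain N where N: "eigenvalue_count ?S \<delta> = of_nat N" and dev: "\<bar>real N - measure lborel ?R\<Omega>\<bar>
     \<le> c0 * (h / \<kappa>) * (r * (1 + (r / (R * \<eta>)) ^ (2 * d - 1)))"
      unfolding c0_def by (auto simp: mult_ac)
    let ?X = "sqrt Cg * A ^ (3 * d + 2) * K powr \<beta>" and ?L = "ln \<tau>"
    let ?Y = "1 + ?L powr ((2 * real d - 1) * \<beta>) / (R * \<eta>) ^ (2 * d - 1)"
    have R\<eta>: "R * \<eta> > 0" using R \<eta> by simp
    \<comment> \<open>The case \<open>k = 1\<close> bounds the term \<open>r\<close>, and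
      \<open>k = 2 * d\<close> bounds the product of \<open>r\<close> with
      \<open>r ^ (2 * d - 1)\<close>; one factor \<open>ln \<tau> powr \<beta>\<close> is split off
      the latter.\<close>
    have radius: "r * (1 + (r / (R * \<eta>)) ^ (2 * d - 1)) \<le> ?X * ?L powr \<beta> * ?Y"
    proof -
      have "r ^ 1 \<le> ?X * ?L powr (real 1 * \<beta>)" by (rule rk) (use d1 in auto)
      moreover have "r ^ (2 * d) \<le> ?X * ?L powr (real (2 * d) * \<beta>)" by (rule rk) (use d1 in auto)
      moreover have "r * r ^ (2 * d - 1) = r ^ (2 * d)" using d1 by (simp flip: power_Suc)
      moreover have "?L powr (real (2 * d) * \<beta>) = ?L powr \<beta> * ?L powr ((2 * real d - 1) * \<beta>)"
        by (simp add: powr_add[symmetric] algebra_simps)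
      ultimately have 1: "r \<le> ?X * ?L powr \<beta>"
        and 2: "r * r ^ (2 * d - 1) \<le> ?X * ?L powr \<beta> * ?L powr ((2 * real d - 1) * \<beta>)" by (simp_all add: mult.assoc)
      have "r * (r / (R * \<eta>)) ^ (2 * d - 1) = r * r ^ (2 * d - 1) / (R * \<eta>) ^ (2 * d - 1)" by (simp add: power_divide)
      also have "\<dots> \<le> ?X * ?L powr \<beta> * ?L powr ((2 * real d - 1) * \<beta>) / (R * \<eta>) ^ (2 * d - 1)"
        by (rule divide_right_mono[OF 2]) (use R\<eta> in simp)
      finally show ?thesis using 1 unfolding distrib_left by simp
    qed
    have hk: "0 \<le> h / \<kappa>" using h \<kappa> by simp
    have rad0: "0 \<le> r * (1 + (r / (R * \<eta>)) ^ (2 * d - 1))"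
      using r R \<eta> by (intro mult_nonneg_nonneg add_nonneg_nonneg zero_le_power divide_nonneg_nonneg) auto
    have const: "c0 \<le> C1 powr \<beta> * ln (?L + 1)"
    proof -
      have "3 * c0 \<le> max 1 (3 * c0)" by simp
      also have "\<dots> = C1 powr (1 / 2)" unfolding C1_def by (simp add: powr_half_sqrt)
      also have "\<dots> \<le> C1 powr \<beta>" using C1 \<beta> by (intro powr_mono) auto
      finally have "3 * c0 * (1 / 3) \<le> C1 powr \<beta> * ln (?L + 1)"
        using log_log_lower_bound[OF \<tau>2] by (intro mult_mono) auto
      thus ?thesis by simp
    qed
    have "\<bar>real N - measure lborel ?R\<Omega>\<bar> \<le> c0 * (h / \<kappa>) * (r * (1 + (r / (R * \<eta>)) ^ (2 * d - 1)))" by (rule dev)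
    also have "\<dots> \<le> (C1 powr \<beta> * ln (?L + 1)) * (h / \<kappa>) * (?X * ?L powr \<beta> * ?Y)"
      by (rule mult_mono[OF mult_right_mono[OF const hk] radius mult_nonneg_nonneg[OF order_trans[OF c00 const] hk] rad0])
    also have "\<dots> = sqrt Cg * A ^ (3 * d + 2) * (K * C1) powr \<beta> * h * ?L powr \<beta> * ?Y * (ln (?L + 1) / \<kappa>)"
      by (simp add: powr_mult)
    finally have fin: "\<bar>real N - measure lborel ?R\<Omega>\<bar> \<le> sqrt Cg * A ^ (3 * d + 2) * (K * C1) powr \<beta> * h * ?L powr \<beta> * ?Y * (ln (?L + 1) / \<kappa>)" .
    have "measure lebesgue ?R\<Omega> = measure lborel ?R\<Omega>" using \<Omega>_borel by (simp add: measure_completion)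
    moreover have "enn2ereal (of_nat N) = ereal (real N)"
      by (simp add: ennreal_of_nat_eq_real_of_nat enn2ereal_ennreal)
    ultimately have "\<bar>enn2ereal (eigenvalue_count ?S \<delta>) - ereal (measure lebesgue ?R\<Omega>)\<bar> = ereal \<bar>real N - measure lborel ?R\<Omega>\<bar>"
      by (simp add: N)
    thus "\<bar>enn2ereal (eigenvalue_count ?S \<delta>) - ereal (measure lebesgue ?R\<Omega>)\<bar>
      \<le> ereal (sqrt Cg * A ^ (3 * CARD('n) + 2) * (K * C1) powr \<beta>
          * enn2real (hausdorff_measure (2 * CARD('n) - 1) (frontier ?R\<Omega>))
          * (ln \<tau>) powr \<beta>
          * (1 + (ln \<tau>) powr ((2 * real CARD('n) - 1) * \<beta>) / (R * \<eta>) ^ (2 * CARD('n) - 1))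
          * (ln (ln \<tau> + 1) / enn2real (boundary_kappa \<eta> \<Omega>)))"
      using fin unfolding d_def h_def \<kappa>_def by (simp only: ereal_less_eq)
  qed
qed

end
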